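(* There is a randomized online algorithm for edge-weighted online bipartite matching (with free disposal) that is $\Gamma$-competitive for $\Gamma = 0.5368$.
   Context: Edge-weighted online bipartite matching with free disposal: there is a bipartite graph with offline vertex set $L$, known in advance, and online vertices $j\in R$ that arrive one at a time. When $j$ arrives, the nonnegative weights $w_{ij}$ for all $i\in L$ are revealed ($w_{ij}=0$ means there is no edge). Before the next arrival, the algorithm must irrevocably assign $j$ to at most one offline vertex. An offline vertex may be assigned several online vertices, and its contribution to the objective is the largest weight $w_{ij}$ among the online vertices $j$ assigned to it (0 if none). The objective is the sum of these contributions over $i\in L$. A randomized algorithm is $\Gamma$-competitive if, on every instance, the expected value of its objective is at least $\Gamma$ times the maximum weight of a matching in the (offline) graph. *)

theory Defs
  imports "HOL-Probability.Probability"
begin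

text \<open>
  The online vertices are \<open>0, \<dots>, length ws - 1\<close> in order of arrival, and \<open>(ws ! j) i\<close> is the
  weight \<open>w\<^sub>i\<^sub>j\<close>. Requiring weight 0 outside \<open>L\<close> ensures that a weight function carries no
  information beyond the weights on \<open>L\<close>.
\<close>

definition online_instance :: "'l set \<Rightarrow> ('l \<Rightarrow> real) list \<Rightarrow> bool" where
  "online_instance L ws \<longleftrightarrow>
     finite L \<and> (\<forall>w\<in>set ws. (\<forall>i\<in>L. 0 \<le> w i) \<and> (\<forall>i. i \<notin> L \<longrightarrow> w i = 0))"

definition edges :: "'l set \<Rightarrow> ('l \<Rightarrow> real) list \<Rightarrow> ('l \<times> nat) set" where
  "edges L ws = {(i, j). i \<in> L \<and> j < length ws \<and> (ws ! j) i \<noteq> 0}"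

definition matchings :: "'l set \<Rightarrow> ('l \<Rightarrow> real) list \<Rightarrow> ('l \<times> nat) set set" where
  "matchings L ws =
     {E. E \<subseteq> edges L ws \<and> (\<forall>e\<in>E. \<forall>f\<in>E. e \<noteq> f \<longrightarrow> fst e \<noteq> fst f \<and> snd e \<noteq> snd f)}"

definition max_matching_weight :: "'l set \<Rightarrow> ('l \<Rightarrow> real) list \<Rightarrow> real" where
  "max_matching_weight L ws = Max ((\<lambda>E. \<Sum>(i, j)\<in>E. (ws ! j) i) ` matchings L ws)"

lemma finite_matchings: "finite L \<Longrightarrow> finite (matchings L ws)"
proof -
  assume "finite L"
  then have "finite (L \<times> {..<length ws})" by simp
  moreover have "edges L ws \<subseteq> L \<times> {..<length ws}" by (auto simp: edges_def)
  ultimately have "finite (Pow (edges L ws))" by (simp add: finite_subset)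
  then show ?thesis by (rule rev_finite_subset) (auto simp: matchings_def)
qed

lemma empty_in_matchings: "{} \<in> matchings L ws"
  by (simp add: matchings_def)

text \<open>
  A deterministic online algorithm \<open>A\<close> maps the offline side \<open>L\<close>, the weight functions \<open>past\<close> of
  the earlier arrivals (in order of arrival) and the weight function \<open>w\<close> of the arriving vertex
  to its decision for that vertex; \<open>None\<close> leaves the vertex unassigned. The earlier decisions
  are not an argument because they are determined by \<open>A\<close>, \<open>L\<close> and \<open>past\<close>.
\<close>

type_synonym 'l det_online_alg =
  "'l set \<Rightarrow> ('l \<Rightarrow> real) list \<Rightarrow> ('l \<Rightarrow> real) \<Rightarrow> 'l option"

definition det_online_algorithm :: "'l det_online_alg \<Rightarrow> bool" where
  "det_online_algorithm A \<longleftrightarrow>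
     (\<forall>L past w. online_instance L (past @ [w]) \<longrightarrow> A L past w \<in> insert None (Some ` L))"

definition assigned :: "'l det_online_alg \<Rightarrow> 'l set \<Rightarrow> ('l \<Rightarrow> real) list \<Rightarrow> nat \<Rightarrow> 'l option" where
  "assigned A L ws j = A L (take j ws) (ws ! j)"

definition alg_value :: "'l det_online_alg \<Rightarrow> 'l set \<Rightarrow> ('l \<Rightarrow> real) list \<Rightarrow> real" where
  "alg_value A L ws =
     (\<Sum>i\<in>L. Max (insert 0 {(ws ! j) i | j. j < length ws \<and> assigned A L ws j = Some i}))"

text \<open>
  A randomized online algorithm is a probability distribution over deterministic online
  algorithms. The measurability condition says that each decision is a random variable.
\<close>

definition randomized_online_algorithm :: "'l det_online_alg measure \<Rightarrow> bool" where
  "randomized_online_algorithm M \<longleftrightarrow>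
     prob_space M \<and>
     (\<forall>A\<in>space M. det_online_algorithm A) \<and>
     (\<forall>L past w. online_instance L (past @ [w]) \<longrightarrow>
        (\<lambda>A. A L past w) \<in> measurable M (count_space UNIV))"

definition competitive :: "real \<Rightarrow> 'l det_online_alg measure \<Rightarrow> bool" where
  "competitive \<Gamma> M \<longleftrightarrow>
     (\<forall>L ws. online_instance L ws \<longrightarrow>
        (\<integral>A. alg_value A L ws \<partial>M) \<ge> \<Gamma> * max_matching_weight L ws)"

end

theory Submission imports Defs begin

text \<open>
  Every round is split into \<open>m\<close> equal slots, which are given one after the other to the offline
  vertex with the largest residual offer, as in the greedy primal-dual algorithm. The round is then
  awarded to one of the vertices holding a slot, with negative correlation over time: the units
  obtained by an offline vertex are numbered consecutively from a random offset and grouped into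
  cells of \<open>l\<close> units, and each cell owns one uniform seed. The pieces of a cell that belong to
  different rounds use disjoint parts of the range of that seed, so at most one of them becomes a
  candidate. The strongest candidate of a round wins; if there is none, a uniformly chosen slot
  wins. A vertex then loses all rounds that offer it weight at least \<open>u\<close> with probability at most
  the product over its cells of \<open>G n\<close>, where \<open>n\<close> counts the units of those rounds in the cell.
  Each such unit lowers this bound by at least a \<open>1 / m\<close> fraction of a continuation value, and the
  deficits of the continuation values, integrated over \<open>u\<close>, serve as dual variables. With
  \<open>m = 25\<close> and \<open>l = 15\<close> the ratio is about 0.5374.
\<close>

section \<open>The loss potential of a flag sequence\<close>

text \<open>Exclusive candidacies are the gain over independent rounds: the chances of the
  \<open>n\<close> units of a cell to win as candidates add up to \<open>n * \<eta> / m\<close>,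
  where independence would only multiply factors \<open>1 - \<eta> / m\<close>. Wins in rounds
  without candidates have no such exclusion and enter \<open>H\<close> through the factors
  \<open>1 - \<epsilon> / m\<close>. The obstacle is that rounds are also coupled through the seeds
  of all rivals. For fixed own seeds, a negative dependence argument decouples the rivals; the
  levels to be beaten then behave as independent variables with an explicit law, and only the
  correlation of the own seeds is left to analyse. The discount \<open>m / (m + 1)\<close> is
  dictated by duality: with it, the drop of the loss bound splits exactly into a
  \<open>1 / m\<close> share for the online vertex and the rise of the offline dual. The random
  offset is needed because irrelevant units move a vertex through its cell without lowering its
  loss; only the average over all positions gives a fresh vertex a value, \<open>\<Gamma>\<close>,
  that such units leave unchanged.\<close>

text \<open>
  A state \<open>(p, k, n)\<close> records the product \<open>p\<close> of the bounds of the completed cells, the number \<open>k\<close>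
  of units in the current cell (including the initial offset), and the number \<open>n\<close> of relevant ones
  among them.
\<close>

definition step :: "(nat \<Rightarrow> real) \<Rightarrow> nat \<Rightarrow> bool \<Rightarrow> real \<times> nat \<times> nat \<Rightarrow> real \<times> nat \<times> nat" where
  "step G l b s = (case s of (p, k, n) \<Rightarrow>
     let n' = (if b then Suc n else n)
     in if Suc k = l then (p * G n', 0, 0) else (p, Suc k, n'))"

text \<open>The open cell is charged as if it ended here; with \<open>G 0 = 1\<close> this agrees
  with the product that \<open>step\<close> forms when the cell is really closed.\<close>

definition sval :: "(nat \<Rightarrow> real) \<Rightarrow> real \<times> nat \<times> nat \<Rightarrow> real" where
  "sval G s = (case s of (p, k, n) \<Rightarrow> p * G n)"

definition run :: "(nat \<Rightarrow> real) \<Rightarrow> nat \<Rightarrow> nat \<Rightarrow> bool list \<Rightarrow> real \<times> nat \<times> nat" where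
  "run G l off fl = fold (step G l) fl (1, off, 0)"

lemma run_snoc: "run G l off (fl @ [b]) = step G l b (run G l off fl)"
  by (simp add: run_def)

lemma run_Nil: "run G l off [] = (1, off, 0)"
  by (simp add: run_def)

text \<open>Convexity makes an earlier relevant unit worth at least as much as a later one in its
  cell. Submultiplicativity gives \<open>gain n \<ge> G n * gain 0\<close>, so the relative drop is
  smallest at the start of a cell; this compares the value of the next cell with the current
  drop.\<close>

locale unsel_bound =
  fixes m l :: nat and G :: "nat \<Rightarrow> real"
  assumes m_pos: "0 < m" and l_pos: "0 < l"
    and G0: "G 0 = 1"
    and G_nonneg: "n \<le> l \<Longrightarrow> 0 \<le> G n"
    and G_dec: "n < l \<Longrightarrow> G (Suc n) \<le> G n"
    and G_convex: "Suc n < l \<Longrightarrow> G (Suc n) - G (Suc (Suc n)) \<le> G n - G (Suc n)"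
    and G_submult: "n < l \<Longrightarrow> G (Suc n) \<le> G n * G 1"
begin

text \<open>
  \<open>Pv r n\<close> is the total decrease of the loss bound, discounted by \<open>\<theta>\<close> per unit, if only relevant
  units follow, \<open>n\<close> units of the current cell are relevant and \<open>r\<close> are still to come. Its value
  \<open>V0\<close> at the start of a cell solves the fixed point equation \<open>Pv l 0 = V0\<close>.
\<close>

definition \<theta> :: real where "\<theta> = m / (m + 1)"
definition gain :: "nat \<Rightarrow> real" where "gain n = G n - G (Suc n)"
definition V0 :: real where
  "V0 = (\<Sum>t<l. \<theta> ^ Suc t * gain t) / (1 - \<theta> ^ l * G l)"
definition Pv :: "nat \<Rightarrow> nat \<Rightarrow> real" where
  "Pv r n = (\<Sum>t<r. \<theta> ^ Suc t * gain (n + t)) + \<theta> ^ r * G (n + r) * V0"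
text \<open>The value of a vertex without relevant units whose position in its cell is
  uniform.\<close>

definition \<Gamma> :: real where "\<Gamma> = (\<Sum>k<l. Pv (l - k) 0) / l"
definition bval :: "real \<times> nat \<times> nat \<Rightarrow> real" where
  "bval s = (case s of (p, k, n) \<Rightarrow> p * Pv (l - k) n)"
text \<open>For positive \<open>r\<close> this equals
  \<open>(1 + 1 / m) * Pv r n - Pv (r - 1) n\<close>, the left side of the dual recursion when the
  unit is irrelevant and \<open>n\<close> does not grow.\<close>

definition slope :: "nat \<Rightarrow> nat \<Rightarrow> real" where
  "slope r n = gain n + Pv (r - 1) (Suc n) - Pv (r - 1) n"

section \<open>Discounted values within one cell\<close>

lemma theta: "0 < \<theta>" "\<theta> < 1" "\<theta> * (1 + real m) = m" "1 / \<theta> = 1 + 1 / m"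
  using m_pos by (auto simp: \<theta>_def field_simps)

lemma G_le_1: "n \<le> l \<Longrightarrow> G n \<le> 1"
proof (induction n)
  case (Suc n)
  then show ?case using G_dec[of n] by simp
qed (simp add: G0)

lemma gain_nonneg: "n < l \<Longrightarrow> 0 \<le> gain n"
  using G_dec by (simp add: gain_def)

lemma gain_dec: "Suc n < l \<Longrightarrow> gain (Suc n) \<le> gain n"
  using G_convex by (simp add: gain_def)

lemma denom_pos: "0 < 1 - \<theta> ^ l * G l"
proof -
  have "\<theta> ^ l < 1" using theta l_pos by (simp add: power_less_one_iff)
  moreover have "\<theta> ^ l * G l \<le> \<theta> ^ l * 1"
    using theta G_le_1[of l] by (intro mult_left_mono) auto
  ultimately show ?thesis by simp
qed

lemma Pv_Suc: "Pv (Suc r) n = \<theta> * (gain n + Pv r (Suc n))"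
  by (simp add: Pv_def sum.lessThan_Suc_shift sum_distrib_left algebra_simps del: sum.lessThan_Suc)

text \<open>Equivalently, \<open>gain n = Pv (Suc r) n / m + (Pv (Suc r) n - Pv r (Suc n))\<close>:
  the drop of the loss bound pays the share of the online vertex and the fall of the value, which is
  the rise of the dual. This identity is the reason for the choice of
  \<open>\<theta>\<close>.\<close>

lemma Pv_unfold: "(1 + 1 / m) * Pv (Suc r) n = gain n + Pv r (Suc n)"
proof -
  have "(1 + 1 / m) * \<theta> = 1" using theta(1) unfolding theta(4)[symmetric] by simp
  then show ?thesis by (simp add: Pv_Suc mult.assoc[symmetric])
qed

lemma Pv_0: "Pv 0 n = G n * V0"
  by (simp add: Pv_def)

lemma V0_fix: "Pv l 0 = V0"
proof -
  have "V0 * (1 - \<theta> ^ l * G l) = (\<Sum>t<l. \<theta> ^ Suc t * gain t)"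
    using denom_pos by (simp add: V0_def)
  then show ?thesis by (simp add: Pv_def algebra_simps)
qed

lemma V0_nonneg: "0 \<le> V0"
  unfolding V0_def using denom_pos theta gain_nonneg
  by (intro divide_nonneg_pos sum_nonneg mult_nonneg_nonneg) auto

text \<open>Because \<open>\<theta> < 1\<close>, each discounted drop is at most
  \<open>\<theta> ^ k * G k - \<theta> ^ Suc k * G (Suc k)\<close>, and these differences telescope
  to the denominator of \<open>V0\<close>.\<close>

lemma V0_le_1: "V0 \<le> 1"
proof -
  have tel: "(\<Sum>t<k. \<theta> ^ Suc t * gain t) \<le> 1 - \<theta> ^ k * G k" if "k \<le> l" for k
    using that
  proof (induction k)
    case (Suc k)
    have "\<theta> ^ Suc k * G k \<le> \<theta> ^ k * G k"
      using theta G_nonneg[of k] Suc by (intro mult_right_mono power_decreasing) auto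
    then have "\<theta> ^ Suc k * gain k \<le> \<theta> ^ k * G k - \<theta> ^ Suc k * G (Suc k)"
      by (simp add: gain_def algebra_simps)
    then show ?case using Suc by simp
  qed (simp add: G0)
  show ?thesis unfolding V0_def using tel[of l] denom_pos by (simp add: divide_le_eq)
qed

text \<open>By convexity the first drop is the largest, and a perpetual drop of
  \<open>gain 0\<close> has discounted value
  \<open>gain 0 * \<theta> / (1 - \<theta>) = m * gain 0\<close>.\<close>

lemma V0_le_gain: "V0 \<le> m * gain 0"
proof -
  have g: "gain t \<le> gain 0" if "t < l" for t
    using that
  proof (induction t)
    case (Suc t)
    then show ?case using gain_dec[of t] by simp
  qed simp
  have "(\<Sum>t<l. \<theta> ^ Suc t * gain t) \<le> (\<Sum>t<l. \<theta> ^ Suc t * gain 0)"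
    using theta g by (intro sum_mono mult_left_mono) auto
  also have "\<dots> = gain 0 * \<theta> * (\<Sum>t<l. \<theta> ^ t)"
    by (simp add: sum_distrib_left sum_distrib_right algebra_simps)
  also have "(\<Sum>t<l. \<theta> ^ t) = (1 - \<theta> ^ l) / (1 - \<theta>)"
    using theta by (simp add: sum_gp_strict)
  also have "gain 0 * \<theta> * ((1 - \<theta> ^ l) / (1 - \<theta>)) = m * gain 0 * (1 - \<theta> ^ l)"
  proof -
    have "\<theta> / (1 - \<theta>) = m" using m_pos by (simp add: \<theta>_def field_simps)
    then show ?thesis by (metis (no_types, opaque_lifting) mult.assoc mult.commute times_divide_eq_left times_divide_eq_right)
  qed
  also have "\<dots> \<le> m * gain 0 * (1 - \<theta> ^ l * G l)"
  proof -
    have "\<theta> ^ l * G l \<le> \<theta> ^ l * 1"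
      using theta G_le_1[of l] by (intro mult_left_mono) auto
    then show ?thesis using gain_nonneg[of 0] l_pos m_pos by (intro mult_left_mono) auto
  qed
  finally show ?thesis using denom_pos by (simp add: V0_def divide_le_eq)
qed

lemma Pv_nonneg: "n + r \<le> l \<Longrightarrow> 0 \<le> Pv r n"
  unfolding Pv_def using theta gain_nonneg G_nonneg V0_nonneg
  by (intro add_nonneg_nonneg sum_nonneg mult_nonneg_nonneg) auto

lemma slope_1: "slope (Suc 0) n = (1 - V0) * gain n"
  by (simp add: slope_def Pv_0 gain_def algebra_simps)

lemma slope_Suc: "slope (Suc (Suc r)) n = (1 - \<theta>) * gain n + \<theta> * slope (Suc r) (Suc n)"
  by (simp add: slope_def Pv_Suc algebra_simps)

text \<open>By \<open>slope_Suc\<close> a slope is a convex combination of \<open>gain n\<close> and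
  a slope with fewer units left, ending in \<open>(1 - V0) * gain\<close>. Sign and monotonicity are
  therefore inherited from \<open>gain\<close>, given \<open>V0 \<le> 1\<close>.\<close>

lemma slope_bounds: "n + Suc r \<le> l \<Longrightarrow> 0 \<le> slope (Suc r) n"
    "Suc n + Suc r \<le> l \<Longrightarrow> slope (Suc r) (Suc n) \<le> slope (Suc r) n"
proof (induction r arbitrary: n)
  case 0
  { case 1 then show ?case using gain_nonneg[of n] V0_le_1 by (simp add: slope_1) }
  { case 2 then show ?case using gain_dec[of n] V0_le_1 by (simp add: slope_1 mult_left_mono) }
next
  case (Suc r)
  { case 1 then show ?case unfolding slope_Suc using gain_nonneg[of n] Suc(1)[of "Suc n"] theta by simp }
  { case 2 then show ?case unfolding slope_Suc using gain_dec[of n] Suc(2)[of "Suc n"] theta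
      by (intro add_mono mult_left_mono) auto }
qed

lemma slope_le_0: "n + Suc r \<le> l \<Longrightarrow> slope (Suc r) n \<le> slope (Suc r) 0"
proof (induction n)
  case (Suc n)
  then show ?case using slope_bounds(2)[of n r] by simp
qed simp

lemma gain_hazard: "n < l \<Longrightarrow> G n * gain 0 \<le> gain n"
  using G_submult[of n] by (simp add: gain_def G0 algebra_simps)

text \<open>Within the cell the drops only decrease. The value of the next cell is the critical
  term: it is at most \<open>G n * V0 \<le> m * (G n * gain 0)\<close>, and submultiplicativity
  turns this into \<open>m * gain n\<close>.\<close>

lemma Pv_le_gain: "n + Suc r \<le> l \<Longrightarrow> Pv (Suc r) n \<le> m * gain n"
proof (induction r arbitrary: n)
  case 0
  have "G (Suc n) * V0 \<le> G n * V0"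
    using 0 G_dec[of n] V0_nonneg by (intro mult_right_mono) auto
  also have "\<dots> \<le> G n * (m * gain 0)"
    using 0 G_nonneg[of n] V0_le_gain by (intro mult_left_mono) auto
  also have "\<dots> \<le> m * gain n"
    using gain_hazard[of n] 0 m_pos by (simp add: algebra_simps)
  finally have "gain n + Pv 0 (Suc n) \<le> (1 + m) * gain n" by (simp add: Pv_0 algebra_simps)
  then have "Pv (Suc 0) n \<le> \<theta> * ((1 + m) * gain n)"
    unfolding Pv_Suc using theta by (intro mult_left_mono) auto
  then show ?case using theta(3) by (simp add: mult.assoc[symmetric])
next
  case (Suc r)
  have "m * gain (Suc n) \<le> m * gain n" using gain_dec[of n] Suc.prems by (intro mult_left_mono) auto
  then have "gain n + Pv (Suc r) (Suc n) \<le> (1 + m) * gain n"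
    using Suc.IH[of "Suc n"] Suc.prems by (simp add: algebra_simps)
  then have "Pv (Suc (Suc r)) n \<le> \<theta> * ((1 + m) * gain n)"
    unfolding Pv_Suc[of "Suc r"] using theta by (intro mult_left_mono) auto
  then show ?case using theta(3) by (simp add: mult.assoc[symmetric])
qed

lemma Pv_antimono: "Suc n + r \<le> l \<Longrightarrow> Pv r (Suc n) \<le> Pv r n"
proof (induction r arbitrary: n)
  case 0
  then show ?case using G_dec[of n] V0_nonneg by (simp add: Pv_0 mult_right_mono)
next
  case (Suc r)
  then show ?case unfolding Pv_Suc using theta gain_dec[of n] Suc.IH[of "Suc n"]
    by (intro mult_left_mono add_mono) auto
qed

lemma Pv_le_0: "n + r \<le> l \<Longrightarrow> Pv r n \<le> Pv r 0"
proof (induction n)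
  case (Suc n)
  then show ?case using Pv_antimono[of n r] by simp
qed simp

text \<open>Summed over all positions, the shift from \<open>l - k\<close> to
  \<open>l - Suc k\<close> merely exchanges \<open>Pv l 0\<close> for \<open>Pv 0 0\<close>, and
  both equal \<open>V0\<close>. Hence only the \<open>1 / m\<close> term survives. A single position
  offers no such cancellation.\<close>

lemma slope_sum: "(\<Sum>k<l. slope (l - k) 0) = l * (\<Gamma> / m)"
proof -
  have eq: "slope (l - k) 0 = (1 + 1 / m) * Pv (l - k) 0 - Pv (l - Suc k) 0" if "k < l" for k
  proof -
    have "l - k = Suc (l - Suc k)" using that by simp
    then have "(1 + 1 / m) * Pv (l - k) 0 = gain 0 + Pv (l - Suc k) (Suc 0)" by (metis Pv_unfold)
    then show ?thesis by (simp add: slope_def)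
  qed
  have "(\<Sum>k<l. Pv (l - Suc k) 0) + Pv l 0 = (\<Sum>k<Suc l. Pv (l - k) 0)"
    by (simp only: sum.lessThan_Suc_shift) simp
  also have "\<dots> = (\<Sum>k<l. Pv (l - k) 0) + Pv 0 0" by simp
  finally have "(\<Sum>k<l. Pv (l - Suc k) 0) = (\<Sum>k<l. Pv (l - k) 0)"
    by (simp add: Pv_0 V0_fix G0)
  moreover have "(\<Sum>k<l. slope (l - k) 0) = (1 + 1 / m) * (\<Sum>k<l. Pv (l - k) 0) - (\<Sum>k<l. Pv (l - Suc k) 0)"
    using eq by (simp add: sum_subtractf sum_distrib_left[symmetric])
  ultimately have "(\<Sum>k<l. slope (l - k) 0) = (1 / m) * (\<Sum>k<l. Pv (l - k) 0)"
    by (simp add: algebra_simps)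
  then show ?thesis using l_pos by (simp add: \<Gamma>_def)
qed

section \<open>Values along a run with a fixed offset\<close>

definition good_state :: "real \<times> nat \<times> nat \<Rightarrow> bool" where
  "good_state s = (case s of (p, k, n) \<Rightarrow> 0 \<le> p \<and> p \<le> 1 \<and> k < l \<and> n \<le> k)"

lemma good_step: "good_state s \<Longrightarrow> good_state (step G l b s)"
  using l_pos G_nonneg G_le_1
  by (auto simp: good_state_def step_def Let_def split: prod.splits intro!: mult_le_one)

lemma good_run: "off < l \<Longrightarrow> good_state (run G l off fl)"
  by (induction fl rule: rev_induct) (auto simp: run_snoc run_Nil good_step, simp add: good_state_def)

lemma sval_step_False: "good_state s \<Longrightarrow> sval G (step G l False s) = sval G s"
  by (auto simp: good_state_def step_def sval_def Let_def G0 split: prod.splits)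

lemma bval_step:
  assumes "good_state (p, k, n)"
  shows "bval (step G l b (p, k, n)) = p * Pv (l - Suc k) (if b then Suc n else n)"
  using assms by (auto simp: good_state_def step_def bval_def Let_def Pv_0 V0_fix)

lemma sval_step_True:
  assumes "good_state (p, k, n)"
  shows "sval G (p, k, n) - sval G (step G l True (p, k, n)) = p * gain n"
  using assms by (auto simp: good_state_def step_def sval_def Let_def G0 gain_def algebra_simps)

lemma bval_True:
  assumes "good_state s"
  shows "sval G s - sval G (step G l True s) = (1 + 1 / m) * bval s - bval (step G l True s)"
proof -
  obtain p k n where s: "s = (p, k, n)" by (cases s)
  have lk: "l - k = Suc (l - Suc k)" using assms s by (auto simp: good_state_def)
  have "(1 + 1 / m) * bval s = p * (gain n + Pv (l - Suc k) (Suc n))"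
    unfolding s bval_def prod.case lk Pv_unfold[symmetric] by simp
  then show ?thesis
    using assms bval_step[of p k n True] sval_step_True[of p k n] unfolding s by (simp add: algebra_simps)
qed

text \<open>The worst case for an irrelevant unit is a vertex without relevant units,
  \<open>p = 1\<close> and \<open>n = 0\<close>, since slopes are nonnegative and decrease in
  \<open>n\<close>.\<close>

lemma bval_False:
  assumes "good_state s"
  shows "(1 + 1 / m) * bval s - bval (step G l False s) \<le> slope (l - fst (snd s)) 0"
proof -
  obtain p k n where s: "s = (p, k, n)" by (cases s)
  have g: "0 \<le> p" "p \<le> 1" "k < l" "n \<le> k" using assms s by (auto simp: good_state_def)
  have lk: "l - k = Suc (l - Suc k)" using g by auto
  have "(1 + 1 / m) * bval s = p * (gain n + Pv (l - Suc k) (Suc n))"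
    unfolding s bval_def prod.case lk Pv_unfold[symmetric] by simp
  then have "(1 + 1 / m) * bval s - bval (step G l False s) = p * slope (l - k) n"
    using assms bval_step[of p k n False] unfolding s slope_def by (simp add: algebra_simps)
  also have "\<dots> \<le> 1 * slope (l - k) n"
    using g slope_bounds(1)[of n "l - Suc k"] lk by (intro mult_right_mono) auto
  also have "\<dots> \<le> slope (l - k) 0" using slope_le_0[of n "l - Suc k"] lk g by simp
  finally show ?thesis by (simp add: s)
qed

lemma bval_hazard:
  assumes "good_state s"
  shows "bval s / m \<le> sval G s - sval G (step G l True s)"
proof -
  obtain p k n where s: "s = (p, k, n)" by (cases s)
  have g: "0 \<le> p" "p \<le> 1" "k < l" "n \<le> k" using assms s by (auto simp: good_state_def)
  have lk: "l - k = Suc (l - Suc k)" using g by auto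
  have "bval s \<le> p * (m * gain n)"
    unfolding s bval_def using Pv_le_gain[of n "l - Suc k"] g lk by (auto intro!: mult_left_mono)
  then show ?thesis using sval_step_True[of p k n] assms m_pos unfolding s by (simp add: field_simps)
qed

lemma bval_le:
  assumes "good_state s"
  shows "0 \<le> bval s" "bval s \<le> Pv (l - fst (snd s)) 0"
proof -
  obtain p k n where s: "s = (p, k, n)" by (cases s)
  have g: "0 \<le> p" "p \<le> 1" "k < l" "n \<le> k" using assms s by (auto simp: good_state_def)
  show "0 \<le> bval s" unfolding s bval_def using g Pv_nonneg[of n "l - k"] by simp
  have "p * Pv (l - k) n \<le> 1 * Pv (l - k) n" using g Pv_nonneg[of n "l - k"] by (intro mult_right_mono) auto
  also have "\<dots> \<le> Pv (l - k) 0" using Pv_le_0[of n "l - k"] g by simp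
  finally show "bval s \<le> Pv (l - fst (snd s)) 0" by (simp add: s bval_def)
qed

lemma sval_bounds:
  assumes "good_state s"
  shows "0 \<le> sval G s" "sval G s \<le> 1"
  using assms G_nonneg G_le_1 by (auto simp: good_state_def sval_def split: prod.splits intro!: mult_le_one)

text \<open>The position ignores the flags, so a uniform offset yields a uniform position after
  every history, the same one for all weight levels.\<close>

lemma run_pos: "off < l \<Longrightarrow> fst (snd (run G l off fl)) = (off + length fl) mod l"
proof (induction fl rule: rev_induct)
  case (snoc b fl)
  obtain p k n where r: "run G l off fl = (p, k, n)" by (cases "run G l off fl")
  have "k = (off + length fl) mod l" "k < l" using snoc r good_run[of off fl] by (auto simp: good_state_def)
  then show ?case using r l_pos by (auto simp: run_snoc step_def Let_def mod_Suc)
qed (simp add: run_Nil)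

lemma run_no_True:
  "off < l \<Longrightarrow> True \<notin> set fl \<Longrightarrow> run G l off fl = (1, (off + length fl) mod l, 0)"
proof (induction fl rule: rev_induct)
  case (snoc b fl)
  have "run G l off fl = (1, (off + length fl) mod l, 0)" using snoc by auto
  moreover have "\<not> b" using snoc by auto
  ultimately show ?case by (auto simp: run_snoc step_def Let_def mod_Suc G0)
qed (simp add: run_Nil)

lemma sum_shift_mod: "(\<Sum>off<l. f ((off + d) mod l)) = (\<Sum>k<l. f k)"
proof (rule sum.reindex_bij_witness[where i = "\<lambda>k. (k + (l - d mod l)) mod l" and j = "\<lambda>off. (off + d) mod l"])
  fix a assume "a \<in> {..<l}"
  then have a: "a < l" by simp
  have "((a + d) mod l + (l - d mod l)) mod l = (a + d mod l + (l - d mod l)) mod l"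
    by (metis mod_add_left_eq mod_add_right_eq)
  also have "a + d mod l + (l - d mod l) = a + l"
    using mod_less_divisor[OF l_pos, of d] by linarith
  finally show "((a + d) mod l + (l - d mod l)) mod l = a" using a by simp
next
  fix b assume "b \<in> {..<l}"
  then have b: "b < l" by simp
  have "((b + (l - d mod l)) mod l + d) mod l = (b + (l - d mod l) + d mod l) mod l"
    by (metis mod_add_left_eq mod_add_right_eq)
  also have "b + (l - d mod l) + d mod l = b + l"
    using mod_less_divisor[OF l_pos, of d] by linarith
  finally show "((b + (l - d mod l)) mod l + d) mod l = b" using b by simp
qed (use l_pos in auto)

section \<open>Averages over a uniform offset\<close>

definition Sbar :: "bool list \<Rightarrow> real" where
  "Sbar fl = (\<Sum>off<l. sval G (run G l off fl)) / l"
definition Bbar :: "bool list \<Rightarrow> real" where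
  "Bbar fl = (\<Sum>off<l. bval (run G l off fl)) / l"

lemma Bbar_True: "Sbar fl - Sbar (fl @ [True]) = (1 + 1 / m) * Bbar fl - Bbar (fl @ [True])"
proof -
  have "(\<Sum>off<l. sval G (run G l off fl) - sval G (run G l off (fl @ [True])))
      = (\<Sum>off<l. (1 + 1 / m) * bval (run G l off fl) - bval (run G l off (fl @ [True])))"
    using bval_True[OF good_run] by (intro sum.cong) (auto simp: run_snoc)
  then have "(\<Sum>off<l. sval G (run G l off fl)) - (\<Sum>off<l. sval G (run G l off (fl @ [True])))
      = (1 + 1 / m) * (\<Sum>off<l. bval (run G l off fl)) - (\<Sum>off<l. bval (run G l off (fl @ [True])))"
    by (simp add: sum_subtractf sum_distrib_left)
  then show ?thesis unfolding Sbar_def Bbar_def by (simp only: diff_divide_distrib[symmetric] times_divide_eq_right)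
qed

lemma Sbar_False: "Sbar (fl @ [False]) = Sbar fl"
  unfolding Sbar_def using sval_step_False[OF good_run] by (auto simp: run_snoc)

text \<open>In terms of the deficit \<open>\<Gamma> - Bbar\<close>: an irrelevant unit raises it by
  at most a \<open>1 / m\<close> fraction of itself.\<close>

lemma Bbar_False: "(1 + 1 / m) * Bbar fl - Bbar (fl @ [False]) \<le> \<Gamma> / m"
proof -
  have "(\<Sum>off<l. (1 + 1 / m) * bval (run G l off fl) - bval (run G l off (fl @ [False])))
      \<le> (\<Sum>off<l. slope (l - (off + length fl) mod l) 0)"
    using bval_False[OF good_run] by (intro sum_mono) (auto simp: run_snoc run_pos[symmetric])
  also have "\<dots> = l * (\<Gamma> / m)"
    using sum_shift_mod[of "\<lambda>k. slope (l - k) 0" "length fl"] slope_sum by simp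
  finally have "(1 + 1 / m) * (\<Sum>off<l. bval (run G l off fl)) - (\<Sum>off<l. bval (run G l off (fl @ [False]))) \<le> l * (\<Gamma> / m)"
    by (simp add: sum_subtractf sum_distrib_left)
  then have "((1 + 1 / m) * (\<Sum>off<l. bval (run G l off fl)) - (\<Sum>off<l. bval (run G l off (fl @ [False])))) / l \<le> \<Gamma> / m"
    using l_pos by (simp add: divide_le_eq mult.commute)
  then show ?thesis unfolding Bbar_def by (simp only: diff_divide_distrib times_divide_eq_right)
qed

text \<open>Meant for units at which the dual, a running maximum, does not move: the drop alone then
  has to pay the share of the online vertex.\<close>

lemma Bbar_hazard: "Bbar fl / m \<le> Sbar fl - Sbar (fl @ [True])"
proof -
  have "(\<Sum>off<l. bval (run G l off fl) / m) \<le> (\<Sum>off<l. sval G (run G l off fl) - sval G (run G l off (fl @ [True])))"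
    using bval_hazard[OF good_run] by (intro sum_mono) (auto simp: run_snoc)
  then have "(\<Sum>off<l. bval (run G l off fl)) / m / l \<le> ((\<Sum>off<l. sval G (run G l off fl)) - (\<Sum>off<l. sval G (run G l off (fl @ [True])))) / l"
    using l_pos by (intro divide_right_mono) (auto simp: sum_subtractf sum_divide_distrib)
  then show ?thesis unfolding Bbar_def Sbar_def by (simp add: diff_divide_distrib mult.commute)
qed

lemma Bbar_bounds: "0 \<le> Bbar fl" "Bbar fl \<le> \<Gamma>"
proof -
  show "0 \<le> Bbar fl" unfolding Bbar_def using bval_le(1)[OF good_run] by (intro divide_nonneg_nonneg sum_nonneg) auto
  have "(\<Sum>off<l. bval (run G l off fl)) \<le> (\<Sum>off<l. Pv (l - (off + length fl) mod l) 0)"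
    using bval_le(2)[OF good_run] by (intro sum_mono) (auto simp: run_pos[symmetric])
  also have "\<dots> = (\<Sum>k<l. Pv (l - k) 0)"
    using sum_shift_mod[of "\<lambda>k. Pv (l - k) 0" "length fl"] by simp
  finally show "Bbar fl \<le> \<Gamma>" unfolding Bbar_def \<Gamma>_def by (intro divide_right_mono) auto
qed

lemma Sbar_bounds: "0 \<le> Sbar fl" "Sbar fl \<le> 1"
proof -
  show "0 \<le> Sbar fl" unfolding Sbar_def using sval_bounds(1)[OF good_run] by (intro divide_nonneg_nonneg sum_nonneg) auto
  have "(\<Sum>off<l. sval G (run G l off fl)) \<le> (\<Sum>off<l. 1)"
    using sval_bounds(2)[OF good_run] by (intro sum_mono) auto
  then show "Sbar fl \<le> 1" unfolding Sbar_def using l_pos by (simp add: divide_le_eq)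
qed

lemma no_True:
  assumes "True \<notin> set fl"
  shows "Sbar fl = 1" "Bbar fl = \<Gamma>"
proof -
  show "Sbar fl = 1" using run_no_True[OF _ assms] l_pos by (simp add: Sbar_def sval_def G0)
  have "(\<Sum>off<l. bval (run G l off fl)) = (\<Sum>off<l. Pv (l - (off + length fl) mod l) 0)"
    using run_no_True[OF _ assms] by (intro sum.cong) (auto simp: bval_def)
  also have "\<dots> = (\<Sum>k<l. Pv (l - k) 0)"
    using sum_shift_mod[of "\<lambda>k. Pv (l - k) 0" "length fl"] by simp
  finally show "Bbar fl = \<Gamma>" by (simp add: Bbar_def \<Gamma>_def)
qed

lemma Gamma_nonneg: "0 \<le> \<Gamma>"
  unfolding \<Gamma>_def using Pv_nonneg by (intro divide_nonneg_nonneg sum_nonneg) auto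

end

section \<open>Greedy slot assignment and its dual\<close>

definition flags :: "real \<Rightarrow> real list \<Rightarrow> bool list" where
  "flags u h = map (\<lambda>w. u \<le> w) h"

lemma flags_snoc: "flags u (h @ [w]) = flags u h @ [u \<le> w]"
  by (simp add: flags_def)

lemma flags_measurable: "(\<lambda>u. f (flags u h)) \<in> borel_measurable borel" for f :: "bool list \<Rightarrow> real"
proof (induction h arbitrary: f)
  case (Cons w h)
  have "(\<lambda>u. f (flags u (w # h)))
      = (\<lambda>u. if u \<le> w then f (True # flags u h) else f (False # flags u h))"
    by (auto simp: flags_def)
  moreover have "\<dots> \<in> borel_measurable borel"
    using Cons[of "\<lambda>x. f (True # x)"] Cons[of "\<lambda>x. f (False # x)"] by measurable
  ultimately show ?case by simp
qed (simp add: flags_def)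

section \<open>Integrals over weight levels\<close>

definition level_integral :: "(real \<Rightarrow> real) \<Rightarrow> real" where
  "level_integral f = (LINT u|lborel. indicator {0<..} u * f u)"

lemma level_integrable:
  fixes f :: "real \<Rightarrow> real"
  assumes "f \<in> borel_measurable borel" "\<And>u. u > b \<Longrightarrow> f u = 0" "\<And>u. \<bar>f u\<bar> \<le> c"
  shows "integrable lborel (\<lambda>u. indicator {0<..} u * f u :: real)"
proof -
  have "integrable lborel (\<lambda>u. indicator {0<..b} u *\<^sub>R f u)"
  proof (rule integrableI_bounded_set_indicator)
    show "AE u in lborel. u \<in> {0<..b} \<longrightarrow> norm (f u) \<le> c" using assms(3) by auto
    show "emeasure lborel {0<..b} < \<infinity>"
      by (rule emeasure_bounded_finite) (auto intro: bounded_subset[OF bounded_closed_interval[of 0 b]])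
  qed (use assms in auto)
  moreover have "(\<lambda>u. indicator {0<..b} u *\<^sub>R f u) = (\<lambda>u. indicator {0<..} u * f u)"
    using assms(2) by (auto simp: fun_eq_iff indicator_def not_le)
  ultimately show ?thesis by simp
qed

context unsel_bound begin

definition cost :: "real list \<Rightarrow> real" where
  "cost h = level_integral (\<lambda>u. \<Gamma> - Bbar (flags u h))"
text \<open>The layer-cake formula for an expected maximum, with \<open>1 - Sbar\<close> in place of
  the probability of obtaining weight at least \<open>u\<close>.\<close>

definition reward :: "real list \<Rightarrow> real" where
  "reward h = level_integral (\<lambda>u. 1 - Sbar (flags u h))"

lemma flags_above: "(\<And>w. w \<in> set h \<Longrightarrow> w \<le> b) \<Longrightarrow> u > b \<Longrightarrow> True \<notin> set (flags u h)"
  by (force simp: flags_def)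

lemma level_integrable_flags:
  assumes "\<And>fl. True \<notin> set fl \<Longrightarrow> f fl = 0" "\<And>fl. \<bar>f fl\<bar> \<le> c"
  shows "integrable lborel (\<lambda>u. indicator {0<..} u * f (flags u h) :: real)"
proof (rule level_integrable)
  have "w \<le> Max (insert 0 (set h))" if "w \<in> set h" for w
    using that by simp
  then show "f (flags u h) = 0" if "u > Max (insert 0 (set h))" for u
    using that assms(1) flags_above by metis
qed (use assms flags_measurable in auto)

lemma cost_integrable: "integrable lborel (\<lambda>u. indicator {0<..} u * (\<Gamma> - Bbar (flags u h)))"
proof (rule level_integrable_flags[of "\<lambda>fl. \<Gamma> - Bbar fl" \<Gamma>])
  show "\<bar>\<Gamma> - Bbar fl\<bar> \<le> \<Gamma>" for fl using Bbar_bounds[of fl] Gamma_nonneg by linarith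
qed (simp add: no_True)

lemma reward_integrable: "integrable lborel (\<lambda>u. indicator {0<..} u * (1 - Sbar (flags u h)))"
proof (rule level_integrable_flags[of "\<lambda>fl. 1 - Sbar fl" 1])
  show "\<bar>1 - Sbar fl\<bar> \<le> 1" for fl using Sbar_bounds[of fl] by linarith
qed (simp add: no_True)

lemma cost_nonneg: "0 \<le> cost h"
  unfolding cost_def level_integral_def using Bbar_bounds(2)
  by (intro Bochner_Integration.integral_nonneg) (auto simp: indicator_def)

lemma cost_Nil: "cost [] = 0"
  by (simp add: cost_def level_integral_def flags_def no_True)

lemma reward_Nil: "reward [] = 0"
  by (simp add: reward_def level_integral_def flags_def no_True)

lemma interval_integral:
  assumes "0 \<le> (w::real)"
  shows "integrable lborel (\<lambda>u. indicator {0<..w} u * c :: real)"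
    "(LINT u|lborel. indicator {0<..w} u * c) = w * c"
  using assms by simp_all

text \<open>At levels \<open>u \<le> w\<close> the unit is relevant and \<open>Bbar_True\<close>
  holds with equality; at levels above \<open>w\<close> the reward is constant and
  \<open>Bbar_False\<close> limits the rise of the cost. Integration over \<open>{0<..w}\<close>
  turns \<open>\<Gamma>\<close> into \<open>\<Gamma> * w\<close>. The second bound uses
  \<open>Bbar_hazard\<close> instead and says nothing about the new cost.\<close>

lemma reward_snoc:
  assumes "0 \<le> w"
  shows "reward (h @ [w]) - reward h \<ge> (\<Gamma> * w - cost h) / m + cost (h @ [w]) - cost h"
    and "reward (h @ [w]) - reward h \<ge> (\<Gamma> * w - cost h) / m"
proof -
  let ?i = "indicator {0<..} :: real \<Rightarrow> real"
  let ?R = "\<lambda>u. ?i u * (1 - Sbar (flags u (h @ [w]))) - ?i u * (1 - Sbar (flags u h))"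
  let ?C = "\<lambda>u. (indicator {0<..w} u * \<Gamma> - ?i u * (\<Gamma> - Bbar (flags u h))) / m"
  let ?D = "\<lambda>u. ?i u * (\<Gamma> - Bbar (flags u (h @ [w]))) - ?i u * (\<Gamma> - Bbar (flags u h))"
  have iR: "integrable lborel ?R" and iC: "integrable lborel ?C" and iD: "integrable lborel ?D"
    using reward_integrable cost_integrable interval_integral[OF assms] by auto
  have R: "(LINT u|lborel. ?R u) = reward (h @ [w]) - reward h"
    unfolding reward_def level_integral_def by (intro Bochner_Integration.integral_diff reward_integrable)
  have C: "(LINT u|lborel. ?C u) = (\<Gamma> * w - cost h) / m"
    unfolding cost_def level_integral_def
    using cost_integrable interval_integral[OF assms] by (simp add: mult.commute)
  have D: "(LINT u|lborel. ?D u) = cost (h @ [w]) - cost h"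
    unfolding cost_def level_integral_def by (intro Bochner_Integration.integral_diff cost_integrable)
  have 1: "?C u + ?D u \<le> ?R u" for u
    using Bbar_True[of "flags u h"] Bbar_False[of "flags u h"]
    by (cases "u \<le> w"; cases "0 < u")
      (simp_all add: indicator_def flags_snoc Sbar_False distrib_right diff_divide_distrib)
  have "(LINT u|lborel. ?C u + ?D u) \<le> (LINT u|lborel. ?R u)"
    by (intro integral_mono 1 Bochner_Integration.integrable_add iR iC iD)
  then show "reward (h @ [w]) - reward h \<ge> (\<Gamma> * w - cost h) / m + cost (h @ [w]) - cost h"
    unfolding Bochner_Integration.integral_add[OF iC iD] R C D by linarith
  have 2: "?C u \<le> ?R u" for u
    using Bbar_hazard[of "flags u h"] divide_right_mono[OF Bbar_bounds(2)[of "flags u h"], of m]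
    by (cases "u \<le> w"; cases "0 < u")
      (simp_all add: indicator_def flags_snoc Sbar_False distrib_right diff_divide_distrib)
  have "(LINT u|lborel. ?C u) \<le> (LINT u|lborel. ?R u)"
    by (intro integral_mono 2 iR iC)
  then show "reward (h @ [w]) - reward h \<ge> (\<Gamma> * w - cost h) / m"
    unfolding R C .
qed

text \<open>Offers made earlier are compared with the final prices, so prices must never decrease;
  taking the running maximum of \<open>cost\<close> guarantees this.\<close>

definition dual :: "real list \<Rightarrow> real" where
  "dual h = Max ((\<lambda>k. cost (take k h)) ` {..length h})"

lemma dual_Nil: "dual [] = 0"
  by (simp add: dual_def cost_Nil)

lemma dual_snoc: "dual (h @ [w]) = max (dual h) (cost (h @ [w]))"
proof -
  have "(\<lambda>k. cost (take k (h @ [w]))) ` {..length (h @ [w])}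
      = insert (cost (h @ [w])) ((\<lambda>k. cost (take k h)) ` {..length h})"
    by (auto simp: atMost_Suc)
  then show ?thesis by (simp add: dual_def max.commute)
qed

lemma cost_le_dual: "cost h \<le> dual h"
  unfolding dual_def by (rule Max_ge) (auto intro: image_eqI[of _ _ "length h"])

lemma dual_mono: "dual h \<le> dual (h @ h')"
  by (induction h' rule: rev_induct) (auto simp: dual_snoc append_assoc[symmetric] simp del: append_assoc)

text \<open>If the maximum moves, its rise is at most that of \<open>cost\<close>, and the first
  bound of \<open>reward_snoc\<close> pays for it; if it stays, the second bound suffices.\<close>

lemma reward_dual_snoc:
  assumes "0 \<le> w"
  shows "reward (h @ [w]) - dual (h @ [w]) \<ge> reward h - dual h + (\<Gamma> * w - dual h) / m"
proof -
  have le: "(\<Gamma> * w - dual h) / m \<le> (\<Gamma> * w - cost h) / m"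
    using cost_le_dual[of h] m_pos by (simp add: divide_right_mono)
  show ?thesis
    using reward_snoc[OF assms, of h] cost_le_dual[of h] le unfolding dual_snoc by (simp add: max_def)
qed

section \<open>Greedy slots\<close>

definition offer :: "('l \<Rightarrow> real) \<Rightarrow> ('l \<Rightarrow> real list) \<Rightarrow> 'l \<Rightarrow> real" where
  "offer w h i = \<Gamma> * w i - dual (h i)"

definition pick :: "'l set \<Rightarrow> ('l \<Rightarrow> real) \<Rightarrow> ('l \<Rightarrow> real list) \<Rightarrow> 'l option" where
  "pick L w h = (if \<exists>i\<in>L. 0 < offer w h i
     then Some (SOME i. i \<in> L \<and> (\<forall>k\<in>L. offer w h k \<le> offer w h i)) else None)"

definition add_unit :: "('l \<Rightarrow> real) \<Rightarrow> 'l option \<Rightarrow> ('l \<Rightarrow> real list) \<Rightarrow> 'l \<Rightarrow> real list" where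
  "add_unit w s h = (case s of None \<Rightarrow> h | Some i \<Rightarrow> h(i := h i @ [w i]))"

lemma add_unit_apply: "add_unit w s h i = h i @ (if s = Some i then [w i] else [])"
  by (auto simp: add_unit_def split: option.splits)

fun slots :: "nat \<Rightarrow> 'l set \<Rightarrow> ('l \<Rightarrow> real) \<Rightarrow> ('l \<Rightarrow> real list) \<Rightarrow> 'l option list \<times> ('l \<Rightarrow> real list)" where
  "slots 0 L w h = ([], h)"
| "slots (Suc k) L w h =
     (let s = pick L w h; (ss, h') = slots k L w (add_unit w s h) in (s # ss, h'))"

definition history :: "'l set \<Rightarrow> ('l \<Rightarrow> real) list \<Rightarrow> 'l \<Rightarrow> real list" where
  "history L ws = fold (\<lambda>w h. snd (slots m L w h)) ws (\<lambda>_. [])"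

lemma history_snoc: "history L (ws @ [w]) = snd (slots m L w (history L ws))"
  by (simp add: history_def)

lemma pick_Some:
  assumes "finite L" "pick L w h = Some i"
  shows "i \<in> L" "\<And>k. k \<in> L \<Longrightarrow> offer w h k \<le> offer w h i"
proof -
  have ne: "L \<noteq> {}" and i: "i = (SOME i. i \<in> L \<and> (\<forall>k\<in>L. offer w h k \<le> offer w h i))"
    using assms(2) by (auto simp: pick_def split: if_splits)
  have "Max (offer w h ` L) \<in> offer w h ` L" using assms(1) ne by (intro Max_in) auto
  then obtain i' where "i' \<in> L" "Max (offer w h ` L) = offer w h i'" by auto
  then have "\<exists>i. i \<in> L \<and> (\<forall>k\<in>L. offer w h k \<le> offer w h i)"
    using assms(1) by (metis Max_ge finite_imageI imageI)
  then have "i \<in> L \<and> (\<forall>k\<in>L. offer w h k \<le> offer w h i)"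
    unfolding i by (rule someI_ex)
  then show "i \<in> L" "\<And>k. k \<in> L \<Longrightarrow> offer w h k \<le> offer w h i" by auto
qed

lemma slots_props:
  assumes "finite L"
  shows "length (fst (slots k L w h)) = k"
    "set (fst (slots k L w h)) \<subseteq> insert None (Some ` L)"
    "snd (slots k L w h) i = h i @ replicate (count_list (fst (slots k L w h)) (Some i)) (w i)"
proof (induction k arbitrary: h)
  case (Suc k)
  { case 1 show ?case using Suc by (simp add: Let_def split_beta) }
  { case 2 show ?case using Suc pick_Some(1)[OF assms, of w h]
      by (cases "pick L w h") (auto simp: Let_def split_beta) }
  { case 3 show ?case using Suc(3)[of "add_unit w (pick L w h) h"]
      by (cases "pick L w h = Some i") (simp_all add: Let_def split_beta add_unit_apply[of _ _ _ i]) }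
qed auto

section \<open>Weak duality\<close>

definition potential :: "'l set \<Rightarrow> ('l \<Rightarrow> real list) \<Rightarrow> real" where
  "potential L h = (\<Sum>i\<in>L. reward (h i) - dual (h i))"

lemma potential_unit:
  assumes "finite L" "\<And>i. i \<in> L \<Longrightarrow> 0 \<le> w i" "k \<in> L"
  shows "potential L (add_unit w (pick L w h) h) \<ge> potential L h + max 0 (offer w h k) / m"
proof (cases "pick L w h")
  case None
  then have "offer w h k \<le> 0" using assms(3) by (force simp: pick_def not_less split: if_splits)
  then show ?thesis using None by (simp add: add_unit_def)
next
  case (Some i)
  note i = pick_Some[OF assms(1) Some]
  have pos: "0 \<le> offer w h i"
  proof -
    have "\<exists>k\<in>L. 0 < offer w h k" using Some by (auto simp: pick_def split: if_splits)
    then show ?thesis using i(2) by fastforce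
  qed
  have "potential L (h(i := h i @ [w i])) - potential L h
      = (reward (h i @ [w i]) - dual (h i @ [w i])) - (reward (h i) - dual (h i))"
    unfolding potential_def using assms(1) i(1)
    by (simp add: sum.remove[of L i])
  also have "\<dots> \<ge> offer w h i / m"
    using reward_dual_snoc[of "w i" "h i"] assms(2)[OF i(1)] by (simp add: offer_def)
  also have "offer w h i / m \<ge> max 0 (offer w h k) / m"
    using pos i(2)[OF assms(3)] by (intro divide_right_mono) auto
  finally show ?thesis using Some by (simp add: add_unit_def)
qed

text \<open>Prices only rise, so the final offer of a vertex is the smallest one it makes in this
  round. The greedy choice makes every slot worth at least a \<open>1 / m\<close> fraction of
  it.\<close>

lemma potential_slots:
  assumes "finite L" "\<And>i. i \<in> L \<Longrightarrow> 0 \<le> w i" "i \<in> L"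
  shows "potential L (snd (slots k L w h)) \<ge> potential L h + k * (max 0 (offer w (snd (slots k L w h)) i) / m)"
proof (induction k arbitrary: h)
  case (Suc k)
  let ?h = "add_unit w (pick L w h) h"
  have "dual (h i) \<le> dual (snd (slots (Suc k) L w h) i)"
    unfolding slots_props(3)[OF assms(1), of "Suc k"] by (rule dual_mono)
  then have "max 0 (offer w (snd (slots (Suc k) L w h)) i) / m \<le> max 0 (offer w h i) / m"
    by (intro divide_right_mono) (auto simp: offer_def)
  moreover have "potential L ?h \<ge> potential L h + max 0 (offer w h i) / m"
    by (rule potential_unit[OF assms])
  moreover have "snd (slots (Suc k) L w h) = snd (slots k L w ?h)"
    by (simp add: Let_def split_beta)
  ultimately show ?case using Suc.IH[of ?h] by (simp add: add_divide_distrib distrib_right)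
qed simp

text \<open>Weak duality: \<open>\<beta> j\<close>, the rise of the potential in round
  \<open>j\<close>, is the dual of the online vertex, and the final prices are the offline duals.
  The \<open>m\<close> slots of a round together cover the full final offer, which is dual
  feasibility, and all duals add up exactly to the total reward.\<close>

theorem reward_competitive:
  assumes inst: "online_instance L ws"
  shows "(\<Sum>i\<in>L. reward (history L ws i)) \<ge> \<Gamma> * max_matching_weight L ws"
proof -
  have fin: "finite L" and nn: "\<And>j i. j < length ws \<Longrightarrow> i \<in> L \<Longrightarrow> 0 \<le> (ws ! j) i"
    using inst by (auto simp: online_instance_def)
  define H where "H j = history L (take j ws)" for j
  define \<beta> where "\<beta> j = potential L (H (Suc j)) - potential L (H j)" for j
  have HS: "H (Suc j) = snd (slots m L (ws ! j) (H j))" if "j < length ws" for j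
    using that by (simp add: H_def take_Suc_conv_app_nth history_snoc)
  have Hmono: "dual (H j i) \<le> dual (H (Suc j) i)" if "j < length ws" for j i
    unfolding HS[OF that] slots_props(3)[OF fin] by (rule dual_mono)
  have Hfin: "dual (H j i) \<le> dual (H (length ws) i)" if "j \<le> length ws" for j i
    using that by (induction rule: inc_induct) (auto intro: order_trans Hmono)
  have \<beta>: "max 0 (\<Gamma> * (ws ! j) i - dual (H (length ws) i)) \<le> \<beta> j" if "j < length ws" "i \<in> L" for j i
  proof -
    have "potential L (snd (slots m L (ws ! j) (H j)))
        \<ge> potential L (H j) + m * (max 0 (offer (ws ! j) (snd (slots m L (ws ! j) (H j))) i) / m)"
      by (rule potential_slots) (use fin nn that in auto)
    then have "max 0 (offer (ws ! j) (H (Suc j)) i) \<le> \<beta> j"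
      unfolding \<beta>_def HS[OF that(1)] using m_pos by (simp add: max_def split: if_splits)
    moreover have "dual (H (Suc j) i) \<le> dual (H (length ws) i)" using Hfin that by simp
    ultimately show ?thesis by (simp add: offer_def)
  qed
  have \<beta>0: "0 \<le> \<beta> j" if "j < length ws" for j
  proof (cases "L = {}")
    case True then show ?thesis by (simp add: \<beta>_def potential_def)
  next
    case False then show ?thesis using \<beta>[OF that] by fastforce
  qed
  have dual0: "0 \<le> dual h" for h using cost_le_dual[of h] cost_nonneg[of h] by linarith
  have sum\<beta>: "(\<Sum>j<length ws. \<beta> j) = potential L (H (length ws))"
    unfolding \<beta>_def sum_lessThan_telescope[of "\<lambda>j. potential L (H j)"]
    by (simp add: H_def history_def potential_def reward_Nil dual_Nil)
  have match: "\<Gamma> * (\<Sum>(i, j)\<in>E. (ws ! j) i) \<le> (\<Sum>i\<in>L. reward (history L ws i))" if "E \<in> matchings L ws" for E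
  proof -
    have E: "E \<subseteq> edges L ws" and inj: "inj_on fst E" "inj_on snd E"
      using that by (auto simp: matchings_def inj_on_def)
    have Ein: "i \<in> L" "j < length ws" if "(i, j) \<in> E" for i j using E that by (auto simp: edges_def)
    have "\<Gamma> * (\<Sum>(i, j)\<in>E. (ws ! j) i) = (\<Sum>e\<in>E. \<Gamma> * (ws ! snd e) (fst e))"
      by (simp add: sum_distrib_left split_beta)
    also have "\<dots> \<le> (\<Sum>e\<in>E. \<beta> (snd e) + dual (H (length ws) (fst e)))"
    proof (rule sum_mono)
      fix e assume "e \<in> E"
      then show "\<Gamma> * (ws ! snd e) (fst e) \<le> \<beta> (snd e) + dual (H (length ws) (fst e))"
        using \<beta>[of "snd e" "fst e"] Ein[of "fst e" "snd e"] by simp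
    qed
    also have "\<dots> = (\<Sum>j\<in>snd ` E. \<beta> j) + (\<Sum>i\<in>fst ` E. dual (H (length ws) i))"
      by (simp add: sum.distrib sum.reindex[OF inj(1)] sum.reindex[OF inj(2)])
    also have "\<dots> \<le> (\<Sum>j<length ws. \<beta> j) + (\<Sum>i\<in>L. dual (H (length ws) i))"
      using Ein \<beta>0 dual0 fin by (intro add_mono sum_mono2) auto
    also have "\<dots> = (\<Sum>i\<in>L. reward (history L ws i))"
      by (simp add: sum\<beta> potential_def H_def sum_subtractf)
    finally show ?thesis .
  qed
  have "max_matching_weight L ws \<in> (\<lambda>E. \<Sum>(i, j)\<in>E. (ws ! j) i) ` matchings L ws"
    unfolding max_matching_weight_def using finite_matchings[OF fin] empty_in_matchings[of L ws]
    by (intro Max_in) auto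
  then show ?thesis using match by auto
qed

end

section \<open>Integrals over the strength of the rivals\<close>

text \<open>The condition \<open>half\<close> reads \<open>\<eta> * l / m \<le> 1 / 2\<close>: the
  candidate shares \<open>\<eta> / m\<close> of a full cell sum to at most one half. Through
  \<open>bilinear_bound\<close> it ensures that two cells touched by one round are no worse than
  independent ones; for fixed \<open>m\<close> it limits the length of cells.\<close>

locale cell_params =
  fixes m l :: nat
  assumes l2: "2 \<le> l" and lm: "l < m" and half: "(1 - (1 - 1 / l) ^ m) * l \<le> m / 2"
begin

text \<open>A unit is thought of as a candidate when a uniform variable exceeds
  \<open>\<rho>\<close>, which has probability \<open>1 / l\<close>. If the units of a round were
  independent, \<open>\<epsilon>\<close> would be the probability of no candidate, and by symmetry
  each unit would win with probability \<open>\<eta> / m\<close> as a candidate and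
  \<open>\<epsilon> / m\<close> blindly.\<close>

definition \<rho> :: real where "\<rho> = 1 - 1 / l"
definition \<epsilon> :: real where "\<epsilon> = \<rho> ^ m"
definition \<eta> :: real where "\<eta> = 1 - \<epsilon>"
definition H :: "nat \<Rightarrow> real" where "H n = (1 - \<epsilon> / m) ^ n * (1 - n * \<eta> / m)"
text \<open>The probability that \<open>n\<close> units of a round lose given that none of them is a
  candidate, the other \<open>m - n\<close> being independent.\<close>

definition u0 :: "nat \<Rightarrow> real" where "u0 n = 1 - n / m * \<rho> ^ (m - n)"

lemma rho: "0 < \<rho>" "\<rho> < 1" "0 \<le> \<rho>" "\<rho> \<le> 1"
  using l2 by (auto simp: \<rho>_def)

lemma eps: "0 < \<epsilon>" "\<epsilon> < 1" "0 < \<eta>" "\<eta> < 1"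
  using rho lm by (auto simp: \<epsilon>_def \<eta>_def power_less_one_iff)

lemma mpos: "0 < real m" "0 < m" "0 < l" "0 < real l"
  using lm l2 by auto

lemma eta_half: "\<eta> * l / m \<le> 1 / 2"
  using half mpos by (simp add: \<eta>_def \<epsilon>_def \<rho>_def field_simps)

lemma rho_power_ge: "1 - n / l \<le> \<rho> ^ n"
proof -
  have "1 + real n * (- 1 / l) \<le> (1 + - 1 / l) ^ n"
    using l2 by (intro Bernoulli_inequality) (simp add: field_simps)
  then show ?thesis by (simp add: \<rho>_def)
qed

text \<open>The left side is the chord from \<open>0\<close> to \<open>m\<close> of the concave
  function on the right.\<close>

lemma rho_power_chord: "n \<le> m \<Longrightarrow> n * \<eta> / m \<le> 1 - \<rho> ^ n"
proof (cases "n = 0")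
  case False
  assume "n \<le> m"
  have "real n * (\<Sum>i<m. \<rho> ^ i) \<le> real m * (\<Sum>i<n. \<rho> ^ i)"
  proof -
    have split: "(\<Sum>i<m. \<rho> ^ i) = (\<Sum>i<n. \<rho> ^ i) + (\<Sum>i\<in>{n..<m}. \<rho> ^ i)"
      using \<open>n \<le> m\<close> by (metis atLeast0LessThan le0 sum.atLeastLessThan_concat)
    have "(\<Sum>i\<in>{n..<m}. \<rho> ^ i) \<le> (\<Sum>i\<in>{n..<m}. \<rho> ^ n)"
      using rho by (intro sum_mono power_decreasing) auto
    then have 1: "real n * (\<Sum>i\<in>{n..<m}. \<rho> ^ i) \<le> real n * ((m - n) * \<rho> ^ n)"
      by (intro mult_left_mono) auto
    have "(\<Sum>i<n. \<rho> ^ n) \<le> (\<Sum>i<n. \<rho> ^ i)"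
      using rho by (intro sum_mono power_decreasing) auto
    then have 2: "(m - n) * (n * \<rho> ^ n) \<le> (m - n) * (\<Sum>i<n. \<rho> ^ i)"
      by (intro mult_left_mono) auto
    show ?thesis unfolding split using 1 2 \<open>n \<le> m\<close> by (simp add: algebra_simps of_nat_diff)
  qed
  then have "(1 - \<rho>) * (real n * (\<Sum>i<m. \<rho> ^ i)) \<le> (1 - \<rho>) * (real m * (\<Sum>i<n. \<rho> ^ i))"
    using rho by (intro mult_left_mono) auto
  moreover have "(1 - \<rho>) * (\<Sum>i<k. \<rho> ^ i) = 1 - \<rho> ^ k" for k
    using rho by (simp add: sum_gp_strict)
  ultimately have "real n * (1 - \<rho> ^ m) \<le> real m * (1 - \<rho> ^ n)"
    by (metis mult.left_commute)
  then show ?thesis using mpos by (simp add: \<eta>_def \<epsilon>_def field_simps)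
qed simp

lemma eps_split: "n \<le> m \<Longrightarrow> \<epsilon> = \<rho> ^ (m - n) * \<rho> ^ n"
  by (simp add: \<epsilon>_def power_add[symmetric])

lemma u0_bounds: "n \<le> m \<Longrightarrow> 0 \<le> u0 n" "u0 n \<le> 1"
proof -
  assume "n \<le> m"
  then have "n / m * \<rho> ^ (m - n) \<le> 1 * 1"
    using rho mpos by (intro mult_mono) (auto simp: power_le_one)
  then show "0 \<le> u0 n" by (simp add: u0_def)
next
  show "u0 n \<le> 1" using rho by (simp add: u0_def)
qed

text \<open>As \<open>rival (m - n)\<close> maps \<open>1\<close> to \<open>u0 n\<close> and
  \<open>v ^ n\<close> to \<open>1 - n / m\<close>, this says that the seed mass
  \<open>1 - v ^ n\<close> excluded by a lost round is on average at most
  \<open>n * \<eta> / m\<close>.\<close>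

lemma u0_mult_le:
  assumes "n \<le> m"
  shows "u0 n * (1 - n * \<eta> / m) \<le> 1 - n / m"
proof -
  define x where "x = n / m"
  define q where "q = \<rho> ^ (m - n)"
  have x: "0 \<le> x" and q: "0 < q" using rho by (auto simp: x_def q_def)
  have "q * \<rho> ^ n \<le> q * (1 - x * \<eta>)"
    using rho_power_chord[OF assms] q by (intro mult_left_mono) (auto simp: x_def)
  then have "1 - \<eta> \<le> q * (1 - x * \<eta>)"
    using eps_split[OF assms] by (simp add: \<eta>_def q_def)
  then have "x * (1 - \<eta>) \<le> x * (q * (1 - x * \<eta>))" using x by (intro mult_left_mono)
  then have "(1 - x * q) * (1 - x * \<eta>) \<le> 1 - x" by (simp add: algebra_simps)
  then show ?thesis by (simp add: u0_def x_def q_def)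
qed

lemma room_eq: "(real l - real n) * \<eta> / m = (\<eta> * l / m) * (1 - n / l)"
  using mpos by (simp add: field_simps)

text \<open>The left side is the probability of losing a round with \<open>n\<close> units while the
  seed avoids a set of mass \<open>s\<close> spent in earlier rounds: inside that set the vertex is
  no candidate and loses with probability \<open>u0 n\<close>.\<close>

lemma block_bound:
  assumes "n \<le> l" "0 \<le> s" "s \<le> (real l - real n) * \<eta> / m"
  shows "(1 - n / m) - s * u0 n \<le> (1 - \<epsilon> / m) ^ n * (1 - s - n * \<eta> / m)"
proof -
  define x where "x = n / m"
  define q where "q = \<rho> ^ (m - n)"
  define R where "R = \<rho> ^ n"
  have x: "0 \<le> x" and q: "0 < q" and R: "0 < R" "R \<le> 1"
    using rho by (auto simp: x_def q_def R_def power_le_one)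
  have qR: "\<epsilon> = q * R" using eps_split[of n] assms(1) lm by (simp add: q_def R_def)
  have "1 - n / l \<le> R" using rho_power_ge by (simp add: R_def)
  then have lR: "(real l - real n) * (1 - R) \<le> n * R" using mpos by (simp add: field_simps)
  have "s * (1 - R) \<le> ((real l - real n) * \<eta> / m) * (1 - R)"
    using assms R by (intro mult_right_mono) auto
  also have "\<dots> = ((real l - real n) * (1 - R)) * (\<eta> / m)" by simp
  also have "\<dots> \<le> (n * R) * (\<eta> / m)" using lR eps mpos by (intro mult_right_mono) auto
  finally have "s * (1 - R) \<le> R * \<eta> * x" by (simp add: x_def mult_ac)
  then have "(x * q) * (s * (1 - R)) \<le> (x * q) * (R * \<eta> * x)"
    using x q by (intro mult_left_mono) auto
  \<comment> \<open>Since \<open>\<epsilon> = q * R\<close> and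
    \<open>\<eta> = 1 - \<epsilon>\<close>, the sides differ by
    \<open>x * q * (R * \<eta> * x - s * (1 - R))\<close>.\<close>
  then have key: "(1 - x) - s * (1 - x * q) \<le> (1 - \<epsilon> * x) * (1 - s - \<eta> * x)"
    using qR by (simp add: \<eta>_def algebra_simps)
  have "s + \<eta> * x \<le> \<eta> * l / m"
  proof -
    have "(real l - real n) * \<eta> / m = \<eta> * l / m - \<eta> * x"
      by (simp add: x_def right_diff_distrib left_diff_distrib diff_divide_distrib mult.commute)
    then show ?thesis using assms(3) by linarith
  qed
  then have nn: "0 \<le> 1 - s - \<eta> * x" using eta_half by linarith
  have "1 + real n * (- \<epsilon> / m) \<le> (1 + - \<epsilon> / m) ^ n"
    using eps mpos by (intro Bernoulli_inequality) (simp add: field_simps)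
  then have "(1 - \<epsilon> * x) * (1 - s - \<eta> * x) \<le> (1 - \<epsilon> / m) ^ n * (1 - s - \<eta> * x)"
    using nn by (intro mult_right_mono) (simp_all add: x_def mult.commute)
  then show ?thesis using key by (simp add: u0_def x_def q_def mult.commute)
qed

lemma H_ge: "n \<le> l \<Longrightarrow> 1 - n / m \<le> H n"
  using block_bound[of n 0] eps by (simp add: H_def)

lemma u0_slack:
  assumes "n \<le> l" "0 \<le> s" "s \<le> (real l - real n) * \<eta> / m"
  shows "s * u0 n \<le> (1 - n / m) / 2"
proof -
  have "s * u0 n \<le> s" using mult_left_mono[of "u0 n" 1 s] assms u0_bounds(2)[of n] by simp
  also have "s \<le> (\<eta> * l / m) * (1 - n / l)"
    using assms(3) room_eq[of n] by linarith
  also have "\<dots> \<le> 1 / 2 * (1 - n / l)"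
    using eta_half assms(1) mpos by (intro mult_right_mono) (auto simp: field_simps)
  also have "\<dots> \<le> 1 / 2 * (1 - n / m)"
    using lm mpos by (intro mult_left_mono) (auto simp: frac_le)
  finally show ?thesis by simp
qed

text \<open>The right side exceeds the left by \<open>x * y * (1 - s * u / (1 - x) - t * v / (1 -
  y)) + s * t * (u * v - w)\<close>; the two factors one half in the hypotheses make the first
  bracket nonnegative.\<close>

lemma bilinear_bound:
  fixes x y s t u v w :: real
  assumes "0 \<le> x" "0 \<le> y" "x < 1" "y < 1" "0 \<le> s" "0 \<le> t"
    and "w \<le> u * v" "s * u \<le> (1 - x) / 2" "t * v \<le> (1 - y) / 2"
  shows "(1 - x - y) - s * ((1 - x - y) / (1 - x) * u) - t * ((1 - x - y) / (1 - y) * v) + s * t * w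
    \<le> (1 - x - s * u) * (1 - y - t * v)"
proof -
  have 1: "(1 - x - y) / (1 - x) = (1 - y) - x * y / (1 - x)"
    and 2: "(1 - x - y) / (1 - y) = (1 - x) - x * y / (1 - y)"
    using assms by (auto simp: field_simps)
  have "s * u / (1 - x) \<le> 1 / 2" "t * v / (1 - y) \<le> 1 / 2" using assms by (auto simp: field_simps)
  then have "s * u / (1 - x) + t * v / (1 - y) \<le> 1" by linarith
  then have "x * y * (s * u / (1 - x) + t * v / (1 - y)) \<le> x * y * 1"
    using assms by (intro mult_left_mono) auto
  moreover have "s * t * w \<le> s * t * (u * v)" using assms by (intro mult_left_mono) auto
  ultimately show ?thesis unfolding 1 2 by (simp add: algebra_simps)
qed

lemma u0_add_le:
  assumes "n + k \<le> m"
  shows "u0 (n + k) \<le> u0 n * u0 k"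
proof -
  define q r p where "q = \<rho> ^ (m - n)" "r = \<rho> ^ (m - k)" "p = \<rho> ^ (m - (n + k))"
  have "q \<le> p" "r \<le> p" using rho by (auto simp: q_r_p_def intro!: power_decreasing)
  then have "n / m * q + k / m * r \<le> n / m * p + k / m * p" by (intro add_mono mult_left_mono) auto
  moreover have "0 \<le> (n / m * q) * (k / m * r)" using rho by (simp add: q_r_p_def)
  moreover have "u0 (n + k) = 1 - (n / m * p + k / m * p)" by (simp add: u0_def q_r_p_def add_divide_distrib distrib_right)
  moreover have "u0 n * u0 k = 1 - (n / m * q + k / m * r) + (n / m * q) * (k / m * r)"
    by (simp add: u0_def q_r_p_def algebra_simps)
  ultimately show ?thesis by linarith
qed

text \<open>
  The integral against the law of the largest strength among \<open>M\<close> competing units, where the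
  mass at \<open>\<rho>\<close> (no competitor is a candidate) is reduced to the probability \<open>M / m\<close> that the
  uniformly chosen slot is one of theirs.
\<close>

definition rival :: "nat \<Rightarrow> (real \<Rightarrow> real) \<Rightarrow> real" where
  "rival M f = (LINT v|lborel. indicator {\<rho>..1} v * (M * v ^ (M - 1) * f v)) + M / m * \<rho> ^ M * f \<rho>"

lemma rival_integrable:
  assumes "continuous_on {\<rho>..1} f"
  shows "integrable lborel (\<lambda>v. indicator {\<rho>..1} v * (M * v ^ (M - 1) * f v) :: real)"
proof -
  have "integrable lborel (\<lambda>v. indicator {\<rho>..1} v *\<^sub>R (M * v ^ (M - 1) * f v))"
    using assms by (intro borel_integrable_compact continuous_intros) auto
  then show ?thesis by simp
qed

lemma rival_add:
  assumes "continuous_on {\<rho>..1} f" "continuous_on {\<rho>..1} g"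
  shows "rival M (\<lambda>v. f v + g v) = rival M f + rival M g"
  using rival_integrable[OF assms(1), of M] rival_integrable[OF assms(2), of M]
  by (simp add: rival_def distrib_left)

lemma rival_cmult: "rival M (\<lambda>v. c * f v) = c * rival M f"
proof -
  have "(\<lambda>v. indicator {\<rho>..1} v * (M * v ^ (M - 1) * (c * f v)))
      = (\<lambda>v. c * (indicator {\<rho>..1} v * (M * v ^ (M - 1) * f v)) :: real)"
    by (auto simp: fun_eq_iff)
  then show ?thesis unfolding rival_def by (simp add: distrib_left mult.left_commute)
qed

lemma rival_linear:
  assumes "continuous_on {\<rho>..1} f" "continuous_on {\<rho>..1} g"
  shows "rival M (\<lambda>v. f v + c * g v) = rival M f + c * rival M g"
  using rival_add[OF assms(1) continuous_on_mult_left[OF assms(2)], of M c] by (simp only: rival_cmult)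

lemma rival_mono:
  assumes "continuous_on {\<rho>..1} f" "continuous_on {\<rho>..1} g" "\<And>v. \<rho> \<le> v \<Longrightarrow> v \<le> 1 \<Longrightarrow> f v \<le> g v"
  shows "rival M f \<le> rival M g"
proof -
  have "(LINT v|lborel. indicator {\<rho>..1} v * (M * v ^ (M - 1) * f v))
      \<le> (LINT v|lborel. indicator {\<rho>..1} v * (M * v ^ (M - 1) * g v))"
  proof (intro integral_mono rival_integrable assms)
    fix v :: real
    show "indicator {\<rho>..1} v * (M * v ^ (M - 1) * f v) \<le> indicator {\<rho>..1} v * (M * v ^ (M - 1) * g v)"
      using assms(3)[of v] rho by (auto simp: indicator_def intro!: mult_left_mono)
  qed
  moreover have "M / m * \<rho> ^ M * f \<rho> \<le> M / m * \<rho> ^ M * g \<rho>"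
    using assms(3)[of \<rho>] rho by (intro mult_left_mono) auto
  ultimately show ?thesis unfolding rival_def by (rule add_mono)
qed

lemma rival_nonneg:
  assumes "continuous_on {\<rho>..1} f" "\<And>v. \<rho> \<le> v \<Longrightarrow> v \<le> 1 \<Longrightarrow> 0 \<le> f v"
  shows "0 \<le> rival M f"
  using rival_mono[of "\<lambda>_. 0" f M] assms rival_cmult[of M 0 "\<lambda>_. 0"] by simp

lemma rival_0: "rival 0 f = 0"
  by (simp add: rival_def)

text \<open>A factor \<open>v ^ k\<close> acts like \<open>k\<close> additional competing units, up
  to normalisation of the density. The atom at \<open>\<rho>\<close> obeys the same rule because its
  weight \<open>M / m\<close> is linear in \<open>M\<close>.\<close>

lemma rival_shift:
  assumes "0 < M + k"
  shows "rival M (\<lambda>v. v ^ k * f v) = M / (M + k) * rival (M + k) f"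
proof (cases M)
  case (Suc M')
  define c :: real where "c = M / (M + k)"
  have c: "c * (M + k) = M" using assms by (simp add: c_def)
  have "M * v ^ (M - 1) * (v ^ k * f v) = c * ((M + k) * v ^ (M + k - 1) * f v)" for v :: real
  proof -
    have p: "v ^ (M + k - 1) = v ^ (M - 1) * v ^ k" using Suc by (simp add: power_add)
    have "c * ((M + k) * v ^ (M + k - 1) * f v) = (c * (M + k)) * (v ^ (M + k - 1) * f v)"
      by (simp only: mult.assoc)
    then show ?thesis by (simp only: c p mult.assoc)
  qed
  then have "(LINT v|lborel. indicator {\<rho>..1} v * (M * v ^ (M - 1) * (v ^ k * f v)))
      = (LINT v|lborel. c * (indicator {\<rho>..1} v * ((M + k) * v ^ (M + k - 1) * f v)))"
    by (intro Bochner_Integration.integral_cong) (simp_all only: mult.left_commute)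
  then have I: "(LINT v|lborel. indicator {\<rho>..1} v * (M * v ^ (M - 1) * (v ^ k * f v)))
      = c * (LINT v|lborel. indicator {\<rho>..1} v * ((M + k) * v ^ (M + k - 1) * f v))"
    by (simp only: integral_mult_right_zero)
  have "M / m * \<rho> ^ M * (\<rho> ^ k * f \<rho>) = c * ((M + k) / m * \<rho> ^ (M + k) * f \<rho>)"
    unfolding c[symmetric] by (simp add: power_add)
  then show ?thesis unfolding rival_def I by (simp only: distrib_left c_def of_nat_add)
qed (simp add: rival_0)

lemma rival_moment:
  assumes "n \<le> m" "k \<le> n"
  shows "rival (m - n) (\<lambda>v. v ^ k) = (m - n) / (m - n + k) * u0 (n - k)"
proof (cases "m - n + k = 0")
  case True
  then show ?thesis by (simp add: rival_0)
next
  case False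
  define K where "K = m - n + k"
  have K: "0 < K" "m - (n - k) = K" "n - k = m - K" "K \<le> m" using False assms by (auto simp: K_def)
  have "rival (m - n) (\<lambda>v. v ^ k) = (m - n) / K * rival K (\<lambda>v. 1)"
    using rival_shift[of "m - n" k "\<lambda>_. 1"] K(1) by (simp add: K_def)
  also have "rival K (\<lambda>v. 1) = u0 (m - K)"
  proof -
    have "(LINT v|lborel. v ^ (K - 1) * indicator {\<rho>..1} v) = (1 ^ Suc (K - 1) - \<rho> ^ Suc (K - 1)) / Suc (K - 1)"
      using rho by (intro integral_power) auto
    then have "(LINT v|lborel. indicator {\<rho>..1} v * (K * v ^ (K - 1) * 1)) = 1 - \<rho> ^ K"
      using K by (simp add: mult.commute mult.left_commute)
    then have "rival K (\<lambda>v. 1) = 1 - \<rho> ^ K + K / m * \<rho> ^ K * 1" unfolding rival_def by (simp only:)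
    moreover have "u0 (m - K) = 1 - (1 - K / m) * \<rho> ^ K"
      unfolding u0_def using K(4) mpos by (simp add: of_nat_diff diff_divide_distrib)
    ultimately show ?thesis by (simp add: left_diff_distrib)
  qed
  finally show ?thesis unfolding K(3) by (simp add: K_def)
qed

text \<open>An affine function is integrated through the mass \<open>e\<close> and the first moment
  \<open>f\<close> only. Since the mean lies between \<open>0\<close> and \<open>T\<close>, the
  bounds at these two points suffice even if single arguments exceed \<open>T\<close>.\<close>

lemma affine_bound:
  fixes a b c e f s T :: real
  assumes "0 < T" "a \<le> c * (1 - s)" "a - b * T \<le> c * (1 - s - T)" "0 \<le> f" "f \<le> T * e"
  shows "a * e - b * f \<le> c * ((1 - s) * e - f)"
proof -
  have "f / T \<le> e" using assms by (simp add: field_simps)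
  then have "(e - f / T) * a \<le> (e - f / T) * (c * (1 - s))" using assms by (intro mult_left_mono) auto
  moreover have "(f / T) * (a - b * T) \<le> (f / T) * (c * (1 - s - T))" using assms by (intro mult_left_mono) auto
  moreover have "a * e - b * f = (e - f / T) * a + (f / T) * (a - b * T)" using assms by (simp add: field_simps)
  moreover have "c * ((1 - s) * e - f) = (e - f / T) * (c * (1 - s)) + (f / T) * (c * (1 - s - T))"
    using assms by (simp add: field_simps)
  ultimately show ?thesis by linarith
qed

lemma rival_const: "rival M (\<lambda>v. c) = c * rival M (\<lambda>v. 1)"
  using rival_cmult[of M c "\<lambda>_. 1"] by simp

lemma rival_moments:
  assumes "n + k \<le> m" "n + k < m"
  shows "rival (m - (n + k)) (\<lambda>v. 1) = u0 (n + k)"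
    "rival (m - (n + k)) (\<lambda>v. v ^ n) = (1 - n / m - k / m) / (1 - k / m) * u0 k"
    "rival (m - (n + k)) (\<lambda>v. v ^ k) = (1 - n / m - k / m) / (1 - n / m) * u0 n"
    "rival (m - (n + k)) (\<lambda>v. v ^ n * v ^ k) = 1 - n / m - k / m"
proof -
  have u00: "u0 0 = 1" by (simp add: u0_def)
  have eq: "real (m - (n + k)) = m * (1 - n / m - k / m)" using assms mpos by (simp add: field_simps of_nat_diff)
  show "rival (m - (n + k)) (\<lambda>v. 1) = u0 (n + k)"
    using rival_moment[OF assms(1), of 0] assms(2) by simp
  have "real (m - (n + k) + n) = m * (1 - k / m)" using assms mpos by (simp add: field_simps of_nat_diff)
  then show "rival (m - (n + k)) (\<lambda>v. v ^ n) = (1 - n / m - k / m) / (1 - k / m) * u0 k"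
    using rival_moment[OF assms(1), of n] mpos eq by (simp del: of_nat_add of_nat_diff)
  have "real (m - (n + k) + k) = m * (1 - n / m)" using assms mpos by (simp add: field_simps of_nat_diff)
  then show "rival (m - (n + k)) (\<lambda>v. v ^ k) = (1 - n / m - k / m) / (1 - n / m) * u0 n"
    using rival_moment[OF assms(1), of k] mpos eq by (simp del: of_nat_add of_nat_diff)
  have "m - (n + k) + (n + k) = m" using assms by simp
  then show "rival (m - (n + k)) (\<lambda>v. v ^ n * v ^ k) = 1 - n / m - k / m"
    using rival_moment[OF assms(1), of "n + k"] mpos eq u00 by (simp del: of_nat_add of_nat_diff add: power_add)
qed

section \<open>One round, inside a cell or across cells\<close>

lemma u0_ge: "1 - n / m \<le> u0 n"
proof -
  have "n / m * \<rho> ^ (m - n) \<le> n / m * 1" using rho by (intro mult_left_mono) (auto simp: power_le_one)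
  then show ?thesis by (simp add: u0_def)
qed

text \<open>Here \<open>s\<close> is the mass already spent and \<open>r\<close> the number of units
  left in the cell. The argument \<open>t + 1 - v ^ n\<close> can leave the range in which
  \<open>Q\<close> is available, but its mean under the rival law does not, by
  \<open>u0_mult_le\<close>; so \<open>affine_bound\<close> applies and leaves
  \<open>block_bound\<close>.\<close>

lemma round_inside:
  assumes Q: "\<And>t. 0 \<le> t \<Longrightarrow> t \<le> r * \<eta> / m \<Longrightarrow> a - b * t \<le> c * (1 - s - t)"
    and c: "0 \<le> c" and s: "0 \<le> s" "s \<le> (real l - real r) * \<eta> / m"
    and n: "n \<le> r" "0 < r" "r \<le> l" and t: "0 \<le> t" "t \<le> (real r - real n) * \<eta> / m"
  shows "rival (m - n) (\<lambda>v. a - b * (t + 1 - v ^ n)) \<le> c * ((1 - \<epsilon> / m) ^ n * (1 - s - n * \<eta> / m - t))"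
proof -
  have nm: "n \<le> m" "n < m" using n lm by auto
  define T where "T = r * \<eta> / m"
  define f where "f = (t + 1) * u0 n - (1 - n / m)"
  have T: "0 < T" using n eps mpos by (simp add: T_def)
  have "rival (m - n) (\<lambda>v. a - b * (t + 1 - v ^ n)) = rival (m - n) (\<lambda>v. (a - b * (t + 1)) * 1 + b * v ^ n)"
    by (simp add: algebra_simps)
  also have "\<dots> = (a - b * (t + 1)) * u0 n + b * (1 - n / m)"
    using rival_moments(1,2)[of n 0] nm mpos
    by (subst rival_add) (auto intro!: continuous_intros simp: rival_cmult u0_def rival_const[of _ "a - b * (t + 1)"])
  also have "\<dots> = a * u0 n - b * f" by (simp add: f_def algebra_simps)
  also have "\<dots> \<le> c * ((1 - s) * u0 n - f)"
  proof (rule affine_bound[OF T])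
    show "a \<le> c * (1 - s)" "a - b * T \<le> c * (1 - s - T)" using Q[of 0] Q[of T] T by (auto simp: T_def)
    have "0 \<le> t * u0 n" using t u0_bounds nm by simp
    then show "0 \<le> f" using u0_ge[of n] by (simp add: f_def distrib_right)
    have "t * u0 n \<le> ((real r - real n) * \<eta> / m) * u0 n" using t u0_bounds nm by (intro mult_right_mono) auto
    then show "f \<le> T * u0 n" using u0_mult_le[OF nm(1)] by (simp add: f_def T_def algebra_simps diff_divide_distrib)
  qed
  also have "(1 - s) * u0 n - f = (1 - n / m) - (s + t) * u0 n" by (simp add: f_def algebra_simps)
  also have "c * \<dots> \<le> c * ((1 - \<epsilon> / m) ^ n * (1 - (s + t) - n * \<eta> / m))"
  proof (intro mult_left_mono block_bound c)
    have "(real l - real r) * \<eta> / m + (real r - real n) * \<eta> / m = (real l - real n) * \<eta> / m"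
      by (simp add: add_divide_distrib[symmetric] algebra_simps)
    then show "s + t \<le> (real l - real n) * \<eta> / m" using s t by linarith
  qed (use n s t in auto)
  finally show ?thesis by (simp add: algebra_simps)
qed

text \<open>Weighting by \<open>v ^ k - t\<close> must not push the mean of \<open>1 - v ^ n\<close>
  above \<open>n * \<eta> / m\<close>. For \<open>t = 0\<close> the moments show this. In general
  \<open>v ^ k - t = K * v ^ k + (1 - K) * (v ^ k - v0 ^ k)\<close>, where \<open>v0\<close> is the
  zero of \<open>v ^ n - d\<close>, and the last bracket changes sign together with
  \<open>v ^ n - d\<close>.\<close>

lemma rival_sign_change:
  assumes nk: "n + k < m" "n \<le> l" "k \<le> l" "0 < n" and t: "0 \<le> t" "t \<le> (real l - real k) * \<eta> / m"
  shows "0 \<le> rival (m - (n + k)) (\<lambda>v. (v ^ n - (1 - n * \<eta> / m)) * (v ^ k - t))"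
proof -
  define d where "d = 1 - n * \<eta> / m"
  define v0 where "v0 = root n d"
  have d: "\<rho> ^ n \<le> d" "d \<le> 1" using rho_power_chord[of n] nk lm eps by (auto simp: d_def)
  have d0: "0 < d" using d(1) zero_less_power[OF rho(1), of n] by linarith
  have v0: "v0 ^ n = d" "0 < v0"
    using d0 nk(4) by (auto simp: v0_def real_root_pow_pos2)
  \<comment> \<open>The chord bound \<open>\<rho> ^ n \<le> d\<close> keeps the zero from falling
    below \<open>\<rho>\<close>; this gives \<open>t \<le> v0 ^ k\<close> and hence
    \<open>K \<ge> 0\<close>.\<close>
  have "\<rho> \<le> v0" using d(1) v0 rho nk(4) by (metis less_le_not_le linorder_le_less_linear order_less_imp_le power_strict_mono)
  have tk: "t \<le> v0 ^ k"
  proof -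
    have "t \<le> (\<eta> * l / m) * (1 - k / l)" using t(2) room_eq[of k] by linarith
    also have "\<dots> \<le> 1 * (1 - k / l)" using eta_half nk mpos by (intro mult_right_mono) auto
    also have "\<dots> \<le> \<rho> ^ k" using rho_power_ge by simp
    also have "\<dots> \<le> v0 ^ k" using \<open>\<rho> \<le> v0\<close> rho by (intro power_mono) auto
    finally show ?thesis .
  qed
  define K where "K = 1 - t / v0 ^ k"
  have K: "0 \<le> K" using tk v0 by (simp add: K_def)
  have "rival (m - (n + k)) (\<lambda>v. (v ^ n - d) * v ^ k)
      = rival (m - (n + k)) (\<lambda>v. v ^ n * v ^ k + (- d) * v ^ k)"
    by (simp add: left_diff_distrib)
  also have "\<dots> = (1 - n / m - k / m) - d * ((1 - n / m - k / m) / (1 - n / m) * u0 n)"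
    using rival_moments(3,4)[of n k] nk by (subst rival_linear) (auto intro!: continuous_intros)
  also have "\<dots> = (1 - n / m - k / m) / (1 - n / m) * ((1 - n / m) - u0 n * d)"
    using nk mpos by (simp add: field_simps)
  also have "\<dots> \<ge> 0"
  proof (intro mult_nonneg_nonneg divide_nonneg_nonneg)
    have "(real n + real k) / m \<le> 1" using nk mpos by (simp add: divide_le_eq)
    then show "0 \<le> 1 - n / m - k / m" by (simp add: add_divide_distrib)
    show "0 \<le> 1 - n / m" using nk mpos by (simp add: field_simps)
    show "0 \<le> 1 - n / m - u0 n * d" using u0_mult_le[of n] nk by (simp add: d_def)
  qed
  finally have nn: "0 \<le> rival (m - (n + k)) (\<lambda>v. (v ^ n - d) * v ^ k)" .
  have "0 \<le> K * rival (m - (n + k)) (\<lambda>v. (v ^ n - d) * v ^ k)" using K nn by simp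
  also have "\<dots> = rival (m - (n + k)) (\<lambda>v. K * ((v ^ n - d) * v ^ k))" by (simp add: rival_cmult)
  also have "\<dots> \<le> rival (m - (n + k)) (\<lambda>v. (v ^ n - d) * (v ^ k - t))"
  proof (intro rival_mono continuous_intros)
    fix v assume v: "\<rho> \<le> v" "v \<le> 1"
    then have v0': "0 < v" using rho by simp
    have "0 \<le> (v ^ n - d) * (v ^ k - v0 ^ k)"
    proof (cases "v0 \<le> v")
      case True
      then have "d \<le> v ^ n" "v0 ^ k \<le> v ^ k" unfolding v0(1)[symmetric] using v0 by (auto intro!: power_mono)
      then show ?thesis by simp
    next
      case False
      then have "v ^ n \<le> d" "v ^ k \<le> v0 ^ k" unfolding v0(1)[symmetric] using v0' by (auto intro!: power_mono)
      then show ?thesis by (simp add: mult_nonpos_nonpos)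
    qed
    then have "0 \<le> (1 - K) * ((v ^ n - d) * (v ^ k - v0 ^ k))" using t v0 by (simp add: K_def)
    moreover have tK: "t = (1 - K) * v0 ^ k" using v0 by (simp add: K_def)
    ultimately show "K * ((v ^ n - d) * v ^ k) \<le> (v ^ n - d) * (v ^ k - t)"
      by (subst tK) (simp add: algebra_simps)
  qed
  finally show ?thesis by (simp add: d_def)
qed

text \<open>The round completes one cell with \<open>n\<close> units and opens the next with
  \<open>k\<close>; the common rival level couples the two pieces. After
  \<open>affine_bound\<close>, with \<open>e\<close> and \<open>f\<close> weighted by
  \<open>v ^ k - t\<close>, the integral is bilinear in \<open>s\<close> and \<open>t\<close>, and
  \<open>bilinear_bound\<close> followed by \<open>block_bound\<close> separates it into one factor
  per cell.\<close>

lemma round_across_basic: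
  assumes Q: "\<And>t. 0 \<le> t \<Longrightarrow> t \<le> n * \<eta> / m \<Longrightarrow> a - b * t \<le> c * (1 - s - t)"
    and c: "0 \<le> c" and s: "0 \<le> s" "s \<le> (real l - real n) * \<eta> / m"
    and nk: "0 < n" "n \<le> l" "k \<le> l" "n + k < m" and t: "0 \<le> t" "t \<le> (real l - real k) * \<eta> / m"
  shows "rival (m - (n + k)) (\<lambda>v. (a - b * (1 - v ^ n)) * (v ^ k - t))
    \<le> c * (((1 - \<epsilon> / m) ^ n * (1 - s - n * \<eta> / m)) * ((1 - \<epsilon> / m) ^ k * (1 - t - k * \<eta> / m)))"
    "0 \<le> (1 - \<epsilon> / m) ^ n * (1 - s - n * \<eta> / m)" "0 \<le> (1 - \<epsilon> / m) ^ k * (1 - t - k * \<eta> / m)"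
proof -
  let ?R = "rival (m - (n + k))"
  define x y where "x = n / m" and "y = k / m"
  have x: "0 \<le> x" "x < 1" and y: "0 \<le> y" "y < 1"
    using nk lm mpos by (auto simp: x_def y_def)
  have halve: "0 \<le> b - a" if "a \<le> b / 2" "0 \<le> b" for a b :: real using that by simp
  have su: "s * u0 n \<le> (1 - x) / 2" using u0_slack[OF nk(2) s] by (simp only: x_def)
  have su': "0 \<le> 1 - x - s * u0 n" using halve[OF su] x by simp
  have tu: "t * u0 k \<le> (1 - y) / 2" using u0_slack[OF nk(3) t] by (simp only: y_def)
  have tu': "0 \<le> 1 - y - t * u0 k" using halve[OF tu] y by simp
  define T where "T = n * \<eta> / m"
  have T: "0 < T" using nk eps mpos by (simp add: T_def)
  define e where "e = ?R (\<lambda>v. v ^ k - t)"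
  define f where "f = ?R (\<lambda>v. (1 - v ^ n) * (v ^ k - t))"
  define \<mu> where "\<mu> = 1 - x - y"
  note mom = rival_moments[of n k, folded x_def y_def, folded \<mu>_def]
  have nk': "n + k \<le> m" using nk by simp
  have lk: "v ^ k - t \<ge> 0" if "\<rho> \<le> v" for v
  proof -
    have "t \<le> (\<eta> * l / m) * (1 - k / l)" using t(2) room_eq[of k] by linarith
    also have "\<dots> \<le> 1 * (1 - k / l)" using eta_half nk mpos by (intro mult_right_mono) auto
    also have "\<dots> \<le> \<rho> ^ k" using rho_power_ge by simp
    also have "\<dots> \<le> v ^ k" using that rho by (intro power_mono) auto
    finally show ?thesis by simp
  qed
  have f0: "0 \<le> f" unfolding f_def
    using lk rho by (intro rival_nonneg continuous_intros mult_nonneg_nonneg) (auto simp: power_le_one)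
  have "0 \<le> ?R (\<lambda>v. (v ^ n - (1 - T)) * (v ^ k - t))"
    using rival_sign_change[of n k t] nk t by (simp add: T_def)
  also have "\<dots> = ?R (\<lambda>v. T * (v ^ k - t) + (- 1) * ((1 - v ^ n) * (v ^ k - t)))"
    by (simp add: algebra_simps)
  also have "\<dots> = T * e - f"
    unfolding e_def f_def by (subst rival_add) (auto intro!: continuous_intros simp only: rival_cmult)
  finally have fT: "f \<le> T * e" by simp
  have "?R (\<lambda>v. (a - b * (1 - v ^ n)) * (v ^ k - t)) = ?R (\<lambda>v. a * (v ^ k - t) + (- b) * ((1 - v ^ n) * (v ^ k - t)))"
    by (simp add: algebra_simps)
  also have "\<dots> = a * e - b * f"
    unfolding e_def f_def by (subst rival_add) (auto intro!: continuous_intros simp only: rival_cmult)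
  also have "\<dots> \<le> c * ((1 - s) * e - f)"
    by (rule affine_bound[OF T _ _ f0 fT]) (use Q[of 0] Q[of T] T in \<open>auto simp: T_def\<close>)
  also have "(1 - s) * e - f = \<mu> - s * (\<mu> / (1 - x) * u0 n) - t * (\<mu> / (1 - y) * u0 k) + s * t * u0 (n + k)"
  proof -
    have e: "e = ?R (\<lambda>v. v ^ k + (- t) * 1)" by (simp add: e_def)
    have e': "e = \<mu> / (1 - x) * u0 n - t * u0 (n + k)"
      unfolding e using mom(1,3)[OF nk' nk(4)]
      by (subst rival_add) (auto intro!: continuous_intros simp: rival_const[of _ "- t"])
    have "e - f = ?R (\<lambda>v. (v ^ k - t) + (- 1) * ((1 - v ^ n) * (v ^ k - t)))"
      unfolding e_def f_def by (subst rival_add) (auto intro!: continuous_intros simp only: rival_cmult)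
    also have "\<dots> = ?R (\<lambda>v. v ^ n * v ^ k + (- t) * v ^ n)"
      by (simp add: algebra_simps)
    also have "\<dots> = \<mu> - t * (\<mu> / (1 - y) * u0 k)"
      using mom(2,4)[OF nk' nk(4)] by (subst rival_linear) (auto intro!: continuous_intros)
    finally have ef: "e - f = \<mu> - t * (\<mu> / (1 - y) * u0 k)" .
    have "(1 - s) * e - f = (e - f) - s * e" by (simp add: left_diff_distrib)
    also have "\<dots> = \<mu> - t * (\<mu> / (1 - y) * u0 k) - s * (\<mu> / (1 - x) * u0 n - t * u0 (n + k))"
      by (subst ef, subst e', rule refl)
    finally show ?thesis by (simp add: right_diff_distrib mult.assoc)
  qed
  also have "c * \<dots> \<le> c * ((1 - x - s * u0 n) * (1 - y - t * u0 k))"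
    unfolding \<mu>_def
    by (intro mult_left_mono bilinear_bound c x y s t u0_add_le nk' su tu)
  also have "\<dots> \<le> c * (((1 - \<epsilon> / m) ^ n * (1 - s - n * \<eta> / m)) * ((1 - \<epsilon> / m) ^ k * (1 - t - k * \<eta> / m)))"
  proof (intro mult_left_mono mult_mono c)
    show 1: "1 - x - s * u0 n \<le> (1 - \<epsilon> / m) ^ n * (1 - s - n * \<eta> / m)"
      using block_bound[of n s] nk s by (simp add: x_def)
    then show "0 \<le> (1 - \<epsilon> / m) ^ n * (1 - s - n * \<eta> / m)" using su' by simp
    show 2: "1 - y - t * u0 k \<le> (1 - \<epsilon> / m) ^ k * (1 - t - k * \<eta> / m)"
      using block_bound[of k t] nk t by (simp add: y_def)
    show "0 \<le> 1 - y - t * u0 k" by (rule tu')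
  qed
  finally show "rival (m - (n + k)) (\<lambda>v. (a - b * (1 - v ^ n)) * (v ^ k - t))
    \<le> c * (((1 - \<epsilon> / m) ^ n * (1 - s - n * \<eta> / m)) * ((1 - \<epsilon> / m) ^ k * (1 - t - k * \<eta> / m)))" .
  show "0 \<le> (1 - \<epsilon> / m) ^ n * (1 - s - n * \<eta> / m)"
    using block_bound[of n s] nk s su' by (simp add: x_def)
  show "0 \<le> (1 - \<epsilon> / m) ^ k * (1 - t - k * \<eta> / m)"
    using block_bound[of k t] nk t tu' by (simp add: y_def)
qed

lemma block_nonneg:
  assumes "n \<le> l" "0 \<le> s" "s \<le> (real l - real n) * \<eta> / m"
  shows "0 \<le> (1 - \<epsilon> / m) ^ n * (1 - s - n * \<eta> / m)"
proof -
  have "n / m \<le> 1" using assms(1) lm mpos by simp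
  then have "(1 - n / m) / 2 \<le> 1 - n / m" by simp
  then have "s * u0 n \<le> 1 - n / m" by (rule order_trans[OF u0_slack[OF assms]])
  then show ?thesis using block_bound[OF assms] by linarith
qed

text \<open>The \<open>d\<close> whole cells in between contribute \<open>v ^ (d * l)\<close>. By
  \<open>rival_shift\<close> this becomes the factor \<open>M / M' \<le> 1 - d * l / m\<close>,
  which Bernoulli's inequality bounds by \<open>(1 - l / m) ^ d \<le> H l ^ d\<close>.\<close>

lemma round_across:
  assumes Q: "\<And>t. 0 \<le> t \<Longrightarrow> t \<le> r * \<eta> / m \<Longrightarrow> a - b * t \<le> c * (1 - s - t)"
    and c: "0 \<le> c" and s: "0 \<le> s" "s \<le> (real l - real r) * \<eta> / m"
    and n: "0 < r" "r \<le> l" "k \<le> l" "r + d * l + k \<le> m" and t: "0 \<le> t" "t \<le> (real l - real k) * \<eta> / m"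
  shows "rival (m - (r + d * l + k)) (\<lambda>v. v ^ (d * l) * ((a - b * (1 - v ^ r)) * (v ^ k - t)))
    \<le> c * ((1 - \<epsilon> / m) ^ r * (1 - s - r * \<eta> / m)) * H l ^ d * ((1 - \<epsilon> / m) ^ k * (1 - t - k * \<eta> / m))"
proof -
  define M where "M = m - (r + d * l + k)"
  define M' where "M' = m - (r + k)"
  define X where "X = c * (((1 - \<epsilon> / m) ^ r * (1 - s - r * \<eta> / m)) * ((1 - \<epsilon> / m) ^ k * (1 - t - k * \<eta> / m)))"
  have MM: "M' = M + d * l" using n by (simp add: M_def M'_def)
  have X: "0 \<le> X" unfolding X_def using block_nonneg[OF n(2) s] block_nonneg[OF n(3) t] c by simp
  have lm1: "0 \<le> 1 - l / m" using lm by (simp add: field_simps)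
  have Hl: "1 - l / m \<le> H l" using H_ge by simp
  have "rival M (\<lambda>v. v ^ (d * l) * ((a - b * (1 - v ^ r)) * (v ^ k - t))) \<le> H l ^ d * X"
  proof (cases "M' = 0")
    case True
    then have "M = 0" using MM by simp
    then show ?thesis using X Hl lm1 by (simp add: rival_0)
  next
    case False
    have "rival M (\<lambda>v. v ^ (d * l) * ((a - b * (1 - v ^ r)) * (v ^ k - t)))
        = M / M' * rival M' (\<lambda>v. (a - b * (1 - v ^ r)) * (v ^ k - t))"
      using rival_shift[of M "d * l" "\<lambda>v. (a - b * (1 - v ^ r)) * (v ^ k - t)"] MM False by simp
    also have "\<dots> \<le> M / M' * X"
      unfolding X_def M'_def using False
      by (intro mult_left_mono round_across_basic Q c s n t) (auto simp: M'_def)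
    also have "\<dots> \<le> H l ^ d * X"
    proof (intro mult_right_mono X)
      have "d * l / m \<le> d * l / M'"
        using False by (intro divide_left_mono) (auto simp: M'_def)
      moreover have "M / M' = 1 - d * l / M'"
      proof -
        have "real M = real M' - real (d * l)" by (simp add: MM)
        then show ?thesis using False by (simp only: diff_divide_distrib) simp
      qed
      ultimately have "M / M' \<le> 1 + real d * (- (l / m))" by simp
      also have "\<dots> \<le> (1 + - (l / m)) ^ d" using lm1 by (intro Bernoulli_inequality) simp
      also have "\<dots> \<le> H l ^ d" using lm1 Hl by (intro power_mono) auto
      finally show "M / M' \<le> H l ^ d" .
    qed
    finally show ?thesis .
  qed
  then show ?thesis by (simp add: M_def X_def mult_ac)
qed

end

section \<open>Iterating over the rounds\<close>

lemma fold_step_inside: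
  "k + n < l \<Longrightarrow> fold (step G l) (replicate n b) (p, k, N) = (p, k + n, N + (if b then n else 0))"
  by (induction n arbitrary: k N) (auto simp: step_def Let_def)

lemma fold_step_fill:
  assumes "k < l"
  shows "fold (step G l) (replicate (l - k) b) (p, k, N) = (p * G (N + (if b then l - k else 0)), 0, 0)"
proof -
  define n where "n = l - k - 1"
  have n: "l - k = Suc n" "k + n < l" "Suc (k + n) = l" using assms by (auto simp: n_def)
  have "replicate (l - k) b = replicate n b @ [b]" using n by (simp add: replicate_append_same)
  then show ?thesis using n fold_step_inside[OF n(2), of G b p N]
    by (auto simp: step_def Let_def)
qed

lemma fold_step_full:
  assumes "0 < l"
  shows "fold (step G l) (replicate (d * l) b) (p, 0, 0) = (p * G (if b then l else 0) ^ d, 0, 0)"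
proof (induction d arbitrary: p)
  case (Suc d)
  have "replicate (Suc d * l) b = replicate l b @ replicate (d * l) b"
    by (simp add: replicate_add)
  then show ?case using fold_step_fill[OF assms, of G b p 0] Suc by simp
qed simp

lemma fold_step_across:
  assumes "k < l" "n3 < l"
  shows "fold (step G l) (replicate ((l - k) + d * l + n3) b) (p, k, N)
    = (p * G (N + (if b then l - k else 0)) * G (if b then l else 0) ^ d, n3, if b then n3 else 0)"
proof -
  have "replicate ((l - k) + d * l + n3) b = replicate (l - k) b @ replicate (d * l) b @ replicate n3 b"
    by (simp add: replicate_add)
  then show ?thesis
    using assms fold_step_fill[OF assms(1), of G b p N] fold_step_full[of l G d b] fold_step_inside[of 0 n3 l G b _ 0]
    by simp
qed

text \<open>
  One element with \<open>n j\<close> units in round \<open>j\<close>, numbered consecutively from \<open>off\<close>; cell \<open>c\<close> consists of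
  the units \<open>c * l, \<dots>, c * l + l - 1\<close>, and \<open>W\<close> is the set of rounds in which the element must lose.
\<close>

locale cell_run = cell_params +
  fixes n :: "nat \<Rightarrow> nat" and W :: "nat set" and off :: nat
  assumes n_le: "n j \<le> m" and off_less: "off < l"
begin

definition pos :: "nat \<Rightarrow> nat" where "pos j = off + (\<Sum>i<j. n i)"
definition cur :: "nat \<Rightarrow> nat" where "cur j = pos j div l"
definition piece :: "nat \<Rightarrow> nat \<Rightarrow> nat" where
  "piece c j = min (pos j + n j) (c * l + l) - max (pos j) (c * l)"
text \<open>The mass of the seed of cell \<open>c\<close> that loses all these rounds when
  \<open>v i\<close> is the rival level of round \<open>i\<close>. The excluded parts are disjoint,
  hence a sum is subtracted instead of a product formed.\<close>

definition hole :: "nat \<Rightarrow> nat \<Rightarrow> (nat \<Rightarrow> real) \<Rightarrow> real" where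
  "hole c j v = 1 - (\<Sum>i\<in>W \<inter> {..<j}. 1 - v i ^ piece c i)"

text \<open>The latest round is integrated outermost, so that in an induction on \<open>j\<close>
  its level is a constant for all earlier rounds.\<close>

fun iterated :: "nat \<Rightarrow> ((nat \<Rightarrow> real) \<Rightarrow> real) \<Rightarrow> (nat \<Rightarrow> real) \<Rightarrow> real" where
  "iterated 0 F v = F v"
| "iterated (Suc j) F v =
     (if j \<in> W then rival (m - n j) (\<lambda>x. iterated j F (v(j := x))) else iterated j F v)"

text \<open>The parameter \<open>t\<close> is mass of the current cell to be excluded by later
  rounds. With it, a further round in the same cell is only a change of \<open>t\<close>.\<close>

definition target :: "nat \<Rightarrow> real \<Rightarrow> (nat \<Rightarrow> real) \<Rightarrow> real" where
  "target j t v = (\<Prod>c<cur j. hole c j v) * (hole (cur j) j v - t)"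

definition flag_list :: "nat \<Rightarrow> bool list" where
  "flag_list j = concat (map (\<lambda>i. replicate (n i) (i \<in> W)) [0..<j])"

section \<open>Bookkeeping of cells and pieces\<close>

lemma flag_list_Suc: "flag_list (Suc j) = flag_list j @ replicate (n j) (j \<in> W)"
  by (simp add: flag_list_def)

lemma pos_Suc: "pos (Suc j) = pos j + n j"
  by (simp add: pos_def)

lemma pos_mono: "i \<le> j \<Longrightarrow> pos i \<le> pos j"
  by (induction rule: dec_induct) (auto simp: pos_Suc)

lemma pos_cur: "pos j = cur j * l + pos j mod l"
  by (simp add: cur_def)

lemma iterated_cong:
  "(\<And>v'. (\<And>i. j \<le> i \<Longrightarrow> v' i = v i) \<Longrightarrow> F v' = F' v') \<Longrightarrow> iterated j F v = iterated j F' v"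
proof (induction j arbitrary: v)
  case (Suc j)
  have "iterated j F (v(j := x)) = iterated j F' (v(j := x))" for x
  proof (rule Suc.IH)
    fix v' assume "\<And>i. j \<le> i \<Longrightarrow> v' i = (v(j := x)) i"
    then show "F v' = F' v'" by (intro Suc.prems) auto
  qed
  moreover have "iterated j F v = iterated j F' v" by (rule Suc.IH) (use Suc.prems in auto)
  ultimately show ?case by simp
qed simp

lemma iterated_cmult: "iterated j (\<lambda>v. c * F v) v = c * iterated j F v"
  by (induction j arbitrary: v) (auto simp: rival_cmult)

lemma piece_before: "pos i + n i \<le> c * l \<Longrightarrow> piece c i = 0"
  by (simp add: piece_def)

lemma piece_after: "c < cur j \<Longrightarrow> piece c j = 0"
proof -
  assume "c < cur j"
  then have "Suc c * l \<le> cur j * l" by (intro mult_le_mono1) simp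
  also have "\<dots> \<le> pos j" using pos_cur[of j] by simp
  finally show ?thesis by (simp add: piece_def)
qed

lemma hole_after: "cur j < c \<Longrightarrow> hole c j v = 1"
proof -
  assume "cur j < c"
  then have "Suc (cur j) * l \<le> c * l" by (intro mult_le_mono1) simp
  moreover have "Suc (cur j) * l = cur j * l + l" by simp
  ultimately have "pos j \<le> c * l"
    using pos_cur[of j] mod_less_divisor[of l "pos j"] mpos by linarith
  then have "piece c i = 0" if "i < j" for i
    using piece_before[of i c] pos_mono[of "Suc i" j] that by (simp add: pos_Suc)
  then show ?thesis by (simp add: hole_def)
qed

lemma hole_Suc: "hole c (Suc j) v = hole c j v - (if j \<in> W then 1 - v j ^ piece c j else 0)"
proof (cases "j \<in> W")
  case True
  then have "W \<inter> {..<Suc j} = insert j (W \<inter> {..<j})" by auto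
  then show ?thesis using True by (simp add: hole_def)
next
  case False
  then have "W \<inter> {..<Suc j} = W \<inter> {..<j}" by (auto simp: less_Suc_eq)
  then show ?thesis using False by (simp add: hole_def)
qed

lemma inside:
  assumes "n j < l - pos j mod l"
  shows "cur (Suc j) = cur j" "pos (Suc j) mod l = pos j mod l + n j"
    "piece c j = (if c = cur j then n j else 0)"
proof -
  define k where "k = pos j mod l"
  have q: "pos j = cur j * l + k" unfolding k_def by (rule pos_cur)
  have k: "k + n j < l" using assms by (simp add: k_def)
  have "pos (Suc j) = cur j * l + (k + n j)" by (simp add: pos_Suc q)
  then show "cur (Suc j) = cur j" "pos (Suc j) mod l = pos j mod l + n j"
    using k unfolding cur_def[of "Suc j"] k_def[symmetric] by auto
  show "piece c j = (if c = cur j then n j else 0)"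
  proof (cases c "cur j" rule: linorder_cases)
    case less then show ?thesis using piece_after by simp
  next
    case equal then show ?thesis using k by (simp add: piece_def q)
  next
    case greater
    then have "Suc (cur j) * l \<le> c * l" by (intro mult_le_mono1) simp
    then show ?thesis using greater k by (simp add: piece_before q)
  qed
qed

lemma across:
  assumes "l - pos j mod l \<le> n j"
  obtains d n3 where "n j = (l - pos j mod l) + d * l + n3" "n3 < l"
    "cur (Suc j) = cur j + d + 1" "pos (Suc j) mod l = n3"
    "piece (cur j) j = l - pos j mod l"
    "\<And>c. cur j < c \<Longrightarrow> c \<le> cur j + d \<Longrightarrow> piece c j = l"
    "piece (cur j + d + 1) j = n3"
proof -
  define k where "k = pos j mod l"
  define d where "d = (n j - (l - k)) div l"
  define n3 where "n3 = (n j - (l - k)) mod l"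
  have q: "pos j = cur j * l + k" unfolding k_def by (rule pos_cur)
  have k: "k < l" using mpos by (simp add: k_def)
  have n3: "n3 < l" using mpos by (simp add: n3_def)
  have nj: "n j = (l - k) + d * l + n3"
    using assms by (simp add: d_def n3_def k_def[symmetric])
  have q': "pos (Suc j) = (cur j + d + 1) * l + n3" using k by (simp add: pos_Suc q nj algebra_simps)
  have c1: "cur (Suc j) = cur j + d + 1" "pos (Suc j) mod l = n3"
  proof -
    have "(e * l + n3) div l = e" "(e * l + n3) mod l = n3" for e using n3 by auto
    then show "cur (Suc j) = cur j + d + 1" "pos (Suc j) mod l = n3"
      unfolding cur_def[of "Suc j"] q' by blast+
  qed
  have c2: "piece (cur j) j = l - k"
    unfolding piece_def using k n3 by (simp add: q nj)
  have c3: "piece c j = l" if "cur j < c" "c \<le> cur j + d" for c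
  proof -
    have "Suc (cur j) * l \<le> c * l" "Suc c * l \<le> (cur j + d + 1) * l"
      using that by (intro mult_le_mono1; simp)+
    then have "pos j \<le> c * l" "c * l + l \<le> pos (Suc j)" using k q q' by (auto simp only: mult_Suc)
    then show ?thesis by (simp add: piece_def pos_Suc)
  qed
  have c4: "piece (cur j + d + 1) j = n3"
    unfolding piece_def pos_Suc[symmetric] q' using k n3 by (simp add: q algebra_simps)
  show ?thesis using that[of d n3] nj n3 c1 c2 c3 c4 unfolding k_def by blast
qed

section \<open>Effect of one round on the product of holes\<close>

lemma prod_lessThan_add: "(\<Prod>c<a + b. f c) = (\<Prod>c<a. f c) * (\<Prod>c<b. f (a + c))" for f :: "nat \<Rightarrow> real"
  by (induction b) (auto simp: mult.assoc)

lemma target_inside: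
  assumes "j \<in> W" "n j < l - pos j mod l"
  shows "target (Suc j) t v = target j (t + 1 - v j ^ n j) v"
proof -
  have "(\<Prod>c<cur j. hole c (Suc j) v) = (\<Prod>c<cur j. hole c j v)"
    using assms inside(3)[OF assms(2)] by (intro prod.cong) (auto simp: hole_Suc)
  then show ?thesis using assms inside[OF assms(2)] by (simp add: target_def hole_Suc algebra_simps)
qed

lemma target_across:
  assumes "j \<in> W" "cur (Suc j) = cur j + d + 1" "piece (cur j) j = r"
    "\<And>c. cur j < c \<Longrightarrow> c \<le> cur j + d \<Longrightarrow> piece c j = l" "piece (cur j + d + 1) j = k"
  shows "target (Suc j) t v = (v j ^ (d * l) * (v j ^ k - t)) * target j (1 - v j ^ r) v"
proof -
  have "(\<Prod>c<cur j. hole c (Suc j) v) = (\<Prod>c<cur j. hole c j v)"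
    using piece_after by (intro prod.cong) (auto simp: hole_Suc)
  moreover have "(\<Prod>c<d. hole (Suc (cur j) + c) (Suc j) v) = v j ^ (d * l)"
  proof -
    have "(\<Prod>c<d. hole (Suc (cur j) + c) (Suc j) v) = (\<Prod>c<d. v j ^ l)"
      using assms by (intro prod.cong) (auto simp: hole_Suc hole_after)
    then show ?thesis by (simp add: power_mult[symmetric] mult.commute)
  qed
  moreover have "(\<Prod>c<cur (Suc j). hole c (Suc j) v)
    = (\<Prod>c<cur j. hole c (Suc j) v) * hole (cur j) (Suc j) v * (\<Prod>c<d. hole (Suc (cur j) + c) (Suc j) v)"
    using prod_lessThan_add[of "\<lambda>c. hole c (Suc j) v" "Suc (cur j)" d] assms(2) by simp
  moreover have "hole (cur j) (Suc j) v = hole (cur j) j v - (1 - v j ^ r)"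
    using assms by (simp add: hole_Suc)
  moreover have "hole (cur (Suc j)) (Suc j) v = v j ^ k"
    using assms by (simp add: hole_Suc hole_after)
  ultimately show ?thesis by (simp add: target_def mult_ac)
qed

lemma target_skip:
  assumes "j \<notin> W"
  shows "cur (Suc j) = cur j \<Longrightarrow> target (Suc j) t v = target j t v"
    and "cur j < cur (Suc j) \<Longrightarrow> target (Suc j) t v = (1 - t) * target j 0 v"
proof -
  have h: "hole c (Suc j) v = hole c j v" for c using assms by (simp add: hole_Suc)
  { assume "cur (Suc j) = cur j" then show "target (Suc j) t v = target j t v"
      by (simp add: target_def h) }
  assume "cur j < cur (Suc j)"
  then obtain d where d: "cur (Suc j) = Suc (cur j) + d" using less_imp_Suc_add by fastforce
  have "(\<Prod>c<cur (Suc j). hole c j v) = (\<Prod>c<cur j. hole c j v) * hole (cur j) j v"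
    unfolding d prod_lessThan_add by (simp add: hole_after)
  then show "target (Suc j) t v = (1 - t) * target j 0 v"
    using d by (simp add: target_def h hole_after)
qed

text \<open>The invariant behind the product bound. Later rounds act only through \<open>t\<close>,
  on which the integral depends affinely. The bound is claimed just up to
  \<open>(l - k) * \<eta> / m\<close>, the mass that the remaining \<open>l - k\<close> units
  exclude on average; \<open>round_inside\<close> and \<open>round_across\<close> need no
  more.\<close>

lemma iterated_target:
  "\<exists>p k N a b. run H l off (flag_list j) = (p, k, N) \<and> k = pos j mod l \<and> N \<le> k \<and> 0 \<le> p
    \<and> (\<forall>t v. iterated j (target j t) v = a - b * t)
    \<and> (\<forall>t. 0 \<le> t \<longrightarrow> t \<le> (real l - real k) * \<eta> / m \<longrightarrow>
         a - b * t \<le> p * ((1 - \<epsilon> / m) ^ N * (1 - N * \<eta> / m - t)))"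
proof (induction j)
  case 0
  have "iterated 0 (target 0 t) v = 1 - 1 * t" for t v
    using off_less by (simp add: target_def cur_def pos_def hole_def)
  moreover have "run H l off (flag_list 0) = (1, off, 0)" by (simp add: flag_list_def run_Nil)
  moreover have "off = pos 0 mod l" using off_less by (simp add: pos_def)
  ultimately show ?case by (intro exI[of _ 1] exI[of _ off] exI[of _ 0]) (auto intro!: exI[of _ "1::real"])
next
  case (Suc j)
  then obtain p k N a b where run: "run H l off (flag_list j) = (p, k, N)" and k: "k = pos j mod l"
    and N: "N \<le> k" and p: "0 \<le> p" and it: "\<And>t v. iterated j (target j t) v = a - b * t"
    and bd: "\<And>t. 0 \<le> t \<Longrightarrow> t \<le> (real l - real k) * \<eta> / m \<Longrightarrow>
         a - b * t \<le> p * ((1 - \<epsilon> / m) ^ N * (1 - N * \<eta> / m - t))"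
    by auto
  have kl: "k < l" using mpos k by simp
  have A: "0 \<le> 1 - \<epsilon> / m" using eps mpos by (simp add: field_simps)
  define c where "c = p * (1 - \<epsilon> / m) ^ N"
  have c: "0 \<le> c" using p A by (simp add: c_def)
  define s where "s = N * \<eta> / m"
  have s: "0 \<le> s" "s \<le> (real l - real (l - k)) * \<eta> / m"
    using eps mpos N kl by (auto simp: s_def of_nat_diff intro!: divide_right_mono mult_right_mono)
  have Q: "a - b * t \<le> c * (1 - s - t)" if "0 \<le> t" "t \<le> real (l - k) * \<eta> / m" for t
    using bd[of t] that kl by (simp add: c_def s_def of_nat_diff)
  have run': "run H l off (flag_list (Suc j)) = fold (step H l) (replicate (n j) (j \<in> W)) (p, k, N)"
    using run by (simp add: flag_list_Suc run_def)
  have cH: "c * (1 - s) = p * H N" by (simp add: c_def s_def H_def)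
  show ?case
  proof (cases "n j < l - k")
    case True
    note ins = inside[OF True[unfolded k]]
    have r: "run H l off (flag_list (Suc j)) = (p, k + n j, N + (if j \<in> W then n j else 0))"
      unfolding run' using True by (intro fold_step_inside) simp
    show ?thesis
    proof (cases "j \<in> W")
      case inW: True
      have it': "iterated (Suc j) (target (Suc j) t) v = rival (m - n j) (\<lambda>x. a - b * (t + 1 - x ^ n j))" for t v
      proof -
        have "iterated j (target (Suc j) t) (v(j := x)) = a - b * (t + 1 - x ^ n j)" for x
        proof -
          have "iterated j (target (Suc j) t) (v(j := x)) = iterated j (target j (t + 1 - x ^ n j)) (v(j := x))"
          proof (rule iterated_cong)
            fix v' :: "nat \<Rightarrow> real" assume "\<And>i. j \<le> i \<Longrightarrow> v' i = (v(j := x)) i"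
            from this[of j] show "target (Suc j) t v' = target j (t + 1 - x ^ n j) v'"
              using target_inside[OF inW, of t v'] True k by simp
          qed
          then show ?thesis by (simp add: it)
        qed
        then show ?thesis using inW by simp
      qed
      have lin: "rival (m - n j) (\<lambda>x. a - b * (t + 1 - x ^ n j))
        = rival (m - n j) (\<lambda>x. a - b * (1 - x ^ n j)) - (b * rival (m - n j) (\<lambda>x. 1)) * t" for t
      proof -
        have "rival (m - n j) (\<lambda>x. a - b * (t + 1 - x ^ n j)) = rival (m - n j) (\<lambda>x. (a - b * (1 - x ^ n j)) + (- b * t) * 1)"
          by (simp add: algebra_simps)
        also have "\<dots> = rival (m - n j) (\<lambda>x. a - b * (1 - x ^ n j)) + (- b * t) * rival (m - n j) (\<lambda>x. 1)"
          by (rule rival_linear) (intro continuous_intros)+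
        finally show ?thesis by simp
      qed
      have bd': "rival (m - n j) (\<lambda>x. a - b * (t + 1 - x ^ n j))
          \<le> p * ((1 - \<epsilon> / m) ^ (N + n j) * (1 - real (N + n j) * \<eta> / m - t))"
        if t: "0 \<le> t" "t \<le> (real l - real (k + n j)) * \<eta> / m" for t
      proof -
        have "rival (m - n j) (\<lambda>v. a - b * (t + 1 - v ^ n j)) \<le> c * ((1 - \<epsilon> / m) ^ n j * (1 - s - n j * \<eta> / m - t))"
          using True kl t by (intro round_inside[where r = "l - k"] Q c s) (auto simp: of_nat_diff diff_diff_eq)
        also have "\<dots> = p * ((1 - \<epsilon> / m) ^ (N + n j) * (1 - real (N + n j) * \<eta> / m - t))"
          by (simp add: c_def s_def power_add add_divide_distrib distrib_right)
        finally show ?thesis .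
      qed
      have kn: "k + n j = pos (Suc j) mod l" "N + n j \<le> k + n j" using ins(2) k N by auto
      have it'': "\<forall>t v. iterated (Suc j) (target (Suc j) t) v
          = rival (m - n j) (\<lambda>x. a - b * (1 - x ^ n j)) - (b * rival (m - n j) (\<lambda>x. 1)) * t"
        unfolding it' lin by simp
      show ?thesis
        using r inW kn p bd' it''
        by (intro exI[of _ p] exI[of _ "k + n j"] exI[of _ "N + n j"]
            exI[of _ "rival (m - n j) (\<lambda>x. a - b * (1 - x ^ n j))"] exI[of _ "b * rival (m - n j) (\<lambda>x. 1)"])
          (simp only: lin if_True simp_thms, simp add: lin)
    next
      case notW: False
      have "iterated (Suc j) (target (Suc j) t) v = a - b * t" for t v
        using notW it ins(1) target_skip(1)[OF notW] by (simp add: fun_eq_iff[symmetric] cong: iterated_cong)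
      moreover have "a - b * t \<le> p * ((1 - \<epsilon> / m) ^ N * (1 - N * \<eta> / m - t))"
        if t: "0 \<le> t" "t \<le> (real l - real (k + n j)) * \<eta> / m" for t
      proof (rule bd[OF t(1)])
        have "(real l - real (k + n j)) * \<eta> / m \<le> (real l - real k) * \<eta> / m"
          using eps mpos by (intro divide_right_mono mult_right_mono) auto
        then show "t \<le> (real l - real k) * \<eta> / m" using t by linarith
      qed
      moreover have "k + n j = pos (Suc j) mod l" "N \<le> k + n j" using ins(2) k N by auto
      ultimately show ?thesis using r notW p by auto
    qed
  next
    case False
    then have "l - pos j mod l \<le> n j" using k by simp
    from across[OF this] obtain d n3 where ac: "n j = (l - k) + d * l + n3" "n3 < l"
      "cur (Suc j) = cur j + d + 1" "pos (Suc j) mod l = n3" "piece (cur j) j = l - k"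
      "\<And>c. cur j < c \<Longrightarrow> c \<le> cur j + d \<Longrightarrow> piece c j = l" "piece (cur j + d + 1) j = n3"
      unfolding k by metis
    define p' where "p' = p * H (N + (if j \<in> W then l - k else 0)) * H (if j \<in> W then l else 0) ^ d"
    have r: "run H l off (flag_list (Suc j)) = (p', n3, if j \<in> W then n3 else 0)"
      unfolding run' ac(1) p'_def by (rule fold_step_across) (use kl ac in auto)
    have Hn: "0 \<le> H i" if "i \<le> l" for i
      using block_nonneg[of i 0] that eps by (simp add: H_def)
    have p': "0 \<le> p'" unfolding p'_def using p N kl by (auto intro!: mult_nonneg_nonneg Hn zero_le_power)
    show ?thesis
    proof (cases "j \<in> W")
      case inW: True
      define P where "P x = x ^ (d * l) * (a - b * (1 - x ^ (l - k)))" for x :: real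
      have contP: "continuous_on S P" for S unfolding P_def by (intro continuous_intros)
      have it': "iterated (Suc j) (target (Suc j) t) v = rival (m - n j) (\<lambda>x. P x * (x ^ n3 - t))" for t v
      proof -
        have "iterated j (target (Suc j) t) (v(j := x)) = P x * (x ^ n3 - t)" for x
        proof -
          have "iterated j (target (Suc j) t) (v(j := x))
              = iterated j (\<lambda>v. (x ^ (d * l) * (x ^ n3 - t)) * target j (1 - x ^ (l - k)) v) (v(j := x))"
          proof (rule iterated_cong)
            fix v' :: "nat \<Rightarrow> real" assume "\<And>i. j \<le> i \<Longrightarrow> v' i = (v(j := x)) i"
            from this[of j] have "v' j = x" by simp
            then show "target (Suc j) t v' = (x ^ (d * l) * (x ^ n3 - t)) * target j (1 - x ^ (l - k)) v'"
              using target_across[OF inW ac(3,5,6,7), of t v'] by simp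
          qed
          then show ?thesis by (simp add: it iterated_cmult P_def)
        qed
        then show ?thesis using inW by simp
      qed
      have lin: "rival (m - n j) (\<lambda>x. P x * (x ^ n3 - t))
        = rival (m - n j) (\<lambda>x. P x * x ^ n3) - rival (m - n j) P * t" for t
      proof -
        have "rival (m - n j) (\<lambda>x. P x * (x ^ n3 - t)) = rival (m - n j) (\<lambda>x. P x * x ^ n3 + (- t) * P x)"
          by (simp add: algebra_simps)
        also have "\<dots> = rival (m - n j) (\<lambda>x. P x * x ^ n3) + (- t) * rival (m - n j) P"
          by (rule rival_linear) (intro continuous_intros contP)+
        finally show ?thesis by simp
      qed
      have bd': "rival (m - n j) (\<lambda>x. P x * (x ^ n3 - t))
          \<le> p' * ((1 - \<epsilon> / m) ^ n3 * (1 - n3 * \<eta> / m - t))"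
        if t: "0 \<le> t" "t \<le> (real l - real n3) * \<eta> / m" for t
      proof -
        have "rival (m - ((l - k) + d * l + n3)) (\<lambda>v. v ^ (d * l) * ((a - b * (1 - v ^ (l - k))) * (v ^ n3 - t)))
          \<le> c * ((1 - \<epsilon> / m) ^ (l - k) * (1 - s - (l - k) * \<eta> / m)) * H l ^ d * ((1 - \<epsilon> / m) ^ n3 * (1 - t - n3 * \<eta> / m))"
          using n_le[of j] kl ac by (intro round_across Q c s t) auto
        also have "c * ((1 - \<epsilon> / m) ^ (l - k) * (1 - s - (l - k) * \<eta> / m)) = p * H (N + (l - k))"
          by (simp add: c_def s_def H_def power_add add_divide_distrib distrib_right)
        finally show ?thesis using inW by (simp add: P_def ac(1) p'_def mult.assoc algebra_simps)
      qed
      have it'': "\<forall>t v. iterated (Suc j) (target (Suc j) t) v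
          = rival (m - n j) (\<lambda>x. P x * x ^ n3) - rival (m - n j) P * t"
        unfolding it' lin by simp
      show ?thesis
        by (intro exI[of _ p'] exI[of _ n3] exI[of _ n3] exI[of _ "rival (m - n j) (\<lambda>x. P x * x ^ n3)"]
            exI[of _ "rival (m - n j) P"] conjI it'')
          (use r inW ac(4) p' bd' in \<open>auto simp: lin\<close>)
    next
      case notW: False
      \<comment> \<open>Irrelevant units have closed the cell, so \<open>t\<close> now refers to a
        fresh one: it contributes \<open>1 - t\<close>, and the closed cells keep their value at
        \<open>t = 0\<close>.\<close>
      have "iterated (Suc j) (target (Suc j) t) v = a - a * t" for t v
      proof -
        have "target (Suc j) t = (\<lambda>v. (1 - t) * target j 0 v)"
          using target_skip(2)[OF notW] ac(3) by (auto simp: fun_eq_iff)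
        then have "iterated (Suc j) (target (Suc j) t) v = (1 - t) * iterated j (target j 0) v"
          using notW by (simp only: iterated.simps if_False iterated_cmult)
        then show ?thesis by (simp add: it algebra_simps)
      qed
      moreover have "a - a * t \<le> p' * ((1 - \<epsilon> / m) ^ 0 * (1 - real 0 * \<eta> / m - t))"
        if t: "0 \<le> t" "t \<le> (real l - real n3) * \<eta> / m" for t
      proof -
        have "t \<le> (\<eta> * l / m) * (1 - n3 / l)" using t room_eq by simp
        also have "\<dots> \<le> 1 * (1 - n3 / l)"
        proof (rule mult_right_mono)
          show "\<eta> * l / m \<le> 1" using eta_half by linarith
        qed (use ac(2) in auto)
        finally have "t \<le> 1 - n3 / l" by simp
        moreover have "0 \<le> real n3 / l" by simp
        ultimately have t1: "t \<le> 1" by linarith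
        have "a \<le> p'" using Q[of 0] eps cH notW by (simp add: p'_def H_def)
        then have "a * (1 - t) \<le> p' * (1 - t)" using t1 by (intro mult_right_mono) auto
        then show ?thesis by (simp add: algebra_simps)
      qed
      ultimately show ?thesis using r notW ac(4) p'
        by (intro exI[of _ p'] exI[of _ n3] exI[of _ 0] exI[of _ a] exI[of _ a]) auto
    qed
  qed
qed

lemma iterated_target_bound: "iterated j (target j 0) v \<le> sval H (run H l off (flag_list j))"
proof -
  obtain p k N a b where r: "run H l off (flag_list j) = (p, k, N)" and "k = pos j mod l"
    and "\<And>t v. iterated j (target j t) v = a - b * t"
    and "\<And>t. 0 \<le> t \<Longrightarrow> t \<le> (real l - real k) * \<eta> / m \<Longrightarrow>
         a - b * t \<le> p * ((1 - \<epsilon> / m) ^ N * (1 - N * \<eta> / m - t))"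
    using iterated_target[of j] by blast
  moreover have "0 \<le> (real l - real k) * \<eta> / m" using calculation(2) mpos eps by simp
  ultimately show ?thesis by (fastforce simp: sval_def H_def)
qed

end

section \<open>Negative dependence\<close>

text \<open>The left side consists of the terms of order at most one in \<open>d\<close>.\<close>

lemma prod_add_ge:
  fixes a d :: "'a \<Rightarrow> real"
  assumes "finite J" "\<And>j. j \<in> J \<Longrightarrow> 0 \<le> a j" "\<And>j. j \<in> J \<Longrightarrow> 0 \<le> d j"
  shows "(\<Prod>j\<in>J. a j) + (\<Sum>j\<in>J. d j * (\<Prod>k\<in>J - {j}. a k)) \<le> (\<Prod>j\<in>J. a j + d j)"
  using assms
proof (induction J)
  case (insert x J)
  have eq: "(\<Prod>k\<in>insert x J - {j}. a k) = a x * (\<Prod>k\<in>J - {j}. a k)" if "j \<in> J" for j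
  proof -
    have "insert x J - {j} = insert x (J - {j})" using that insert by auto
    then show ?thesis using insert by simp
  qed
  have "(\<Prod>j\<in>insert x J. a j) + (\<Sum>j\<in>insert x J. d j * (\<Prod>k\<in>insert x J - {j}. a k))
      = a x * ((\<Prod>j\<in>J. a j) + (\<Sum>j\<in>J. d j * (\<Prod>k\<in>J - {j}. a k))) + d x * (\<Prod>j\<in>J. a j)"
    using insert by (simp add: eq sum_distrib_left algebra_simps)
  also have "\<dots> \<le> a x * (\<Prod>j\<in>J. a j + d j) + d x * (\<Prod>j\<in>J. a j + d j)"
    using insert by (intro add_mono mult_left_mono prod_mono) auto
  finally show ?case using insert by (simp add: distrib_right)
qed simp

text \<open>At most one of the sets is hit, so the product is affine in the indicators. Its
  expectation is the first-order part of the expanded right side.\<close>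

lemma one_hot_expectation:
  fixes e :: "'j \<Rightarrow> real"
  assumes "prob_space N" "finite J" "\<And>j. j \<in> J \<Longrightarrow> D j \<in> sets N" "disjoint_family_on D J"
    and e: "\<And>j. j \<in> J \<Longrightarrow> 0 \<le> e j" "\<And>j. j \<in> J \<Longrightarrow> e j \<le> 1"
  shows "(\<integral>u. (\<Prod>j\<in>J. 1 - e j * (1 - indicator (D j) u)) \<partial>N)
    \<le> (\<Prod>j\<in>J. 1 - e j * (1 - measure N (D j)))"
proof -
  interpret prob_space N by fact
  have eq: "(\<Prod>j\<in>J. 1 - e j * (1 - indicator (D j) u))
      = (\<Prod>j\<in>J. 1 - e j) + (\<Sum>j\<in>J. indicator (D j) u * (e j * (\<Prod>k\<in>J - {j}. 1 - e k)))" for u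
  proof (cases "\<exists>i\<in>J. u \<in> D i")
    case True
    then obtain i where i: "i \<in> J" "u \<in> D i" by auto
    have nd: "u \<notin> D j" if "j \<in> J" "j \<noteq> i" for j
      using assms(4) i that by (auto simp: disjoint_family_on_def)
    have "(\<Prod>j\<in>J. 1 - e j * (1 - indicator (D j) u)) = (\<Prod>k\<in>J - {i}. 1 - e k)"
      using i nd assms(2) by (subst prod.remove[of J i]) (auto intro!: prod.cong)
    moreover have "(\<Sum>j\<in>J. indicator (D j) u * (e j * (\<Prod>k\<in>J - {j}. 1 - e k))) = e i * (\<Prod>k\<in>J - {i}. 1 - e k)"
      using i nd assms(2) by (subst sum.remove[of J i]) (auto intro!: sum.neutral)
    moreover have "(\<Prod>j\<in>J. 1 - e j) = (1 - e i) * (\<Prod>k\<in>J - {i}. 1 - e k)"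
      using i assms(2) by (subst prod.remove[of J i]) auto
    ultimately show ?thesis by (simp add: algebra_simps)
  qed auto
  have "(\<integral>u. (\<Prod>j\<in>J. 1 - e j * (1 - indicator (D j) u)) \<partial>N)
      = (\<Prod>j\<in>J. 1 - e j) + (\<Sum>j\<in>J. (e j * measure N (D j)) * (\<Prod>k\<in>J - {j}. 1 - e k))"
    unfolding eq using assms(3)
    by (subst Bochner_Integration.integral_add)
      (auto simp: Bochner_Integration.integral_sum prob_space mult_ac emeasure_eq_measure intro!: sum.cong)
  also have "\<dots> \<le> (\<Prod>j\<in>J. (1 - e j) + e j * measure N (D j))"
    using assms(2) e by (intro prod_add_ge) auto
  finally show ?thesis by (simp add: algebra_simps)
qed

text \<open>
  Each coordinate \<open>U x\<close> hits at most one of the sets \<open>D x j\<close>, so the events that no coordinate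
  hits in round \<open>j\<close> are negatively dependent.
\<close>

lemma negative_dependence:
  fixes c :: "'j \<Rightarrow> real"
  assumes "finite I" "finite J" "\<And>x. prob_space (N x)"
    and "\<And>x j. x \<in> I \<Longrightarrow> j \<in> J \<Longrightarrow> D x j \<in> sets (N x)" "\<And>x. x \<in> I \<Longrightarrow> disjoint_family_on (D x) J"
    and "\<And>j. j \<in> J \<Longrightarrow> 0 \<le> c j" "\<And>j. j \<in> J \<Longrightarrow> c j \<le> 1"
  shows "(\<integral>U. (\<Prod>j\<in>J. 1 - c j * (\<Prod>x\<in>I. 1 - indicator (D x j) (U x))) \<partial>PiM I N)
    \<le> (\<Prod>j\<in>J. 1 - c j * (\<Prod>x\<in>I. 1 - measure (N x) (D x j)))"
  using assms(1,4-)
\<comment> \<open>Integrating out coordinate \<open>x\<close> turns \<open>c j\<close> into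
  \<open>c j * \<mu> j\<close>; for fixed other coordinates their factors are mere coefficients in
  \<open>one_hot_expectation\<close>.\<close>
proof (induction I arbitrary: c)
  case empty
  interpret prob_space "PiM {} N" by (rule prob_space_PiM) simp
  show ?case by (simp add: prob_space)
next
  case (insert x I)
  interpret product_prob_space N "insert x I" using assms(3) by (simp add: product_prob_space_def product_prob_space_axioms_def product_sigma_finite_def prob_space_imp_sigma_finite)
  interpret Q: prob_space "PiM I' N" for I' by (rule prob_space_PiM) (rule assms(3))
  interpret X: prob_space "N x" by (rule assms(3))
  let ?g = "\<lambda>I j U. \<Prod>x\<in>I. 1 - indicator (D x j) (U x) :: real"
  have g01: "0 \<le> ?g I' j U" "?g I' j U \<le> 1" for I' j U
    by (auto intro!: prod_nonneg prod_le_1 simp: indicator_def)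
  have gm: "?g I' j \<in> borel_measurable (PiM I'' N)" if "I' \<subseteq> I''" "I' \<subseteq> insert x I" "j \<in> J" for I' I'' j
  proof (rule borel_measurable_prod)
    fix y assume "y \<in> I'"
    then have "(\<lambda>U. U y) \<in> measurable (PiM I'' N) (N y)" "D y j \<in> sets (N y)"
      using that insert.prems by (auto intro!: measurable_component_singleton)
    then show "(\<lambda>U. 1 - indicator (D y j) (U y) :: real) \<in> borel_measurable (PiM I'' N)" by measurable
  qed
  have c01: "0 \<le> 1 - c j * ?g I' j U" "1 - c j * ?g I' j U \<le> 1" if "j \<in> J" for I' j U
  proof -
    have "c j * ?g I' j U \<le> 1 * 1" using that insert.prems g01 by (intro mult_mono) auto
    then show "0 \<le> 1 - c j * ?g I' j U" by simp
    show "1 - c j * ?g I' j U \<le> 1" using that insert.prems g01 by simp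
  qed
  have int: "integrable (PiM (insert x I) N) (\<lambda>U. \<Prod>j\<in>J. 1 - c j * ?g (insert x I) j U)"
  proof (rule Q.integrable_const_bound[where B = 1])
    show "AE U in PiM (insert x I) N. norm (\<Prod>j\<in>J. 1 - c j * ?g (insert x I) j U) \<le> 1"
      using c01 by (auto simp: abs_prod intro!: prod_le_1)
    show "(\<lambda>U. \<Prod>j\<in>J. 1 - c j * ?g (insert x I) j U) \<in> borel_measurable (PiM (insert x I) N)"
      by (rule borel_measurable_prod, intro borel_measurable_diff borel_measurable_times borel_measurable_const gm) auto
  qed
  define \<mu> where "\<mu> j = 1 - measure (N x) (D x j)" for j
  have \<mu>: "0 \<le> \<mu> j" "\<mu> j \<le> 1" for j by (auto simp: \<mu>_def)
  have "(\<integral>U. (\<Prod>j\<in>J. 1 - c j * ?g (insert x I) j U) \<partial>PiM (insert x I) N)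
      = (\<integral>U. (\<integral>u. (\<Prod>j\<in>J. 1 - c j * ?g (insert x I) j (U(x := u))) \<partial>N x) \<partial>PiM I N)"
    using insert by (intro product_integral_insert int) auto
  also have "\<dots> \<le> (\<integral>U. (\<Prod>j\<in>J. 1 - (c j * \<mu> j) * ?g I j U) \<partial>PiM I N)"
  proof (rule integral_mono')
    show "integrable (PiM I N) (\<lambda>U. \<Prod>j\<in>J. 1 - (c j * \<mu> j) * ?g I j U)"
    proof (rule Q.integrable_const_bound[where B = 1])
      have "0 \<le> 1 - (c j * \<mu> j) * ?g I j U \<and> 1 - (c j * \<mu> j) * ?g I j U \<le> 1" if "j \<in> J" for j U
      proof -
        have "(c j * \<mu> j) * ?g I j U \<le> (1 * 1) * 1" using that insert.prems g01 \<mu> by (intro mult_mono) auto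
        moreover have "0 \<le> (c j * \<mu> j) * ?g I j U" using that insert.prems g01 \<mu> by simp
        ultimately show ?thesis by simp
      qed
      then show "AE U in PiM I N. norm (\<Prod>j\<in>J. 1 - (c j * \<mu> j) * ?g I j U) \<le> 1"
        by (auto simp: abs_prod intro!: prod_le_1)
      show "(\<lambda>U. \<Prod>j\<in>J. 1 - (c j * \<mu> j) * ?g I j U) \<in> borel_measurable (PiM I N)"
        by (rule borel_measurable_prod, intro borel_measurable_diff borel_measurable_times borel_measurable_const gm) auto
    qed
    fix U
    have gx: "?g (insert x I) j (U(x := u)) = ?g I j U * (1 - indicator (D x j) u)" for j u
    proof -
      have "(\<Prod>y\<in>I. 1 - indicator (D y j) ((U(x := u)) y)) = (?g I j U :: real)"
        using insert(2) by (intro prod.cong) auto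
      then show ?thesis using insert by simp
    qed
    have "(\<integral>u. (\<Prod>j\<in>J. 1 - c j * ?g (insert x I) j (U(x := u))) \<partial>N x)
        = (\<integral>u. (\<Prod>j\<in>J. 1 - (c j * ?g I j U) * (1 - indicator (D x j) u)) \<partial>N x)"
      by (simp only: gx mult.assoc)
    also have "\<dots> \<le> (\<Prod>j\<in>J. 1 - (c j * ?g I j U) * (1 - measure (N x) (D x j)))"
      using insert.prems g01 by (intro one_hot_expectation assms(2) assms(3)) (auto intro!: mult_le_one)
    finally show "(\<integral>u. (\<Prod>j\<in>J. 1 - c j * ?g (insert x I) j (U(x := u))) \<partial>N x)
        \<le> (\<Prod>j\<in>J. 1 - (c j * \<mu> j) * ?g I j U)"
      by (simp add: \<mu>_def mult_ac)
    show "0 \<le> (\<Prod>j\<in>J. 1 - (c j * \<mu> j) * ?g I j U)"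
    proof (rule prod_nonneg)
      fix j assume "j \<in> J"
      then have "(c j * \<mu> j) * ?g I j U \<le> (1 * 1) * 1" using insert.prems g01 \<mu> by (intro mult_mono) auto
      then show "0 \<le> 1 - (c j * \<mu> j) * ?g I j U" by simp
    qed
  qed
  also have "\<dots> \<le> (\<Prod>j\<in>J. 1 - (c j * \<mu> j) * (\<Prod>y\<in>I. 1 - measure (N y) (D y j)))"
    using insert.prems \<mu> by (intro insert.IH) (auto intro!: mult_le_one)
  finally show ?case using insert by (simp add: \<mu>_def mult_ac)
qed

section \<open>The strength rule\<close>

definition unif :: "real measure" where "unif = uniform_measure lborel {0..1}"

lemma unif_basic: "prob_space unif" "sets unif = sets borel" "space unif = UNIV"
  by (auto simp: unif_def intro!: prob_space_uniform_measure)

lemma measure_unif: "A \<in> sets borel \<Longrightarrow> measure unif A = measure lborel ({0..1} \<inter> A)"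
  by (simp add: unif_def measure_uniform_measure)

lemma measure_unif_Ico:
  assumes "0 \<le> a" "a \<le> b" "b \<le> (1::real)"
  shows "measure unif {a..<b} = b - a"
proof -
  have "{0..1} \<inter> {a..<b} = {a..<b}" using assms by auto
  then show ?thesis using assms by (simp add: measure_unif)
qed

lemma measure_unif_le:
  assumes "A \<in> sets borel" "A \<subseteq> {a..b}" "a \<le> (b::real)"
  shows "measure unif A \<le> b - a"
proof -
  have "measure lborel ({0..1} \<inter> A) \<le> measure lborel {a..b}"
    using assms by (intro measure_mono_fmeasurable) (auto intro!: fmeasurableI)
  then show ?thesis using assms by (simp add: measure_unif)
qed

context cell_params begin

definition psize :: "nat \<Rightarrow> nat \<Rightarrow> nat \<Rightarrow> nat" where
  "psize q n c = min (q + n) (c * l + l) - max q (c * l)"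
definition pstart :: "nat \<Rightarrow> nat \<Rightarrow> nat" where
  "pstart q c = max q (c * l) - c * l"

text \<open>
  With a uniform seed \<open>u\<close> of cell \<open>c\<close>, the strength of a piece of \<open>n\<close> units has, above \<open>\<rho>\<close>, the law
  of the maximum of \<open>n\<close> independent uniform variables; strength 0 means that the piece is no
  candidate.
\<close>

definition strength :: "nat \<Rightarrow> nat \<Rightarrow> nat \<Rightarrow> real \<Rightarrow> real" where
  "strength q n c u = (let s = pstart q c / l; k = psize q n c in
     if 0 < k \<and> s \<le> u \<and> u < s + (1 - \<rho> ^ k) then root k (1 - (u - s)) else 0)"

text \<open>The reason why all pieces of a cell fit into one seed: a piece of \<open>k\<close> units
  needs an interval no longer than its share \<open>k / l\<close>.\<close>

lemma one_minus_rho_power: "1 - \<rho> ^ k \<le> k / l"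
  using rho_power_ge[of k] by simp

lemma pstart_psize: "0 < psize q n c \<Longrightarrow> pstart q c + psize q n c \<le> l"
  by (auto simp: psize_def pstart_def)

lemma strength_measurable: "strength q n c \<in> borel_measurable borel"
proof -
  let ?s = "pstart q c / l" and ?k = "psize q n c"
  have "strength q n c = (\<lambda>u. indicator (if 0 < ?k then {?s..<?s + (1 - \<rho> ^ ?k)} else {}) u * root ?k (1 - (u - ?s)))"
    by (auto simp: fun_eq_iff strength_def Let_def indicator_def)
  moreover have "\<dots> \<in> borel_measurable borel"
    by (intro borel_measurable_times borel_measurable_indicator borel_measurable_continuous_onI continuous_intros) auto
  ultimately show ?thesis by simp
qed

lemma strength_cases:
  assumes "strength q n c u \<noteq> 0"
  defines "s \<equiv> pstart q c / l" and "k \<equiv> psize q n c"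
  shows "0 < k" "s \<le> u" "u < s + (1 - \<rho> ^ k)" "strength q n c u = root k (1 - (u - s))"
  using assms by (auto simp: strength_def Let_def split: if_splits)

lemma strength_range:
  assumes "strength q n c u \<noteq> 0"
  shows "\<rho> < strength q n c u" "strength q n c u \<le> 1"
proof -
  note h = strength_cases[OF assms]
  let ?k = "psize q n c" let ?y = "1 - (u - pstart q c / l)"
  have y: "\<rho> ^ ?k < ?y" "?y \<le> 1" using h by auto
  have "root ?k (\<rho> ^ ?k) < root ?k ?y" using h(1) y by (intro real_root_less_mono) auto
  then show "\<rho> < strength q n c u" using h(1,4) rho by (simp add: real_root_power_cancel)
  have "root ?k ?y \<le> root ?k 1" using h(1) y by (intro real_root_le_mono) auto
  then show "strength q n c u \<le> 1" using h(1,4) by simp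
qed

lemma strength_nonneg: "0 \<le> strength q n c u"
  by (cases "strength q n c u = 0") (use strength_range(1)[of q n c u] rho in linarith)+

lemma strength_gt_iff:
  assumes "\<rho> \<le> v" "v \<le> 1"
  shows "v < strength q n c u \<longleftrightarrow> u \<in> {pstart q c / l ..< pstart q c / l + (1 - v ^ psize q n c)}"
proof -
  let ?k = "psize q n c" let ?s = "pstart q c / l" let ?y = "1 - (u - ?s)"
  have v: "0 < v" using assms rho by simp
  have vk: "\<rho> ^ ?k \<le> v ^ ?k" using assms rho by (intro power_mono) auto
  show ?thesis
  proof (cases "strength q n c u = 0")
    case True
    have "\<not> (?s \<le> u \<and> u < ?s + (1 - v ^ ?k))"
    proof
      assume a: "?s \<le> u \<and> u < ?s + (1 - v ^ ?k)"
      then have k: "0 < ?k" by (cases ?k) auto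
      have "strength q n c u = root ?k ?y" using a k vk by (simp add: strength_def Let_def)
      moreover have "0 < v ^ ?k" using v by simp
      then have "0 < ?y" using a by simp
      ultimately show False using True k by simp
    qed
    then show ?thesis using True v by auto
  next
    case False
    note h = strength_cases[OF False]
    have "v < root ?k ?y \<longleftrightarrow> root ?k (v ^ ?k) < root ?k ?y"
      using h(1) v by (simp add: real_root_power_cancel)
    also have "\<dots> \<longleftrightarrow> v ^ ?k < ?y" using h(1) by simp
    finally show ?thesis using h by auto
  qed
qed

lemma strength_ge_subset:
  assumes "\<rho> < t"
  shows "{u. t \<le> strength q n c u} \<subseteq> {pstart q c / l .. pstart q c / l + (1 - t ^ psize q n c)}"
proof safe
  fix u assume t: "t \<le> strength q n c u"
  let ?k = "psize q n c" let ?s = "pstart q c / l" let ?y = "1 - (u - ?s)"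
  have "strength q n c u \<noteq> 0" using t assms rho by auto
  note h = strength_cases[OF this]
  have "0 < ?y" using h(3) zero_less_power[OF rho(1), of ?k] by linarith
  have "t \<le> root ?k ?y" using t unfolding h(4) .
  then have "t ^ ?k \<le> root ?k ?y ^ ?k" using assms rho by (intro power_mono) linarith+
  also have "\<dots> = ?y" using h(1) \<open>0 < ?y\<close> by (simp add: real_root_pow_pos2)
  finally show "u \<in> {?s .. ?s + (1 - t ^ ?k)}" using h(2) by simp
qed

lemma strength_pos_subset:
  "{u. 0 < strength q n c u} \<subseteq> {pstart q c / l .. pstart q c / l + (1 - \<rho> ^ psize q n c)}"
proof safe
  fix u assume "0 < strength q n c u"
  then have "strength q n c u \<noteq> 0" by simp
  note h = strength_cases[OF this]
  show "u \<in> {pstart q c / l .. pstart q c / l + (1 - \<rho> ^ psize q n c)}"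
    using h(2,3) by simp
qed

lemma strength_disjoint:
  assumes "q + n \<le> q'" "strength q n c u \<noteq> 0"
  shows "strength q' n' c u = 0"
proof (rule ccontr)
  assume "strength q' n' c u \<noteq> 0"
  note h' = strength_cases[OF this] and h = strength_cases[OF assms(2)]
  have "pstart q c + psize q n c \<le> pstart q' c"
    using assms(1) h(1) h'(1) by (auto simp: pstart_def psize_def)
  then have "real (pstart q c) + real (psize q n c) \<le> real (pstart q' c)" by linarith
  then have "pstart q c / l + psize q n c / l \<le> pstart q' c / l"
    using mpos by (simp add: divide_right_mono add_divide_distrib[symmetric])
  then show False using h(3) h'(2) one_minus_rho_power[of "psize q n c"] by linarith
qed

text \<open>As \<open>l > 0\<close>, cell \<open>c\<close> starts no earlier than unit
  \<open>c\<close>; hence no unit before \<open>q + n\<close> lies in a cell with index above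
  \<open>q + n\<close>.\<close>

definition estrength :: "nat \<Rightarrow> nat \<Rightarrow> (nat \<Rightarrow> real) \<Rightarrow> real" where
  "estrength q n U = Max ((\<lambda>c. strength q n c (U c)) ` {..q + n})"

lemma estrength_le_iff:
  assumes "q + n \<le> C" "0 \<le> x"
  shows "estrength q n U \<le> x \<longleftrightarrow> (\<forall>c\<le>C. strength q n c (U c) \<le> x)"
proof -
  have z: "strength q n c (U c) = 0" if "q + n < c" for c
  proof -
    have "c \<le> c * l" using mpos by simp
    then have "q + n \<le> c * l" using that by linarith
    then have "psize q n c = 0" by (simp add: psize_def min_le_iff_disj le_max_iff_disj)
    then show ?thesis by (simp add: strength_def Let_def)
  qed
  have "estrength q n U \<le> x \<longleftrightarrow> (\<forall>c\<le>q + n. strength q n c (U c) \<le> x)"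
    unfolding estrength_def by (subst Max_le_iff) auto
  also have "\<dots> \<longleftrightarrow> (\<forall>c\<le>C. strength q n c (U c) \<le> x)"
    using z assms by (metis not_le order.trans)
  finally show ?thesis .
qed

lemma estrength_in: "\<exists>c\<le>q + n. estrength q n U = strength q n c (U c)"
proof -
  have "estrength q n U \<in> (\<lambda>c. strength q n c (U c)) ` {..q + n}"
    unfolding estrength_def by (intro Max_in) auto
  then show ?thesis by auto
qed

lemma estrength_range: "0 \<le> estrength q n U" "estrength q n U \<le> 1"
    "0 < estrength q n U \<Longrightarrow> \<rho> < estrength q n U"
  using estrength_in[of q n U] strength_nonneg strength_range
  by (metis, metis less_eq_real_def zero_le_one, metis less_irrefl)

lemma estrength_pos_count: "0 < estrength q n U \<Longrightarrow> 0 < n"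
proof (rule ccontr)
  assume p: "0 < estrength q n U" and "\<not> 0 < n"
  then have "psize q n c = 0" for c by (simp add: psize_def)
  then have "strength q n c (U c) = 0" for c by (simp add: strength_def)
  then show False using p estrength_in[of q n U] by auto
qed

lemma estrength_measurable:
  assumes "\<And>c. c \<le> q + n \<Longrightarrow> (\<lambda>\<omega>. f \<omega> c) \<in> borel_measurable M"
  shows "(\<lambda>\<omega>. estrength q n (f \<omega>)) \<in> borel_measurable M"
  unfolding estrength_def
  by (rule borel_measurable_Max) (auto intro!: measurable_compose[OF assms strength_measurable])

section \<open>Rival integrals as loss probabilities\<close>

lemma rival_cong:
  assumes "\<And>v. \<rho> \<le> v \<Longrightarrow> v \<le> 1 \<Longrightarrow> f v = g v"
  shows "rival M f = rival M g"
  unfolding rival_def using assms rho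
  by (auto intro!: arg_cong2[where f = "(+)"] Bochner_Integration.integral_cong simp: indicator_def)

lemma rival_one: "n \<le> m \<Longrightarrow> rival (m - n) (\<lambda>_. 1) = u0 n"
  using rival_moments(1)[of n 0] mpos by (cases "n = m") (auto simp: rival_0 u0_def)

text \<open>The probability of losing with own strength \<open>t\<close> against \<open>M\<close>
  independent rival units; a value \<open>t \<le> \<rho>\<close> stands for no candidacy.\<close>

lemma rival_threshold:
  assumes "0 \<le> t" "t \<le> 1"
  shows "rival M (\<lambda>x. of_bool (t \<le> x)) = (if t \<le> \<rho> then rival M (\<lambda>_. 1) else 1 - t ^ M)"
proof (cases "t \<le> \<rho>")
  case True
  then show ?thesis by (auto intro!: rival_cong)
next
  case False
  show ?thesis
  proof (cases M)
    case (Suc M')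
    have "(LINT v|lborel. indicator {\<rho>..1} v * (M * v ^ (M - 1) * of_bool (t \<le> v)))
        = (LINT v|lborel. M * (v ^ M' * indicator {t..1} v))"
      using False Suc by (intro Bochner_Integration.integral_cong) (auto simp: indicator_def)
    also have "\<dots> = M * (LINT v|lborel. v ^ M' * indicator {t..1} v)"
      by (rule integral_mult_right_zero)
    also have "(LINT v|lborel. v ^ M' * indicator {t..1} v) = (1 ^ Suc M' - t ^ Suc M') / Suc M'"
      using assms by (intro integral_power)
    also have "M * \<dots> = 1 - t ^ M" using Suc by simp
    finally show ?thesis using False by (simp add: rival_def)
  qed (use False in \<open>simp add: rival_0\<close>)
qed

lemma rival_Fubini:
  assumes "prob_space P" "t \<in> borel_measurable P" "\<Psi> \<in> borel_measurable P" "\<And>U. \<bar>\<Psi> U\<bar> \<le> 1"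
  shows "(\<integral>U. rival M (\<lambda>x. of_bool (t U \<le> x)) * \<Psi> U \<partial>P)
    = rival M (\<lambda>x. \<integral>U. of_bool (t U \<le> x) * \<Psi> U \<partial>P)"
proof -
  interpret prob_space P by fact
  interpret pair_sigma_finite lborel P ..
  note [measurable] = assms(2,3)
  define f where "f x U = indicator {\<rho>..1} x * (M * x ^ (M - 1) * of_bool (t U \<le> x)) * \<Psi> U" for x :: real and U
  have int: "integrable (lborel \<Otimes>\<^sub>M P) (case_prod f)"
  proof (rule integrableI_bounded_set[where A = "{\<rho>..1} \<times> space P" and B = M])
    show "emeasure (lborel \<Otimes>\<^sub>M P) ({\<rho>..1} \<times> space P) < \<infinity>"
      using rho by (subst sigma_finite_measure.emeasure_pair_measure_Times[OF prob_space_imp_sigma_finite[OF assms(1)]])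
          (auto simp: emeasure_space_1)
    show "case_prod f \<in> borel_measurable (lborel \<Otimes>\<^sub>M P)"
      unfolding f_def by measurable
    have "\<bar>f x U\<bar> \<le> M" for x U
    proof (cases "x \<in> {\<rho>..1}")
      case True
      have "\<bar>x ^ (M - 1)\<bar> \<le> 1" using True rho by (auto simp: power_le_one)
      then have "(\<bar>x ^ (M - 1)\<bar> * \<bar>of_bool (t U \<le> x)\<bar>) * \<bar>\<Psi> U\<bar> \<le> (1 * 1) * 1"
        using assms(4) by (intro mult_mono) auto
      then have "M * ((\<bar>x ^ (M - 1)\<bar> * \<bar>of_bool (t U \<le> x)\<bar>) * \<bar>\<Psi> U\<bar>) \<le> real M * 1"
        by (intro mult_left_mono) auto
      then show ?thesis using True by (simp add: f_def abs_mult mult.assoc)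
    qed (simp add: f_def)
    then show "AE z in lborel \<Otimes>\<^sub>M P. z \<in> {\<rho>..1} \<times> space P \<longrightarrow> norm (case_prod f z) \<le> M" by auto
    show "AE z in lborel \<Otimes>\<^sub>M P. z \<notin> {\<rho>..1} \<times> space P \<longrightarrow> case_prod f z = 0"
      by (rule AE_I2) (auto simp: f_def space_pair_measure indicator_def split: if_splits)
  qed auto
  let ?I = "\<lambda>U. LINT x|lborel. indicator {\<rho>..1} x * (M * x ^ (M - 1) * of_bool (t U \<le> x))"
  have fx: "(LINT x|lborel. f x U) = ?I U * \<Psi> U" for U
    unfolding f_def by (rule integral_mult_left_zero)
  have i1: "integrable P (\<lambda>U. ?I U * \<Psi> U)"
    using integrable_snd[OF int] by (simp add: fx)
  have i2: "integrable P (\<lambda>U. of_bool (t U \<le> \<rho>) * \<Psi> U)"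
    using assms(4) by (intro integrable_const_bound[where B = 1]) (auto simp: abs_mult mult_le_one)
  have "(\<integral>U. rival M (\<lambda>x. of_bool (t U \<le> x)) * \<Psi> U \<partial>P)
      = (\<integral>U. ?I U * \<Psi> U + M / m * \<rho> ^ M * (of_bool (t U \<le> \<rho>) * \<Psi> U) \<partial>P)"
    by (simp only: rival_def distrib_right mult.assoc)
  also have "\<dots> = (\<integral>U. ?I U * \<Psi> U \<partial>P) + M / m * \<rho> ^ M * (\<integral>U. of_bool (t U \<le> \<rho>) * \<Psi> U \<partial>P)"
    by (subst Bochner_Integration.integral_add) (use i1 i2 in auto)
  also have "(\<integral>U. ?I U * \<Psi> U \<partial>P) = (LINT x|lborel. (\<integral>U. f x U \<partial>P))"
    using Fubini_integral[OF int] by (simp only: fx)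
  also have "(LINT x|lborel. (\<integral>U. f x U \<partial>P))
      = (LINT x|lborel. indicator {\<rho>..1} x * (M * x ^ (M - 1) * (\<integral>U. of_bool (t U \<le> x) * \<Psi> U \<partial>P)))"
    unfolding f_def by (intro Bochner_Integration.integral_cong refl) (simp add: mult.assoc)
  finally show ?thesis unfolding rival_def .
qed

end

lemma prod_one_minus_indicator:
  assumes "finite J" "disjoint_family_on A J"
  shows "(\<Prod>j\<in>J. 1 - indicator (A j) u) = (1 - (\<Sum>j\<in>J. indicator (A j) u) :: real)"
proof (cases "\<exists>i\<in>J. u \<in> A i")
  case True
  then obtain i where i: "i \<in> J" "u \<in> A i" by auto
  have nd: "u \<notin> A j" if "j \<in> J" "j \<noteq> i" for j
    using assms(2) i that by (auto simp: disjoint_family_on_def)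
  have "(\<Sum>j\<in>J. indicator (A j) u) = (1::real)"
    using i nd assms(1) by (subst sum.remove[of J i]) (auto intro!: sum.neutral)
  moreover have "(\<Prod>j\<in>J. 1 - indicator (A j) u) = (0::real)"
    using i assms(1) by (intro prod_zero bexI[of _ i]) auto
  ultimately show ?thesis by simp
qed auto

context cell_run begin

section \<open>One vertex against independent rival levels\<close>

lemma piece_psize: "piece c j = psize (pos j) (n j) c"
  by (simp add: piece_def psize_def)

lemma iterated_cong_range:
  "(\<And>v'. (\<And>i. i \<in> W \<Longrightarrow> i < j \<Longrightarrow> \<rho> \<le> v' i \<and> v' i \<le> 1) \<Longrightarrow> (\<And>i. j \<le> i \<Longrightarrow> v' i = v i) \<Longrightarrow> F v' = F' v')
    \<Longrightarrow> iterated j F v = iterated j F' v"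
proof (induction j arbitrary: v)
  case (Suc j)
  show ?case
  proof (cases "j \<in> W")
    case True
    have "iterated j F (v(j := x)) = iterated j F' (v(j := x))" if "\<rho> \<le> x" "x \<le> 1" for x
    proof (rule Suc.IH)
      fix v' assume a: "\<And>i. i \<in> W \<Longrightarrow> i < j \<Longrightarrow> \<rho> \<le> v' i \<and> v' i \<le> 1" "\<And>i. j \<le> i \<Longrightarrow> v' i = (v(j := x)) i"
      have "v' j = x" using a(2)[of j] by simp
      then show "F v' = F' v'" using a that by (intro Suc.prems) (auto simp: less_Suc_eq)
    qed
    then show ?thesis using True by (auto intro!: rival_cong)
  next
    case False
    have "iterated j F v = iterated j F' v"
    proof (rule Suc.IH)
      fix v' assume a: "\<And>i. i \<in> W \<Longrightarrow> i < j \<Longrightarrow> \<rho> \<le> v' i \<and> v' i \<le> 1" "\<And>i. j \<le> i \<Longrightarrow> v' i = v i"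
      show "F v' = F' v'"
      proof (rule Suc.prems)
        fix i
        { assume "i \<in> W" "i < Suc j" then show "\<rho> \<le> v' i \<and> v' i \<le> 1" using a(1) False by (auto simp: less_Suc_eq) }
        { assume "Suc j \<le> i" then show "v' i = v i" using a(2) by simp }
      qed
    qed
    then show ?thesis using False by simp
  qed
qed simp

text \<open>The expectation is moved inward one round at a time by \<open>rival_Fubini\<close>;
  \<open>\<Psi>\<close> collects the indicators of the rounds already peeled off.\<close>

lemma rival_iterated:
  assumes P: "prob_space P" and t: "\<And>j. t j \<in> borel_measurable P" "\<And>j U. 0 \<le> t j U \<and> t j U \<le> 1"
    and \<Psi>: "\<Psi> \<in> borel_measurable P" "\<And>U. \<bar>\<Psi> U\<bar> \<le> 1"
  shows "(\<integral>U. (\<Prod>j\<in>W \<inter> {..<k}. rival (m - n j) (\<lambda>x. of_bool (t j U \<le> x))) * \<Psi> U \<partial>P)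
    = iterated k (\<lambda>v. \<integral>U. (\<Prod>j\<in>W \<inter> {..<k}. of_bool (t j U \<le> v j)) * \<Psi> U \<partial>P) v"
  using \<Psi>
proof (induction k arbitrary: \<Psi> v)
  case (Suc k)
  let ?g = "\<lambda>j U. rival (m - n j) (\<lambda>x. of_bool (t j U \<le> x))"
  have geq: "?g j = (\<lambda>U. if t j U \<le> \<rho> then u0 (n j) else 1 - t j U ^ (m - n j))" for j
    using t(2) n_le rival_threshold rival_one by (auto simp: fun_eq_iff)
  have gm: "?g j \<in> borel_measurable P" for j unfolding geq using t(1)[of j] by measurable
  have g01: "0 \<le> ?g j U \<and> ?g j U \<le> 1" for j U
    using fun_cong[OF geq, of j U] u0_bounds(1)[OF n_le[of j]] u0_bounds(2)[of "n j"] t(2)[of j U]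
    by (auto simp: power_le_one)
  show ?case
  proof (cases "k \<in> W")
    case True
    then have W: "W \<inter> {..<Suc k} = insert k (W \<inter> {..<k})" by auto
    let ?G = "\<lambda>U. (\<Prod>j\<in>W \<inter> {..<k}. ?g j U)"
    have Gm: "?G \<in> borel_measurable P" by (intro borel_measurable_prod gm)
    have G1: "\<bar>?G U * \<Psi> U\<bar> \<le> 1" for U
    proof -
      have "\<bar>?G U\<bar> * \<bar>\<Psi> U\<bar> \<le> 1 * 1"
        using Suc.prems(2)[of U] g01 by (intro mult_mono) (auto simp: abs_prod intro!: prod_le_1)
      then show ?thesis by (simp add: abs_mult)
    qed
    have "(\<integral>U. (\<Prod>j\<in>W \<inter> {..<Suc k}. ?g j U) * \<Psi> U \<partial>P) = (\<integral>U. ?g k U * (?G U * \<Psi> U) \<partial>P)"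
      by (simp add: W mult.assoc)
    also have "\<dots> = rival (m - n k) (\<lambda>x. \<integral>U. of_bool (t k U \<le> x) * (?G U * \<Psi> U) \<partial>P)"
      using Gm Suc.prems G1 t(1) by (intro rival_Fubini P) auto
    also have "(\<lambda>x. \<integral>U. of_bool (t k U \<le> x) * (?G U * \<Psi> U) \<partial>P)
        = (\<lambda>x. iterated k (\<lambda>v. \<integral>U. (\<Prod>j\<in>W \<inter> {..<Suc k}. of_bool (t j U \<le> v j)) * \<Psi> U \<partial>P) (v(k := x)))"
    proof
      fix x
      let ?\<Psi> = "\<lambda>U. of_bool (t k U \<le> x) * \<Psi> U"
      have pm: "?\<Psi> \<in> borel_measurable P" using t(1)[of k] Suc.prems(1) by measurable
      have "(\<integral>U. of_bool (t k U \<le> x) * (?G U * \<Psi> U) \<partial>P) = (\<integral>U. ?G U * ?\<Psi> U \<partial>P)"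
        by (simp add: mult.left_commute)
      also have "\<dots> = iterated k (\<lambda>v. \<integral>U. (\<Prod>j\<in>W \<inter> {..<k}. of_bool (t j U \<le> v j)) * ?\<Psi> U \<partial>P) (v(k := x))"
        using pm Suc.prems(2) by (intro Suc.IH) auto
      also have "\<dots> = iterated k (\<lambda>v. \<integral>U. (\<Prod>j\<in>W \<inter> {..<Suc k}. of_bool (t j U \<le> v j)) * \<Psi> U \<partial>P) (v(k := x))"
      proof (rule iterated_cong)
        fix v' :: "nat \<Rightarrow> real" assume "\<And>i. k \<le> i \<Longrightarrow> v' i = (v(k := x)) i"
        from this[of k] have "v' k = x" by simp
        then show "(\<integral>U. (\<Prod>j\<in>W \<inter> {..<k}. of_bool (t j U \<le> v' j)) * ?\<Psi> U \<partial>P)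
          = (\<integral>U. (\<Prod>j\<in>W \<inter> {..<Suc k}. of_bool (t j U \<le> v' j)) * \<Psi> U \<partial>P)"
          by (simp add: W mult_ac)
      qed
      finally show "(\<integral>U. of_bool (t k U \<le> x) * (?G U * \<Psi> U) \<partial>P)
        = iterated k (\<lambda>v. \<integral>U. (\<Prod>j\<in>W \<inter> {..<Suc k}. of_bool (t j U \<le> v j)) * \<Psi> U \<partial>P) (v(k := x))" .
    qed
    finally show ?thesis using True by simp
  next
    case False
    then have "W \<inter> {..<Suc k} = W \<inter> {..<k}" by (auto simp: less_Suc_eq)
    then show ?thesis using Suc.IH[OF Suc.prems, of v] False by simp
  qed
qed simp

text \<open>For fixed levels the event factorises over the cells, whose seeds are independent, and
  the factor of each cell is its \<open>hole\<close>. The injection \<open>\<kappa>\<close> places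
  the cells among the coordinates of a larger family.\<close>

lemma lose_all_integral:
  assumes inj: "inj_on \<kappa> {..C}" and N: "\<And>x. prob_space (N x)" "\<And>c. N (\<kappa> c) = unif"
    and C: "pos R \<le> C" and v: "\<And>j. j \<in> W \<Longrightarrow> j < R \<Longrightarrow> \<rho> \<le> v j \<and> v j \<le> 1"
  shows "(\<integral>U. (\<Prod>j\<in>W \<inter> {..<R}. of_bool (estrength (pos j) (n j) (\<lambda>c. U (\<kappa> c)) \<le> v j)) \<partial>PiM (\<kappa> ` {..C}) N)
    = target R 0 v"
proof -
  interpret product_sigma_finite N using N(1) by (simp add: product_sigma_finite_def prob_space_imp_sigma_finite)
  interpret u: prob_space unif by (rule unif_basic)
  define J where "J = W \<inter> {..<R}"
  have J: "finite J" by (simp add: J_def)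
  define A where "A c j = {pstart (pos j) c / l ..< pstart (pos j) c / l + (1 - v j ^ piece c j)}" for c j
  have A: "v j < strength (pos j) (n j) c u \<longleftrightarrow> u \<in> A c j" if "j \<in> J" for c j u
    using strength_gt_iff[of "v j"] v that by (simp add: A_def J_def piece_psize)
  have As: "A c j \<in> sets unif" for c j by (simp add: A_def unif_basic)
  have posC: "pos j + n j \<le> C" if "j \<in> J" for j
    using pos_mono[of "Suc j" R] that C by (simp add: J_def pos_Suc)
  have ev: "of_bool (estrength (pos j) (n j) (\<lambda>c. U (\<kappa> c)) \<le> v j) = (\<Prod>c\<le>C. 1 - indicator (A c j) (U (\<kappa> c)) :: real)"
    if "j \<in> J" for j U
  proof -
    have "0 \<le> v j" using v that rho by (force simp: J_def)
    then have "estrength (pos j) (n j) (\<lambda>c. U (\<kappa> c)) \<le> v j \<longleftrightarrow> (\<forall>c\<le>C. U (\<kappa> c) \<notin> A c j)"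
      using A[OF that] posC[OF that] by (subst estrength_le_iff) (auto simp: not_less[symmetric])
    moreover have "(\<Prod>c\<le>C. 1 - indicator (A c j) (U (\<kappa> c)) :: real) = of_bool (\<forall>c\<le>C. U (\<kappa> c) \<notin> A c j)"
      by (auto simp: indicator_def intro: prod.neutral)
    ultimately show ?thesis by simp
  qed
  define F where "F x u = (\<Prod>j\<in>J. 1 - indicator (A (inv_into {..C} \<kappa> x) j) u :: real)" for x u
  have F: "F (\<kappa> c) u = (\<Prod>j\<in>J. 1 - indicator (A c j) u)" if "c \<le> C" for c u
    using inj that by (simp add: F_def)
  have "(\<integral>U. (\<Prod>j\<in>J. of_bool (estrength (pos j) (n j) (\<lambda>c. U (\<kappa> c)) \<le> v j)) \<partial>PiM (\<kappa> ` {..C}) N)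
      = (\<integral>U. (\<Prod>x\<in>\<kappa> ` {..C}. F x (U x)) \<partial>PiM (\<kappa> ` {..C}) N)"
  proof (rule Bochner_Integration.integral_cong)
    fix U
    have "(\<Prod>j\<in>J. of_bool (estrength (pos j) (n j) (\<lambda>c. U (\<kappa> c)) \<le> v j))
        = (\<Prod>j\<in>J. \<Prod>c\<le>C. 1 - indicator (A c j) (U (\<kappa> c)) :: real)"
      using ev by (intro prod.cong) auto
    also have "\<dots> = (\<Prod>c\<le>C. F (\<kappa> c) (U (\<kappa> c)))"
      by (subst prod.swap) (simp add: F)
    finally show "(\<Prod>j\<in>J. of_bool (estrength (pos j) (n j) (\<lambda>c. U (\<kappa> c)) \<le> v j)) = (\<Prod>x\<in>\<kappa> ` {..C}. F x (U x))"
      by (simp add: prod.reindex[OF inj])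
  qed simp
  also have "\<dots> = (\<Prod>x\<in>\<kappa> ` {..C}. integral\<^sup>L (N x) (F x))"
  proof (rule product_integral_prod)
    fix x assume "x \<in> \<kappa> ` {..C}"
    then have Nx: "N x = unif" using N by auto
    show "integrable (N x) (F x)"
      unfolding Nx
    proof (rule u.integrable_const_bound[where B = 1])
      show "F x \<in> borel_measurable unif" unfolding F_def
        by (intro borel_measurable_prod borel_measurable_diff borel_measurable_const borel_measurable_indicator As)
      show "AE u in unif. norm (F x u) \<le> 1"
        by (auto simp: F_def abs_prod indicator_def intro!: prod_le_1)
    qed
  qed simp
  also have "\<dots> = (\<Prod>c\<le>C. \<integral>u. F (\<kappa> c) u \<partial>unif)"
    by (simp add: prod.reindex[OF inj] N)
  also have "\<dots> = (\<Prod>c\<le>C. hole c R v)"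
  proof (rule prod.cong)
    fix c assume "c \<in> {..C}"
    have dis: "disjoint_family_on (A c) J"
    proof -
      have "False" if "i \<in> J" "j \<in> J" "i < j" "u \<in> A c i" "u \<in> A c j" for i j u
      proof -
        have "strength (pos i) (n i) c u \<noteq> 0" "strength (pos j) (n j) c u \<noteq> 0"
          using A[OF that(1)] A[OF that(2)] that v rho by (force simp: J_def)+
        moreover have "pos i + n i \<le> pos j" using pos_mono[of "Suc i" j] that by (simp add: pos_Suc)
        ultimately show False using strength_disjoint by blast
      qed
      then show ?thesis unfolding disjoint_family_on_def by (metis disjoint_iff linorder_neqE_nat)
    qed
    have meas: "measure unif (A c j) = 1 - v j ^ piece c j" if "j \<in> J" for j
    proof (cases "piece c j = 0")
      case False
      have vj: "\<rho> \<le> v j" "v j \<le> 1" using v that by (auto simp: J_def)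
      have "1 - v j ^ piece c j \<le> 1 - \<rho> ^ piece c j" using vj rho by (auto intro!: power_mono)
      also have "\<dots> \<le> piece c j / l" by (rule one_minus_rho_power)
      also have "pstart (pos j) c / l + piece c j / l \<le> 1"
      proof -
        have "pstart (pos j) c + piece c j \<le> l" using pstart_psize False by (simp add: piece_psize)
        then have "real (pstart (pos j) c) + real (piece c j) \<le> real l" by linarith
        then show ?thesis using mpos by (simp add: add_divide_distrib[symmetric])
      qed
      finally show ?thesis unfolding A_def using vj rho
        by (subst measure_unif_Ico) (auto simp: power_le_one)
    qed (simp add: A_def)
    have "(\<integral>u. F (\<kappa> c) u \<partial>unif) = (\<integral>u. 1 - (\<Sum>j\<in>J. indicator (A c j) u) \<partial>unif)"
      using \<open>c \<in> {..C}\<close> prod_one_minus_indicator[OF J dis] by (simp add: F)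
    also have "\<dots> = 1 - (\<Sum>j\<in>J. measure unif (A c j))"
      using As by (subst Bochner_Integration.integral_diff)
        (auto simp: Bochner_Integration.integral_sum u.prob_space u.emeasure_eq_measure)
    finally show "(\<integral>u. F (\<kappa> c) u \<partial>unif) = hole c R v"
      using meas by (simp add: hole_def J_def)
  qed simp
  also have "\<dots> = target R 0 v"
  proof -
    have "cur R \<le> C" using C unfolding cur_def by (meson div_le_dividend le_trans)
    then have "{..C} = {..cur R} \<union> {cur R<..C}" by auto
    then have "(\<Prod>c\<le>C. hole c R v) = (\<Prod>c\<le>cur R. hole c R v) * (\<Prod>c\<in>{cur R<..C}. hole c R v)"
      by (simp only:) (rule prod.union_disjoint, auto)
    also have "(\<Prod>c\<in>{cur R<..C}. hole c R v) = 1" by (intro prod.neutral) (auto simp: hole_after)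
    finally show ?thesis by (simp add: target_def lessThan_Suc_atMost[symmetric])
  qed
  finally show ?thesis by (simp add: J_def)
qed

lemma own_loss_bound:
  assumes "inj_on \<kappa> {..C}" "\<And>x. prob_space (N x)" "\<And>c. N (\<kappa> c) = unif" "pos R \<le> C"
  defines "P \<equiv> PiM (\<kappa> ` {..C}) N"
  defines "g \<equiv> \<lambda>j U. rival (m - n j) (\<lambda>x. of_bool (estrength (pos j) (n j) (\<lambda>c. U (\<kappa> c)) \<le> x))"
  shows "(\<integral>U. (\<Prod>j\<in>W \<inter> {..<R}. g j U) \<partial>P) \<le> sval H (run H l off (flag_list R))"
    and "integrable P (\<lambda>U. \<Prod>j\<in>W \<inter> {..<R}. g j U)"
proof -
  interpret P: prob_space P unfolding P_def by (rule prob_space_PiM) (rule assms)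
  \<comment> \<open>The default 0 makes \<open>?t j\<close> measurable and bounded for every
    \<open>j\<close>; for rounds before \<open>R\<close> it is the true strength.\<close>
  let ?t = "\<lambda>j U. if pos j + n j \<le> C then estrength (pos j) (n j) (\<lambda>c. U (\<kappa> c)) else 0"
  have tm: "?t j \<in> borel_measurable P" for j
  proof -
    have "(\<lambda>U. U (\<kappa> c)) \<in> borel_measurable P" if "c \<le> C" for c
    proof -
      have "(\<lambda>U. U (\<kappa> c)) \<in> measurable P (N (\<kappa> c))" unfolding P_def using that by (intro measurable_component_singleton) auto
      moreover have "measurable P (N (\<kappa> c)) = borel_measurable P"
        using assms(3) unif_basic by (intro measurable_cong_sets) auto
      ultimately show ?thesis by simp
    qed
    then show ?thesis by (cases "pos j + n j \<le> C") (auto intro!: estrength_measurable)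
  qed
  have t01: "0 \<le> ?t j U \<and> ?t j U \<le> 1" for j U using estrength_range by auto
  have posC: "pos j + n j \<le> C" if "j < R" for j
    using pos_mono[of "Suc j" R] that assms(4) by (simp add: pos_Suc)
  have gt: "g j U = rival (m - n j) (\<lambda>x. of_bool (?t j U \<le> x))" if "j < R" for j U
    using posC[OF that] by (simp add: g_def)
  have geq: "g j = (\<lambda>U. if ?t j U \<le> \<rho> then u0 (n j) else 1 - ?t j U ^ (m - n j))" if "j < R" for j
  proof
    fix U show "g j U = (if ?t j U \<le> \<rho> then u0 (n j) else 1 - ?t j U ^ (m - n j))"
      unfolding gt[OF that] using rival_threshold[of "?t j U"] t01[of j U] rival_one[OF n_le[of j]] by simp
  qed
  have g01: "0 \<le> g j U \<and> g j U \<le> 1" if "j < R" for j U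
    using fun_cong[OF geq[OF that], of U] u0_bounds(1)[OF n_le[of j]] u0_bounds(2)[of "n j"] t01[of j U]
    by (auto simp: power_le_one)
  show "integrable P (\<lambda>U. \<Prod>j\<in>W \<inter> {..<R}. g j U)"
  proof (rule P.integrable_const_bound[where B = 1])
    show "AE U in P. norm (\<Prod>j\<in>W \<inter> {..<R}. g j U) \<le> 1"
      using g01 by (auto simp: abs_prod intro!: prod_le_1)
    have "g j \<in> borel_measurable P" if "j < R" for j unfolding geq[OF that] using tm[of j] by measurable
    then show "(\<lambda>U. \<Prod>j\<in>W \<inter> {..<R}. g j U) \<in> borel_measurable P"
      by (intro borel_measurable_prod) auto
  qed
  have "(\<integral>U. (\<Prod>j\<in>W \<inter> {..<R}. g j U) \<partial>P)
      = (\<integral>U. (\<Prod>j\<in>W \<inter> {..<R}. rival (m - n j) (\<lambda>x. of_bool (?t j U \<le> x))) * 1 \<partial>P)"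
    using gt by (auto intro!: Bochner_Integration.integral_cong prod.cong)
  also have "\<dots> = iterated R (\<lambda>v. \<integral>U. (\<Prod>j\<in>W \<inter> {..<R}. of_bool (?t j U \<le> v j)) * 1 \<partial>P) (\<lambda>_. 0)"
    by (rule rival_iterated[OF P.prob_space_axioms tm t01]) auto
  also have "\<dots> = iterated R (target R 0) (\<lambda>_. 0)"
  proof (rule iterated_cong_range)
    fix v' :: "nat \<Rightarrow> real" assume r: "\<And>i. i \<in> W \<Longrightarrow> i < R \<Longrightarrow> \<rho> \<le> v' i \<and> v' i \<le> 1"
    have "(\<integral>U. (\<Prod>j\<in>W \<inter> {..<R}. of_bool (?t j U \<le> v' j)) * 1 \<partial>P)
      = (\<integral>U. (\<Prod>j\<in>W \<inter> {..<R}. of_bool (estrength (pos j) (n j) (\<lambda>c. U (\<kappa> c)) \<le> v' j)) \<partial>P)"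
      using posC by (auto intro!: Bochner_Integration.integral_cong prod.cong)
    also have "\<dots> = target R 0 v'"
      unfolding P_def using r by (intro lose_all_integral assms) auto
    finally show "(\<integral>U. (\<Prod>j\<in>W \<inter> {..<R}. of_bool (?t j U \<le> v' j)) * 1 \<partial>P) = target R 0 v'" .
  qed
  also have "\<dots> \<le> sval H (run H l off (flag_list R))" by (rule iterated_target_bound)
  finally show "(\<integral>U. (\<Prod>j\<in>W \<inter> {..<R}. g j U) \<partial>P) \<le> sval H (run H l off (flag_list R))" .
qed

end

section \<open>The selected vertex of a round\<close>

datatype 'e seed = Cell 'e nat | Blind nat

context cell_params begin

definition upos :: "nat \<Rightarrow> (nat \<Rightarrow> 'e list) \<Rightarrow> 'e \<Rightarrow> nat \<Rightarrow> nat" where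
  "upos off sl e j = off + (\<Sum>i<j. count_list (sl i) e)"

definition est :: "nat \<Rightarrow> (nat \<Rightarrow> 'e list) \<Rightarrow> nat \<Rightarrow> ('e seed \<Rightarrow> real) \<Rightarrow> 'e \<Rightarrow> real" where
  "est off sl j \<omega> e = estrength (upos off sl e j) (count_list (sl j) e) (\<lambda>c. \<omega> (Cell e c))"

definition strongest :: "nat \<Rightarrow> (nat \<Rightarrow> 'e list) \<Rightarrow> nat \<Rightarrow> ('e seed \<Rightarrow> real) \<Rightarrow> 'e set" where
  "strongest off sl j \<omega> = {e \<in> set (sl j). 0 < est off sl j \<omega> e
     \<and> (\<forall>e'\<in>set (sl j). est off sl j \<omega> e' \<le> est off sl j \<omega> e)}"

text \<open>The residue modulo \<open>m\<close> keeps the blind index in range for every real seed,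
  so the winner holds a slot at every outcome and not only almost surely.\<close>

definition winner :: "nat \<Rightarrow> (nat \<Rightarrow> 'e list) \<Rightarrow> nat \<Rightarrow> ('e seed \<Rightarrow> real) \<Rightarrow> 'e" where
  "winner off sl j \<omega> = (let S = strongest off sl j \<omega> in
     if S = {} then sl j ! (nat \<lfloor>\<omega> (Blind j)\<rfloor> mod m) else SOME e. e \<in> S)"

definition seed_measure :: "'e seed \<Rightarrow> real measure" where
  "seed_measure x = (case x of Cell e c \<Rightarrow> unif | Blind j \<Rightarrow> measure_pmf (pmf_of_set (real ` {..<m})))"

section \<open>Measurability of the winner\<close>

lemma prob_space_seed: "prob_space (seed_measure x)"
  by (auto simp: seed_measure_def unif_basic prob_space_measure_pmf split: seed.split)

lemma seed_component_measurable:
  assumes "x \<in> K"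
  shows "(\<lambda>\<omega>. \<omega> x) \<in> borel_measurable (PiM K seed_measure)"
proof -
  have "(\<lambda>\<omega>. \<omega> x) \<in> measurable (PiM K seed_measure) (seed_measure x)"
    using assms by (rule measurable_component_singleton)
  moreover have "(\<lambda>x. x) \<in> borel_measurable (seed_measure x)"
    by (cases x) (auto simp: seed_measure_def intro!: measurable_ident_sets unif_basic)
  ultimately show ?thesis by (rule measurable_compose)
qed

lemma winner_in: "length (sl j) = m \<Longrightarrow> winner off sl j \<omega> \<in> set (sl j)"
proof -
  assume len: "length (sl j) = m"
  let ?S = "strongest off sl j \<omega>"
  have "(SOME e. e \<in> ?S) \<in> ?S" if "?S \<noteq> {}" using that by (simp add: some_in_eq)
  then show ?thesis using len mpos by (auto simp: winner_def Let_def strongest_def)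
qed

lemma winner_measurable:
  assumes "\<And>e c. e \<in> set (sl j) \<Longrightarrow> c \<le> upos off sl e j + count_list (sl j) e \<Longrightarrow>
      (\<lambda>\<omega>. \<omega> (Cell e c)) \<in> borel_measurable M"
    and "(\<lambda>\<omega>. \<omega> (Blind j)) \<in> borel_measurable M"
  shows "winner off sl j \<in> measurable M (count_space UNIV)"
proof -
  let ?X = "set (sl j)" and ?S = "strongest off sl j"
  have em: "(\<lambda>\<omega>. est off sl j \<omega> e) \<in> borel_measurable M" if "e \<in> ?X" for e
    unfolding est_def using assms(1)[OF that] by (intro estrength_measurable) auto
  have Se: "{\<omega> \<in> space M. e \<in> ?S \<omega>} \<in> sets M" if "e \<in> ?X" for e
  proof -
    have "{\<omega> \<in> space M. e \<in> ?S \<omega>} = {\<omega> \<in> space M. 0 < est off sl j \<omega> e}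
        \<inter> (\<Inter>e'\<in>?X. {\<omega> \<in> space M. est off sl j \<omega> e' \<le> est off sl j \<omega> e})"
      using that by (auto simp: strongest_def)
    also have "\<dots> \<in> sets M"
    proof (rule sets.Int)
      show "{\<omega> \<in> space M. 0 < est off sl j \<omega> e} \<in> sets M"
        using em[OF that] by (simp add: borel_measurable_less)
      show "(\<Inter>e'\<in>?X. {\<omega> \<in> space M. est off sl j \<omega> e' \<le> est off sl j \<omega> e}) \<in> sets M"
        using that em by (intro sets.finite_INT) (auto intro!: borel_measurable_le)
    qed
    finally show ?thesis .
  qed
  have ST: "{\<omega> \<in> space M. ?S \<omega> = T} \<in> sets M" if "T \<subseteq> ?X" for T
  proof (cases "?X = {}")
    case True
    then have "{\<omega> \<in> space M. ?S \<omega> = T} = space M" using that by (auto simp: strongest_def)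
    then show ?thesis by simp
  next
    case False
    obtain e0 where e0: "e0 \<in> ?X" using False by (metis all_not_in_conv)
    have "{\<omega> \<in> space M. ?S \<omega> = T} = (\<Inter>e\<in>?X. {\<omega> \<in> space M. (e \<in> ?S \<omega>) = (e \<in> T)})"
      using that by (auto simp: strongest_def dest: bspec[OF _ e0])
    also have "\<dots> \<in> sets M"
    proof (intro sets.finite_INT)
      fix e assume e: "e \<in> ?X"
      have "{\<omega> \<in> space M. (e \<in> ?S \<omega>) = (e \<in> T)}
          = (if e \<in> T then {\<omega> \<in> space M. e \<in> ?S \<omega>} else space M - {\<omega> \<in> space M. e \<in> ?S \<omega>})"
        by auto
      then show "{\<omega> \<in> space M. (e \<in> ?S \<omega>) = (e \<in> T)} \<in> sets M" using Se[OF e] by auto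
    qed (use False in auto)
    finally show ?thesis .
  qed
  let ?b = "\<lambda>\<omega>. nat \<lfloor>\<omega> (Blind j)\<rfloor> mod m"
  let ?g = "\<lambda>T b. if T = {} then sl j ! b else SOME e. e \<in> T"
  have bm: "?b \<in> measurable M (count_space UNIV)"
    using assms(2) by measurable
  show ?thesis
  proof (rule measurableI)
    fix A :: "'a set"
    have "winner off sl j -` A \<inter> space M
      = (\<Union>T\<in>Pow ?X. \<Union>b. if ?g T b \<in> A then {\<omega> \<in> space M. ?S \<omega> = T} \<inter> (?b -` {b} \<inter> space M) else {})"
    proof -
      have "?S \<omega> \<in> Pow ?X" for \<omega> by (auto simp: strongest_def)
      then show ?thesis by (auto simp: winner_def Let_def split: if_splits)
    qed
    also have "\<dots> \<in> sets M"
    proof (rule sets.finite_UN)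
      fix T assume T: "T \<in> Pow ?X"
      have *: "(if ?g T b \<in> A then {\<omega> \<in> space M. ?S \<omega> = T} \<inter> (?b -` {b} \<inter> space M) else {}) \<in> sets M" for b
        using ST[of T] T measurable_sets[OF bm, of "{b}"] by auto
      show "(\<Union>b. if ?g T b \<in> A then {\<omega> \<in> space M. ?S \<omega> = T} \<inter> (?b -` {b} \<inter> space M) else {}) \<in> sets M"
        by (rule sets.countable_UN, rule image_subsetI, rule *)
    qed simp
    finally show "winner off sl j -` A \<inter> space M \<in> sets M" .
  qed simp
qed

lemma estrength_cong: "(\<And>c. c \<le> q + n \<Longrightarrow> U c = U' c) \<Longrightarrow> estrength q n U = estrength q n U'"
  unfolding estrength_def by (intro arg_cong[where f = Max] image_cong) auto

lemma sum_psize: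
  assumes "q + n \<le> C"
  shows "(\<Sum>c\<le>C. psize q n c) = n"
proof -
  have "(\<Sum>c<K. psize q n c) = min (q + n) (K * l) - min q (K * l)" for K
    by (induction K) (auto simp: psize_def min_def max_def)
  then have "(\<Sum>c<Suc C. psize q n c) = min (q + n) (Suc C * l) - min q (Suc C * l)" .
  moreover have "q + n \<le> Suc C * l"
  proof -
    have "Suc C * 1 \<le> Suc C * l" using mpos by (intro mult_le_mono2) simp
    then show ?thesis using assms by simp
  qed
  ultimately show ?thesis by (simp add: lessThan_Suc_atMost)
qed

text \<open>Fubini separates own from other seeds. For fixed own seeds, \<open>i\<close> loses a
  round only if some other seed hits a blocking set; by \<open>negative_dependence\<close> the
  probability of losing all rounds is at most the product of the \<open>g j\<close>, as if each
  round had fresh independent rivals. The expectation over the own seeds is then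
  \<open>own_loss_bound\<close>.\<close>

theorem lose_probability:
  fixes sl :: "nat \<Rightarrow> 'e list"
  assumes E: "finite E" "i \<in> E" and sl: "\<And>j. length (sl j) = m" "\<And>j. set (sl j) \<subseteq> E"
    and off: "off < l"
  shows "(\<integral>\<omega>. (\<Prod>j\<in>W \<inter> {..<R}. of_bool (winner off sl j \<omega> \<noteq> i)) \<partial>PiM UNIV seed_measure)
    \<le> sval H (run H l off (concat (map (\<lambda>j. replicate (count_list (sl j) i) (j \<in> W)) [0..<R])))"
proof -
  interpret el: cell_run m l "\<lambda>j. count_list (sl j) e" W off for e
    by unfold_locales (use sl(1) count_le_length[of "sl _"] off in \<open>auto simp: sl(1)[symmetric]\<close>)
  interpret product_sigma_finite seed_measure
    by (simp add: product_sigma_finite_def prob_space_imp_sigma_finite prob_space_seed)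
  \<comment> \<open>No vertex gets more than \<open>R * m\<close> units in the first
    \<open>R\<close> rounds, so these rounds read only the finitely many seeds in
    \<open>K\<close>.\<close>
  define C where "C = off + R * m"
  define K where "K = (\<lambda>(e, c). Cell e c) ` (E \<times> {..C}) \<union> Blind ` {..<R}"
  interpret PK: prob_space "PiM K seed_measure" by (rule prob_space_PiM) (rule prob_space_seed)
  have upos: "upos off sl e j = el.pos e j" for e j by (simp add: upos_def el.pos_def)
  define q where "q e j = upos off sl e j" for e j
  define n where "n e j = count_list (sl j) e" for e j
  have nm: "n e j \<le> m" for e j using el.n_le by (simp add: n_def)
  have qC: "q e j + n e j \<le> C" if "j < R" for e j
  proof -
    have "q e j + n e j = off + (\<Sum>k<Suc j. n e k)" by (simp add: q_def n_def upos_def)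
    also have "\<dots> \<le> off + (\<Sum>k<Suc j. m)" using nm by (intro add_left_mono sum_mono)
    also have "\<dots> \<le> off + R * m" using that by (simp add: Suc_le_eq[symmetric] mult_le_mono1 del: mult_Suc)
    finally show ?thesis by (simp add: C_def)
  qed
  have posR: "el.pos e R \<le> C" for e
  proof -
    have "el.pos e R = off + (\<Sum>k<R. n e k)" by (simp add: el.pos_def n_def)
    also have "\<dots> \<le> off + (\<Sum>k<R. m)" using nm by (intro add_left_mono sum_mono)
    finally show ?thesis by (simp add: C_def)
  qed
  define Ko where "Ko = Cell i ` {..C}"
  define Kr where "Kr = K - Ko"
  have K: "K = Ko \<union> Kr" "Ko \<inter> Kr = {}" "finite Ko" "finite Kr"
    using E by (auto simp: Ko_def Kr_def K_def)
  have Kr: "Kr = (\<lambda>(e, c). Cell e c) ` ((E - {i}) \<times> {..C}) \<union> Blind ` {..<R}"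
    using E by (auto simp: Kr_def K_def Ko_def)
  define J where "J = W \<inter> {..<R}"
  have J: "finite J" "\<And>j. j \<in> J \<Longrightarrow> j < R" by (auto simp: J_def)
  define f where "f \<omega> = (\<Prod>j\<in>J. of_bool (winner off sl j \<omega> \<noteq> i) :: real)" for \<omega>
  have f01: "0 \<le> f \<omega>" "f \<omega> \<le> 1" for \<omega> by (auto simp: f_def intro!: prod_le_1 prod_nonneg)
  have wm: "winner off sl j \<in> measurable (PiM K seed_measure) (count_space UNIV)" if "j < R" for j
  proof (rule winner_measurable)
    fix e c assume "e \<in> set (sl j)" "c \<le> upos off sl e j + count_list (sl j) e"
    then have "Cell e c \<in> K" using sl(2)[of j] qC[OF that, of e] by (force simp: K_def q_def n_def)
    then show "(\<lambda>\<omega>. \<omega> (Cell e c)) \<in> borel_measurable (PiM K seed_measure)" by (rule seed_component_measurable)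
  next
    show "(\<lambda>\<omega>. \<omega> (Blind j)) \<in> borel_measurable (PiM K seed_measure)"
      using that by (intro seed_component_measurable) (simp add: K_def)
  qed
  have fint: "integrable (PiM K seed_measure) f"
  proof (rule PK.integrable_const_bound[where B = 1])
    show "f \<in> borel_measurable (PiM K seed_measure)"
      unfolding f_def
    proof (rule borel_measurable_prod)
      fix j assume "j \<in> J"
      then have [measurable]: "winner off sl j \<in> measurable (PiM K seed_measure) (count_space UNIV)" using wm J by auto
      show "(\<lambda>\<omega>. of_bool (winner off sl j \<omega> \<noteq> i) :: real) \<in> borel_measurable (PiM K seed_measure)" by measurable
    qed
  qed (use f01 in auto)
  define g where "g j U = rival (m - n i j) (\<lambda>x. of_bool (estrength (q i j) (n i j) (\<lambda>c. U (Cell i c)) \<le> x))"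
    for j and U :: "'e seed \<Rightarrow> real"
  have inj: "inj_on (Cell i) {..C}" by (auto simp: inj_on_def)
  have N: "seed_measure (Cell i c) = unif" for c by (simp add: seed_measure_def)
  have gq: "el.pos i j = q i j" for j by (simp add: q_def upos)
  note own = el.own_loss_bound[of "Cell i" C seed_measure i R, OF inj prob_space_seed N posR,
      folded Ko_def J_def, unfolded gq, unfolded n_def[symmetric], folded g_def]
  have inner: "(\<integral>V. f (merge Ko Kr (U, V)) \<partial>PiM Kr seed_measure) \<le> (\<Prod>j\<in>J. g j U)" for U
  proof -
    define t where "t j = estrength (q i j) (n i j) (\<lambda>c. U (Cell i c))" for j
    have t: "0 \<le> t j" "t j \<le> 1" "0 < t j \<Longrightarrow> \<rho> < t j" for j unfolding t_def by (rule estrength_range)+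
    \<comment> \<open>The values of seed \<open>x\<close> that may prevent \<open>i\<close>, of strength \<open>t j\<close>, from winning round \<open>j\<close>.\<close>
    define D where "D x j = (case x of
        Cell e c \<Rightarrow> {u. if 0 < t j then t j \<le> strength (q e j) (n e j) c u else 0 < strength (q e j) (n e j) c u}
      | Blind b \<Rightarrow> if b = j \<and> \<not> 0 < t j then {u. sl j ! (nat \<lfloor>u\<rfloor> mod m) \<noteq> i} else {})" for x j
    have Dm: "D x j \<in> sets (seed_measure x)" for x j
    proof (cases x)
      case (Cell e c)
      have "{u. t j \<le> strength (q e j) (n e j) c u} \<in> sets borel" "{u. 0 < strength (q e j) (n e j) c u} \<in> sets borel"
        using measurable_sets[OF strength_measurable[of "q e j" "n e j" c], of "{t j..}"]
          measurable_sets[OF strength_measurable[of "q e j" "n e j" c], of "{0<..}"]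
        by (simp_all only: vimage_def space_borel Int_UNIV_right atLeast_iff greaterThan_iff mem_Collect_eq
            borel_closed borel_open closed_atLeast open_greaterThan)
      moreover have "D x j = (if 0 < t j then {u. t j \<le> strength (q e j) (n e j) c u}
          else {u. 0 < strength (q e j) (n e j) c u})"
        unfolding D_def Cell by auto
      moreover have "sets (seed_measure x) = sets borel" using Cell unif_basic(2) by (simp only: seed_measure_def seed.case)
      ultimately show ?thesis by (simp only: split: if_split) blast
    qed (simp add: seed_measure_def)
    have Dpos: "strength (q e j) (n e j) c u \<noteq> 0" if "u \<in> D (Cell e c) j" for e c j u
      using that by (auto simp: D_def split: if_splits)
    have dis: "disjoint_family_on (D x) J" for x
    proof -
      have "False" if "a < b" "u \<in> D x a" "u \<in> D x b" for a b u
      proof (cases x)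
        case (Cell e c)
        have "q e a + n e a \<le> q e b"
          using el.pos_mono[of "Suc a" b e] that(1) by (simp add: el.pos_Suc upos q_def n_def)
        then show False using strength_disjoint Dpos[of u e c a] Dpos[of u e c b] that Cell by blast
      next
        case (Blind c)
        then show False using that by (auto simp: D_def split: if_splits)
      qed
      then show ?thesis unfolding disjoint_family_on_def by (metis disjoint_iff linorder_neqE_nat)
    qed
    have win: "winner off sl j (merge Ko Kr (U, V)) = i" if j: "j < R" and nD: "\<And>x. x \<in> Kr \<Longrightarrow> V x \<notin> D x j" for j V
    proof -
      let ?\<omega> = "merge Ko Kr (U, V)"
      have own_val: "?\<omega> (Cell i c) = U (Cell i c)" if "c \<le> C" for c
        using that by (simp add: merge_def Ko_def)
      have oth_val: "?\<omega> x = V x" if "x \<in> Kr" for x using that K by (auto simp: merge_def)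
      have ei: "est off sl j ?\<omega> i = t j"
        unfolding est_def t_def q_def[symmetric] n_def[symmetric]
      proof (rule estrength_cong)
        fix c assume "c \<le> q i j + n i j"
        then have "c \<le> C" using qC[OF j, of i] by linarith
        then show "?\<omega> (Cell i c) = U (Cell i c)" by (rule own_val)
      qed
      have eo: "(if 0 < t j then est off sl j ?\<omega> e < t j else est off sl j ?\<omega> e = 0)"
        if e: "e \<in> set (sl j)" "e \<noteq> i" for e
      proof -
        obtain c where c: "c \<le> q e j + n e j" "est off sl j ?\<omega> e = strength (q e j) (n e j) c (?\<omega> (Cell e c))"
          using estrength_in[of "q e j" "n e j" "\<lambda>c. ?\<omega> (Cell e c)"] by (auto simp: est_def q_def n_def)
        have "c \<le> C" using c(1) qC[OF j, of e] by linarith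
        moreover have "e \<in> E - {i}" using e sl(2)[of j] by blast
        ultimately have Kx: "Cell e c \<in> Kr" unfolding Kr by (intro UnI1 image_eqI[of _ _ "(e, c)"]) auto
        have "?\<omega> (Cell e c) \<notin> D (Cell e c) j" using nD[OF Kx] oth_val[OF Kx] by simp
        then show ?thesis using c(2) strength_nonneg[of "q e j" "n e j" c "?\<omega> (Cell e c)"]
          by (auto simp: D_def split: if_splits)
      qed
      show ?thesis
      proof (cases "0 < t j")
        case True
        then have "0 < n i j" unfolding t_def by (rule estrength_pos_count)
        then have i: "i \<in> set (sl j)" unfolding n_def by (metis count_notin less_irrefl)
        have lt: "est off sl j ?\<omega> e < t j" if "e \<in> set (sl j)" "e \<noteq> i" for e
          using eo[OF that] True by simp
        have "e = i" if "e \<in> strongest off sl j ?\<omega>" for e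
        proof (rule ccontr)
          assume "e \<noteq> i"
          then show False using that i lt[of e] ei by (force simp: strongest_def)
        qed
        moreover have "i \<in> strongest off sl j ?\<omega>"
          using i lt ei True by (force simp: strongest_def)
        ultimately have "strongest off sl j ?\<omega> = {i}" by blast
        then show ?thesis by (simp add: winner_def)
      next
        case False
        have S: "strongest off sl j ?\<omega> = {}"
        proof -
          have "\<not> 0 < est off sl j ?\<omega> e" if "e \<in> set (sl j)" for e
            using eo[OF that] ei False by (cases "e = i") auto
          then show ?thesis by (auto simp: strongest_def)
        qed
        have Kb: "Blind j \<in> Kr" using j by (simp add: Kr)
        have "?\<omega> (Blind j) \<notin> D (Blind j) j" using nD[OF Kb] oth_val[OF Kb] by simp
        then show ?thesis using False S by (simp add: winner_def D_def)
      qed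
    qed
    let ?P = "\<lambda>j V. \<Prod>x\<in>Kr. 1 - indicator (D x j) (V x) :: real"
    have P01: "0 \<le> ?P j V" "?P j V \<le> 1" for j V
      by (auto intro!: prod_nonneg prod_le_1 simp: indicator_def)
    interpret PR: prob_space "PiM Kr seed_measure" by (rule prob_space_PiM) (rule prob_space_seed)
    have "(\<integral>V. f (merge Ko Kr (U, V)) \<partial>PiM Kr seed_measure) \<le> (\<integral>V. (\<Prod>j\<in>J. 1 - 1 * ?P j V) \<partial>PiM Kr seed_measure)"
    proof (rule integral_mono')
      show "integrable (PiM Kr seed_measure) (\<lambda>V. \<Prod>j\<in>J. 1 - 1 * ?P j V)"
      proof (rule PR.integrable_const_bound[where B = 1])
        show "AE V in PiM Kr seed_measure. norm (\<Prod>j\<in>J. 1 - 1 * ?P j V) \<le> 1"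
          using P01 by (auto simp: abs_prod intro!: prod_le_1)
        have "(\<lambda>V. indicator (D x j) (V x) :: real) \<in> borel_measurable (PiM Kr seed_measure)" if "x \<in> Kr" for x j
          by (rule measurable_compose[OF measurable_component_singleton[OF that] borel_measurable_indicator[OF Dm]])
        then show "(\<lambda>V. \<Prod>j\<in>J. 1 - 1 * ?P j V) \<in> borel_measurable (PiM Kr seed_measure)"
          by (intro borel_measurable_prod borel_measurable_diff borel_measurable_const borel_measurable_times)
      qed
      fix V
      show "f (merge Ko Kr (U, V)) \<le> (\<Prod>j\<in>J. 1 - 1 * ?P j V)"
        unfolding f_def
      proof (rule prod_mono, safe)
        fix j assume "j \<in> J"
        then have j: "j < R" using J by simp
        show "of_bool (winner off sl j (merge Ko Kr (U, V)) \<noteq> i) \<le> 1 - 1 * ?P j V"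
        proof (cases "\<exists>x\<in>Kr. V x \<in> D x j")
          case True
          then obtain x where "x \<in> Kr" "V x \<in> D x j" by auto
          then have "?P j V = 0" using K(4) by (intro prod_zero bexI[of _ x]) auto
          then show ?thesis by simp
        next
          case False
          then show ?thesis using win[OF j, of V] P01[of j V] by auto
        qed
      qed simp
      show "0 \<le> (\<Prod>j\<in>J. 1 - 1 * ?P j V)" using P01 by (intro prod_nonneg) auto
    qed
    also have "\<dots> \<le> (\<Prod>j\<in>J. 1 - 1 * (\<Prod>x\<in>Kr. 1 - measure (seed_measure x) (D x j)))"
      by (rule negative_dependence[OF K(4) J(1) prob_space_seed Dm dis]) auto
    also have "\<dots> \<le> (\<Prod>j\<in>J. g j U)"
    proof (rule prod_mono, intro ballI conjI)
      fix j assume "j \<in> J"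
      then have j: "j < R" using J by simp
      \<comment> \<open>The level that governs the rivals: the own strength, or
        \<open>\<rho>\<close> if \<open>i\<close> is no candidate.\<close>
      define s where "s = (if 0 < t j then t j else \<rho>)"
      have s: "\<rho> \<le> s" "s \<le> 1" "0 < s" using t[of j] rho by (auto simp: s_def)
      have meas01: "0 \<le> 1 - measure (seed_measure x) (D x j)" "1 - measure (seed_measure x) (D x j) \<le> 1" for x
        using prob_space.prob_le_1[OF prob_space_seed] by auto
      show "0 \<le> 1 - 1 * (\<Prod>x\<in>Kr. 1 - measure (seed_measure x) (D x j))"
        using meas01 prod_le_1[of Kr "\<lambda>x. 1 - measure (seed_measure x) (D x j)"] by simp
      have cell: "s ^ psize (q e j) (n e j) c \<le> 1 - measure (seed_measure (Cell e c)) (D (Cell e c) j)" for e c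
      proof -
        let ?a = "pstart (q e j) c / l" and ?k = "psize (q e j) (n e j) c"
        have "D (Cell e c) j \<subseteq> {?a .. ?a + (1 - s ^ ?k)}"
          using strength_ge_subset[OF t(3)] strength_pos_subset by (auto simp: D_def s_def)
        moreover have "D (Cell e c) j \<in> sets borel" using Dm[of "Cell e c" j] by (simp add: seed_measure_def unif_basic)
        moreover have "?a \<le> ?a + (1 - s ^ ?k)" using s by (simp add: power_le_one)
        ultimately have "measure unif (D (Cell e c) j) \<le> ?a + (1 - s ^ ?k) - ?a" by (intro measure_unif_le)
        then show ?thesis by (simp add: seed_measure_def)
      qed
      have blind: "(if 0 < t j then 1 else n i j / m) \<le> (\<Prod>b<R. 1 - measure (seed_measure (Blind b :: 'e seed)) (D (Blind b) j))"
      proof (cases "0 < t j")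
        case True
        then show ?thesis by (simp add: D_def)
      next
        case False
        have "(\<Prod>b<R. 1 - measure (seed_measure (Blind b :: 'e seed)) (D (Blind b) j))
            = 1 - measure (seed_measure (Blind j :: 'e seed)) (D (Blind j) j)"
          using j by (subst prod.remove[of _ j]) (auto simp: D_def intro!: prod.neutral)
        also have "\<dots> = 1 - measure (measure_pmf (pmf_of_set (real ` {..<m}))) {u. sl j ! (nat \<lfloor>u\<rfloor> mod m) \<noteq> i}"
          using False by (simp add: D_def seed_measure_def)
        also have "measure (measure_pmf (pmf_of_set (real ` {..<m}))) {u. sl j ! (nat \<lfloor>u\<rfloor> mod m) \<noteq> i}
            = card (real ` {..<m} \<inter> {u. sl j ! (nat \<lfloor>u\<rfloor> mod m) \<noteq> i}) / card (real ` {..<m})"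
          using mpos by (intro measure_pmf_of_set) auto
        also have "real ` {..<m} \<inter> {u. sl j ! (nat \<lfloor>u\<rfloor> mod m) \<noteq> i} = real ` {k. k < m \<and> sl j ! k \<noteq> i}"
          by auto
        also have "card \<dots> = card {k. k < m \<and> sl j ! k \<noteq> i}" by (intro card_image) auto
        also have "\<dots> = m - n i j"
        proof -
          have "card {k. k < length (sl j) \<and> sl j ! k = i} = count_list (sl j) i"
            by (simp add: count_list_eq_length_filter length_filter_conv_card eq_commute)
          moreover have "{k. k < m \<and> sl j ! k \<noteq> i} = {..<m} - {k. k < m \<and> sl j ! k = i}" by auto
          moreover have "card ({..<m} - {k. k < m \<and> sl j ! k = i}) = card {..<m} - card {k. k < m \<and> sl j ! k = i}"
            by (intro card_Diff_subset) auto
          ultimately show ?thesis using sl(1)[of j] by (simp add: n_def)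
        qed
        also have "card (real ` {..<m}) = m" by (simp add: card_image)
        finally show ?thesis using False mpos nm[of i j] by (simp add: of_nat_diff diff_divide_distrib)
      qed
      have units: "(\<Sum>e\<in>E - {i}. n e j) = m - n i j"
      proof -
        have "(\<Sum>e\<in>E. n e j) = m" unfolding n_def using sum_count_set[OF sl(2) E(1)] sl(1) by simp
        then show ?thesis using E by (simp add: sum.remove[of E i])
      qed
      \<comment> \<open>The pieces of the rivals add up to \<open>m - n i j\<close> units, so their
        factors form a single power of \<open>s\<close>, wherever the cell boundaries lie.\<close>
      have "s ^ (m - n i j) * (if 0 < t j then 1 else n i j / m)
          = (\<Prod>e\<in>E - {i}. \<Prod>c\<le>C. s ^ psize (q e j) (n e j) c) * (if 0 < t j then 1 else n i j / m)"
        using sum_psize[OF qC[OF j]] units by (simp add: power_sum[symmetric])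
      also have "\<dots> \<le> (\<Prod>e\<in>E - {i}. \<Prod>c\<le>C. 1 - measure (seed_measure (Cell e c)) (D (Cell e c) j))
          * (\<Prod>b<R. 1 - measure (seed_measure (Blind b :: 'e seed)) (D (Blind b) j))"
        using s cell meas01 by (intro mult_mono blind prod_mono conjI prod_nonneg) auto
      also have "\<dots> = (\<Prod>x\<in>Kr. 1 - measure (seed_measure x) (D x j))"
        unfolding Kr using E
        by (subst prod.union_disjoint) (auto simp: prod.reindex inj_on_def prod.cartesian_product split_beta)
      finally have "1 - 1 * (\<Prod>x\<in>Kr. 1 - measure (seed_measure x) (D x j))
          \<le> 1 - s ^ (m - n i j) * (if 0 < t j then 1 else n i j / m)" by simp
      also have "\<dots> = g j U"
        unfolding g_def t_def[symmetric] rival_threshold[OF t(1,2)] rival_one[OF nm]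
        using t[of j] rho by (auto simp: s_def u0_def)
      finally show "1 - 1 * (\<Prod>x\<in>Kr. 1 - measure (seed_measure x) (D x j)) \<le> g j U" .
    qed
    finally show ?thesis .
  qed
  have g0: "0 \<le> (\<Prod>j\<in>J. g j U)" for U
    unfolding g_def rival_threshold[OF estrength_range(1,2)] rival_one[OF nm]
    using u0_bounds(1)[OF nm] estrength_range by (intro prod_nonneg) (auto simp: power_le_one)
  \<comment> \<open>Reduction to the finite product: rounds before \<open>R\<close> do not depend on
    seeds outside \<open>K\<close>.\<close>
  have "(\<integral>\<omega>. f \<omega> \<partial>PiM UNIV seed_measure) = (\<integral>\<omega>. f (restrict \<omega> K) \<partial>PiM UNIV seed_measure)"
  proof (rule Bochner_Integration.integral_cong)
    fix \<omega> :: "'e seed \<Rightarrow> real"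
    have "winner off sl j (restrict \<omega> K) = winner off sl j \<omega>" if j: "j < R" for j
    proof -
      have "est off sl j (restrict \<omega> K) e = est off sl j \<omega> e" if e: "e \<in> set (sl j)" for e
        unfolding est_def q_def[symmetric] n_def[symmetric]
      proof (rule estrength_cong)
        fix c assume "c \<le> q e j + n e j"
        then have "c \<le> C" using qC[OF j, of e] by linarith
        moreover have "e \<in> E" using e sl(2)[of j] by blast
        ultimately have "Cell e c \<in> K" unfolding K_def by (intro UnI1 image_eqI[of _ _ "(e, c)"]) auto
        then show "restrict \<omega> K (Cell e c) = \<omega> (Cell e c)" by simp
      qed
      then have "strongest off sl j (restrict \<omega> K) = strongest off sl j \<omega>"
        unfolding strongest_def by auto
      moreover have "restrict \<omega> K (Blind j) = \<omega> (Blind j)"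
      proof -
        have "Blind j \<in> K" using j unfolding K_def by blast
        then show ?thesis by simp
      qed
      ultimately show ?thesis by (simp only: winner_def)
    qed
    then show "f \<omega> = f (restrict \<omega> K)" unfolding f_def using J by (intro prod.cong) auto
  qed simp
  also have "\<dots> = (\<integral>\<omega>. f \<omega> \<partial>distr (PiM UNIV seed_measure) (PiM K seed_measure) (\<lambda>\<omega>. restrict \<omega> K))"
    using fint by (intro integral_distr[symmetric] measurable_restrict_subset) auto
  also have "distr (PiM UNIV seed_measure) (PiM K seed_measure) (\<lambda>\<omega>. restrict \<omega> K) = PiM K seed_measure"
  proof -
    interpret U: product_prob_space "seed_measure :: 'e seed \<Rightarrow> real measure" UNIV
      by unfold_locales (auto simp: prob_space.emeasure_space_1 prob_space_seed)
    show ?thesis using K by (intro U.distr_PiM_restrict_finite) auto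
  qed
  also have "(\<integral>\<omega>. f \<omega> \<partial>PiM K seed_measure)
      = (\<integral>U. (\<integral>V. f (merge Ko Kr (U, V)) \<partial>PiM Kr seed_measure) \<partial>PiM Ko seed_measure)"
    using fint K unfolding K(1) by (intro product_integral_fold) auto
  also have "\<dots> \<le> (\<integral>U. (\<Prod>j\<in>J. g j U) \<partial>PiM Ko seed_measure)"
    by (rule integral_mono'[OF own(2) inner g0])
  also have "\<dots> \<le> sval H (run H l off (el.flag_list i R))"
  proof -
    have "n i = (\<lambda>j. count_list (sl j) i)" by (simp add: n_def fun_eq_iff)
    then show ?thesis using own(1) by (simp only:)
  qed
  finally show ?thesis by (simp add: f_def J_def el.flag_list_def)
qed

end

section \<open>The randomized algorithm\<close>

lemma sval_run_mono:
  assumes "\<And>n. n \<le> l \<Longrightarrow> 0 \<le> F n \<and> F n \<le> G n" "off < l"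
  shows "sval F (run F l off fl) \<le> sval G (run G l off fl)"
proof -
  have "\<exists>p p' k n. run F l off fl = (p, k, n) \<and> run G l off fl = (p', k, n) \<and> 0 \<le> p \<and> p \<le> p' \<and> n \<le> k \<and> k < l"
  proof (induction fl rule: rev_induct)
    case (snoc b fl)
    then obtain p p' k n where h: "run F l off fl = (p, k, n)" "run G l off fl = (p', k, n)"
      "0 \<le> p" "p \<le> p'" "n \<le> k" "k < l" by auto
    have "p * F i \<le> p' * G i \<and> 0 \<le> p * F i" if "i \<le> l" for i
      using assms(1)[OF that] h by (auto intro!: mult_mono)
    then show ?case using h by (auto simp: run_snoc step_def Let_def)
  qed (use assms in \<open>auto simp: run_Nil\<close>)
  then obtain p p' k n where "run F l off fl = (p, k, n)" "run G l off fl = (p', k, n)"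
      "0 \<le> p" "p \<le> p'" "n \<le> k" "k < l" by auto
  then show ?thesis using assms(1)[of n] by (auto simp: sval_def intro!: mult_mono)
qed

locale online_selection = cell_params m l + unsel_bound m l G for m l G +
  assumes HG: "n \<le> l \<Longrightarrow> H n \<le> G n"
begin

text \<open>A dummy row after the last round keeps all rows at length \<open>m\<close>. The value
  \<open>None\<close> competes like a vertex, and the arrival stays unassigned when it wins.\<close>

definition slot_seq :: "'l set \<Rightarrow> ('l \<Rightarrow> real) list \<Rightarrow> nat \<Rightarrow> 'l option list" where
  "slot_seq L ws j = (if j < length ws then fst (slots m L (ws ! j) (history L (take j ws)))
     else replicate m None)"

text \<open>Histories record slots, not random outcomes. The rows are thus determined by the
  weights, and past decisions never have to be known.\<close>

definition alg :: "nat \<times> ('l option seed \<Rightarrow> real) \<Rightarrow> 'l det_online_alg" where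
  "alg z L past w = winner (fst z) (slot_seq L (past @ [w])) (length past) (snd z)"

lemma slot_seq:
  assumes "finite L"
  shows "length (slot_seq L ws j) = m" "set (slot_seq L ws j) \<subseteq> insert None (Some ` L)"
proof -
  show "length (slot_seq L ws j) = m"
    using slots_props(1)[OF assms] by (simp add: slot_seq_def)
  have "set (fst (slots m L (ws ! j) (history L (take j ws)))) \<subseteq> insert None (Some ` L)"
    by (rule slots_props(2)[OF assms])
  then show "set (slot_seq L ws j) \<subseteq> insert None (Some ` L)"
    by (auto simp: slot_seq_def)
qed

lemma slot_seq_take: "i \<le> j \<Longrightarrow> j < length ws \<Longrightarrow> slot_seq L (take (Suc j) ws) i = slot_seq L ws i"
  by (simp add: slot_seq_def min_def)

lemma winner_cong:
  assumes "\<And>i. i \<le> j \<Longrightarrow> sl i = sl' i"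
  shows "winner off sl j \<omega> = winner off sl' j \<omega>"
proof -
  have "upos off sl e j = upos off sl' e j" for e
    unfolding upos_def using assms by (intro arg_cong2[where f = "(+)"] sum.cong refl) auto
  then have "est off sl j \<omega> = est off sl' j \<omega>"
    by (intro ext) (simp only: est_def assms[OF order_refl])
  then have "strongest off sl j \<omega> = strongest off sl' j \<omega>"
    by (simp only: strongest_def assms[OF order_refl])
  then show ?thesis by (simp only: winner_def assms[OF order_refl])
qed

lemma assigned_alg:
  assumes "j < length ws"
  shows "assigned (alg z) L ws j = winner (fst z) (slot_seq L ws) j (snd z)"
proof -
  have "take j ws @ [ws ! j] = take (Suc j) ws" using assms by (simp add: take_Suc_conv_app_nth)
  then have "assigned (alg z) L ws j = winner (fst z) (slot_seq L (take (Suc j) ws)) j (snd z)"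
    using assms by (simp add: assigned_def alg_def)
  also have "\<dots> = winner (fst z) (slot_seq L ws) j (snd z)"
    using assms by (intro winner_cong slot_seq_take)
  finally show ?thesis .
qed

lemma history_units:
  assumes "finite L" "j \<le> length ws"
  shows "history L (take j ws) i
    = concat (map (\<lambda>j. replicate (count_list (slot_seq L ws j) (Some i)) ((ws ! j) i)) [0..<j])"
  using assms(2)
proof (induction j)
  case (Suc j)
  have "history L (take (Suc j) ws) i = snd (slots m L (ws ! j) (history L (take j ws))) i"
    using Suc by (simp add: take_Suc_conv_app_nth history_snoc)
  then show ?case using Suc slots_props(3)[OF assms(1), of m "ws ! j" "history L (take j ws)" i]
    by (simp add: slot_seq_def)
qed (simp add: history_def)

text \<open>All vertices share one offset, which suffices because every bound concerns a single
  vertex and expectations are added.\<close>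

definition seeds :: "(nat \<times> ('l option seed \<Rightarrow> real)) measure" where
  "seeds = measure_pmf (pmf_of_set {..<l}) \<Otimes>\<^sub>M PiM UNIV seed_measure"

lemma prob_space_seeds: "prob_space seeds"
  unfolding seeds_def
  by (intro prob_space_pair prob_space_measure_pmf prob_space_PiM prob_space_seed)

lemma winner_seeds_measurable:
  "(\<lambda>z. winner (fst z) sl j (snd z)) \<in> measurable (seeds :: (nat \<times> ('l option seed \<Rightarrow> real)) measure) (count_space UNIV)"
proof -
  have "(\<lambda>z. winner (fst z) sl j (snd z))
      \<in> measurable (count_space UNIV \<Otimes>\<^sub>M PiM UNIV (seed_measure :: 'l option seed \<Rightarrow> real measure)) (count_space UNIV)"
  proof (rule measurable_pair_measure_countable1)
    fix off :: nat
    show "(\<lambda>\<omega>. winner (fst (off, \<omega>)) sl j (snd (off, \<omega>))) \<in> measurable (PiM UNIV seed_measure) (count_space UNIV)"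
      unfolding fst_conv snd_conv by (intro winner_measurable seed_component_measurable UNIV_I)
  qed simp
  moreover have "sets (seeds :: (nat \<times> ('l option seed \<Rightarrow> real)) measure) = sets (count_space UNIV \<Otimes>\<^sub>M PiM UNIV seed_measure)"
    unfolding seeds_def by (rule sets_pair_measure_cong) auto
  ultimately show ?thesis by (simp cong: measurable_cong_sets)
qed

text \<open>Generators that make each decision a random variable; measurability of
  \<open>alg\<close> has to be checked on them only.\<close>

definition decision_events :: "'l det_online_alg set set" where
  "decision_events = {{A \<in> range alg. A L past w = x} | L past w x. online_instance L (past @ [w])}"

definition alg_space :: "'l det_online_alg measure" where
  "alg_space = sigma (range alg) decision_events"

definition alg_measure :: "'l det_online_alg measure" where
  "alg_measure = distr seeds alg_space alg"

lemma decision_events_Pow: "decision_events \<subseteq> Pow (range alg)"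
  by (auto simp: decision_events_def)

lemma space_alg_space: "space alg_space = range alg"
  unfolding alg_space_def by (rule space_measure_of[OF decision_events_Pow])

lemma alg_measurable: "alg \<in> measurable seeds alg_space"
  unfolding alg_space_def
proof (rule measurable_measure_of[OF decision_events_Pow])
  fix B assume "B \<in> decision_events"
  then obtain L past w x where B: "B = {A \<in> range alg. A L past w = x}"
    by (auto simp: decision_events_def)
  have "alg -` B \<inter> space seeds
      = (\<lambda>z. winner (fst z) (slot_seq L (past @ [w])) (length past) (snd z)) -` {x} \<inter> space seeds"
    by (auto simp: B alg_def)
  then show "alg -` B \<inter> space seeds \<in> sets seeds"
    using measurable_sets[OF winner_seeds_measurable, of "{x}"] by simp
qed auto

lemma alg_in:
  assumes "online_instance L (past @ [w])"
  shows "alg z L past w \<in> insert None (Some ` L)"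
proof -
  have fin: "finite L" using assms by (simp add: online_instance_def)
  show ?thesis unfolding alg_def
    using winner_in[of "slot_seq L (past @ [w])" "length past" "fst z" "snd z"]
      slot_seq[OF fin, of "past @ [w]" "length past"] by blast
qed

lemma decision_measurable:
  fixes L :: "'l set"
  assumes "online_instance L (past @ [w])"
  shows "(\<lambda>A. A L past w) \<in> measurable alg_space (count_space UNIV)"
proof (rule measurableI)
  fix X :: "'l option set"
  have fin: "finite L" using assms by (simp add: online_instance_def)
  have "(\<lambda>A. A L past w) -` X \<inter> space alg_space
      = (\<Union>x\<in>X \<inter> insert None (Some ` L). {A \<in> range alg. A L past w = x})"
    unfolding space_alg_space using alg_in[OF assms] by auto
  also have "\<dots> \<in> sets alg_space"
  proof (rule sets.finite_UN)
    fix x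
    have "{A \<in> range alg. A L past w = x} \<in> decision_events"
      using assms unfolding decision_events_def by blast
    then show "{A \<in> range alg. A L past w = x} \<in> sets alg_space"
      unfolding alg_space_def sets_measure_of[OF decision_events_Pow] by (rule sigma_sets.Basic)
  qed (use fin in auto)
  finally show "(\<lambda>A. A L past w) -` X \<inter> space alg_space \<in> sets alg_space" .
qed simp

lemma randomized_alg_measure: "randomized_online_algorithm alg_measure"
  unfolding randomized_online_algorithm_def
proof (intro conjI ballI allI impI)
  show "prob_space alg_measure"
    unfolding alg_measure_def by (rule prob_space.prob_space_distr[OF prob_space_seeds alg_measurable])
  fix A :: "'l det_online_alg" assume "A \<in> space alg_measure"
  then obtain z where "A = alg z" by (auto simp: alg_measure_def space_alg_space)
  then show "det_online_algorithm A" unfolding det_online_algorithm_def by (simp add: alg_in del: insert_iff)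
next
  fix L :: "'l set" and past w assume "online_instance L (past @ [w])"
  then show "(\<lambda>A. A L past w) \<in> measurable alg_measure (count_space UNIV)"
    using decision_measurable unfolding alg_measure_def by simp
qed

text \<open>The maximum runs over a fixed index set instead of the random set of assigned arrivals,
  which gives measurability; index \<open>length ws\<close> supplies the value 0.\<close>

definition best :: "('l \<Rightarrow> real) list \<Rightarrow> 'l \<Rightarrow> (nat \<Rightarrow> 'l option) \<Rightarrow> real" where
  "best ws i s = Max ((\<lambda>j. if j < length ws \<and> s j = Some i then (ws ! j) i else 0) ` {..length ws})"

section \<open>Expected contribution of one offline vertex\<close>

lemma alg_value_best: "alg_value A L ws = (\<Sum>i\<in>L. best ws i (assigned A L ws))"
proof -
  have "insert 0 {(ws ! j) i | j. j < length ws \<and> s j = Some i}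
      = (\<lambda>j. if j < length ws \<and> s j = Some i then (ws ! j) i else 0) ` {..length ws}" for i s
    by (auto simp: image_iff split: if_splits)
  then show ?thesis by (simp add: alg_value_def best_def)
qed

lemma best_measurable:
  assumes "\<And>j. j < length ws \<Longrightarrow> (\<lambda>x. s x j) \<in> measurable M (count_space UNIV)"
  shows "(\<lambda>x. best ws i (s x)) \<in> borel_measurable M"
  unfolding best_def
proof (rule borel_measurable_Max)
  fix j
  show "(\<lambda>x. if j < length ws \<and> s x j = Some i then (ws ! j) i else 0) \<in> borel_measurable M"
  proof (cases "j < length ws")
    case True
    then have [measurable]: "(\<lambda>x. s x j) \<in> measurable M (count_space UNIV)" by (rule assms)
    show ?thesis using True by simp
  qed simp
qed simp

lemma best_ge_iff: "0 < u \<Longrightarrow> u \<le> best ws i s \<longleftrightarrow> (\<exists>j<length ws. u \<le> (ws ! j) i \<and> s j = Some i)"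
  unfolding best_def by (subst Max_ge_iff) (auto split: if_splits simp: Bex_def image_iff dest: less_imp_le)

lemma best_bounds: "0 \<le> best ws i s" "best ws i s \<le> Max (insert 0 ((\<lambda>w. w i) ` set ws))"
proof -
  show "0 \<le> best ws i s" unfolding best_def by (rule Max_ge) (auto intro: image_eqI[of _ _ "length ws"])
  show "best ws i s \<le> Max (insert 0 ((\<lambda>w. w i) ` set ws))"
    unfolding best_def by (subst Max_le_iff) (auto intro!: Max_ge)
qed

text \<open>Falling short of \<open>u\<close> means losing all rounds with weight at least
  \<open>u\<close>; \<open>lose_probability\<close> with these rounds as \<open>W\<close> bounds
  this for each offset, and the average over offsets is \<open>Sbar\<close>.\<close>

lemma best_probability:
  fixes L :: "'l set"
  assumes "online_instance L ws" "i \<in> L" "0 < u"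
  defines "s \<equiv> \<lambda>z. \<lambda>j. winner (fst z) (slot_seq L ws) j (snd z)"
  shows "1 - Sbar (flags u (history L ws i)) \<le> (\<integral>z. of_bool (u \<le> best ws i (s z)) \<partial>seeds)"
proof -
  have fin: "finite L" using assms(1) by (simp add: online_instance_def)
  interpret S: prob_space "seeds :: (nat \<times> ('l option seed \<Rightarrow> real)) measure" by (rule prob_space_seeds)
  interpret B: prob_space "PiM UNIV (seed_measure :: 'l option seed \<Rightarrow> real measure)"
    by (rule prob_space_PiM) (rule prob_space_seed)
  interpret A: prob_space "measure_pmf (pmf_of_set {..<l})" by (rule prob_space_measure_pmf)
  interpret AB: pair_sigma_finite "measure_pmf (pmf_of_set {..<l})" "PiM UNIV (seed_measure :: 'l option seed \<Rightarrow> real measure)" ..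
  define W where "W = {j. u \<le> (ws ! j) i}"
  define fl where "fl = concat (map (\<lambda>j. replicate (count_list (slot_seq L ws j) (Some i)) (j \<in> W)) [0..<length ws])"
  have fl: "flags u (history L ws i) = fl"
    using history_units[OF fin, of "length ws" ws i]
    by (simp add: flags_def fl_def W_def map_concat comp_def)
  define lose where "lose z = (\<Prod>j\<in>W \<inter> {..<length ws}. of_bool (s z j \<noteq> Some i) :: real)" for z
  have lose: "of_bool (u \<le> best ws i (s z)) = 1 - lose z" for z
  proof -
    have "u \<le> best ws i (s z) \<longleftrightarrow> \<not> (\<forall>j\<in>W \<inter> {..<length ws}. s z j \<noteq> Some i)"
      using best_ge_iff[OF assms(3), of ws i "s z"] by (auto simp: W_def)
    moreover have "lose z = of_bool (\<forall>j\<in>W \<inter> {..<length ws}. s z j \<noteq> Some i)"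
      unfolding lose_def by (auto simp: prod_zero_iff intro: prod.neutral)
    ultimately show ?thesis by simp
  qed
  have sm: "(\<lambda>z. s z j) \<in> measurable seeds (count_space UNIV)" for j
    unfolding s_def by (rule winner_seeds_measurable)
  have lm: "lose \<in> borel_measurable seeds" unfolding lose_def
  proof (rule borel_measurable_prod)
    fix j
    have [measurable]: "(\<lambda>z. s z j) \<in> measurable seeds (count_space UNIV)" by (rule sm)
    show "(\<lambda>z. of_bool (s z j \<noteq> Some i) :: real) \<in> borel_measurable seeds" by measurable
  qed
  have li: "integrable seeds lose"
    using lm by (rule S.integrable_const_bound[where B = 1, rotated])
      (auto simp: lose_def abs_prod intro!: prod_le_1)
  have "(\<integral>z. lose z \<partial>seeds) = (\<integral>off. (\<integral>\<omega>. lose (off, \<omega>) \<partial>PiM UNIV seed_measure) \<partial>measure_pmf (pmf_of_set {..<l}))"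
    using AB.integral_fst'[of lose] li unfolding seeds_def by simp
  also have "\<dots> = (\<Sum>off<l. (\<integral>\<omega>. lose (off, \<omega>) \<partial>PiM UNIV seed_measure)) / l"
    using l_pos by (subst integral_pmf_of_set) auto
  also have "\<dots> \<le> (\<Sum>off<l. sval G (run G l off fl)) / l"
  proof (intro divide_right_mono sum_mono)
    fix off assume "off \<in> {..<l}"
    then have off: "off < l" by simp
    have "(\<integral>\<omega>. lose (off, \<omega>) \<partial>PiM UNIV seed_measure) \<le> sval H (run H l off fl)"
      unfolding lose_def s_def fst_conv snd_conv fl_def
      by (rule lose_probability[of "insert None (Some ` L)"]) (use fin assms(2) slot_seq[OF fin] off in auto)
    also have "\<dots> \<le> sval G (run G l off fl)"
    proof (rule sval_run_mono[OF _ off])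
      fix n assume n: "n \<le> l"
      have "0 \<le> H n" using block_nonneg[of n 0] n eps by (simp add: H_def)
      then show "0 \<le> H n \<and> H n \<le> G n" using HG[OF n] by simp
    qed
    finally show "(\<integral>\<omega>. lose (off, \<omega>) \<partial>PiM UNIV seed_measure) \<le> sval G (run G l off fl)" .
  qed simp
  also have "\<dots> = Sbar fl" by (simp add: Sbar_def)
  finally show ?thesis unfolding lose fl using li S.prob_space by simp
qed

lemma best_expectation:
  fixes L :: "'l set"
  assumes "online_instance L ws" "i \<in> L"
  defines "s \<equiv> \<lambda>z. \<lambda>j. winner (fst z) (slot_seq L ws) j (snd z)"
  shows "reward (history L ws i) \<le> (\<integral>z. best ws i (s z) \<partial>seeds)"
    and "integrable seeds (\<lambda>z. best ws i (s z))"
proof -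
  interpret S: prob_space "seeds :: (nat \<times> ('l option seed \<Rightarrow> real)) measure" by (rule prob_space_seeds)
  interpret P: pair_sigma_finite lborel "seeds :: (nat \<times> ('l option seed \<Rightarrow> real)) measure" ..
  define b where "b = Max (insert 0 ((\<lambda>w. w i) ` set ws))"
  let ?X = "\<lambda>z. best ws i (s z)"
  have X: "0 \<le> ?X z" "?X z \<le> b" for z unfolding b_def by (rule best_bounds)+
  have Xm[measurable]: "?X \<in> borel_measurable seeds"
    unfolding s_def by (rule best_measurable) (rule winner_seeds_measurable)
  show "integrable seeds ?X"
    using Xm by (rule S.integrable_const_bound[where B = b, rotated]) (use X in auto)
  define f where "f u z = indicator {0<..} u * (of_bool (u \<le> ?X z) :: real)" for u :: real and z
  have int: "integrable (lborel \<Otimes>\<^sub>M seeds) (case_prod f)"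
  proof (rule integrableI_bounded_set[where A = "{0<..b} \<times> space seeds" and B = 1])
    show "emeasure (lborel \<Otimes>\<^sub>M seeds) ({0<..b} \<times> space (seeds :: (nat \<times> ('l option seed \<Rightarrow> real)) measure)) < \<infinity>"
      using X(1) X(2) order_trans[OF X(1) X(2)]
      by (subst sigma_finite_measure.emeasure_pair_measure_Times[OF prob_space_imp_sigma_finite[OF prob_space_seeds]])
        (auto simp: S.emeasure_space_1)
    show "case_prod f \<in> borel_measurable (lborel \<Otimes>\<^sub>M seeds)" unfolding f_def by measurable
    show "AE x in lborel \<Otimes>\<^sub>M seeds. x \<notin> {0<..b} \<times> space seeds \<longrightarrow> case_prod f x = 0"
    proof (rule AE_I2, rule impI)
      fix x assume x: "x \<in> space (lborel \<Otimes>\<^sub>M (seeds :: (nat \<times> ('l option seed \<Rightarrow> real)) measure))"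
        "x \<notin> {0<..b} \<times> space seeds"
      obtain u z where uz: "x = (u, z)" by (cases x)
      have "\<not> (0 < u \<and> u \<le> b)" using x unfolding uz by (auto simp: space_pair_measure)
      then show "case_prod f x = 0" using X(2)[of z] by (auto simp: uz f_def indicator_def)
    qed
  qed (auto simp: f_def indicator_def)
  have "(\<integral>z. ?X z \<partial>seeds) = (\<integral>z. (LINT u|lborel. f u z) \<partial>seeds)"
  proof (rule Bochner_Integration.integral_cong)
    fix z
    have "f u z = indicator {0<..?X z} u" for u by (auto simp: f_def indicator_def)
    then show "?X z = (LINT u|lborel. f u z)" using X(1)[of z] by simp
  qed simp
  also have "\<dots> = (LINT u|lborel. (\<integral>z. f u z \<partial>seeds))" by (rule P.Fubini_integral[OF int])
  also have "\<dots> \<ge> (LINT u|lborel. indicator {0<..} u * (1 - Sbar (flags u (history L ws i))))"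
  proof (rule integral_mono[OF reward_integrable])
    show "integrable lborel (\<lambda>u. \<integral>z. f u z \<partial>seeds)" using P.integrable_fst[OF int] by simp
    fix u :: real
    show "indicator {0<..} u * (1 - Sbar (flags u (history L ws i))) \<le> (\<integral>z. f u z \<partial>seeds)"
    proof (cases "0 < u")
      case True
      then show ?thesis using best_probability[OF assms(1,2) True] by (simp add: f_def s_def)
    qed (simp add: f_def)
  qed
  finally show "reward (history L ws i) \<le> (\<integral>z. ?X z \<partial>seeds)"
    by (simp add: reward_def level_integral_def)
qed

theorem competitive_alg_measure: "competitive \<Gamma> alg_measure"
  unfolding competitive_def
proof (intro allI impI)
  fix L :: "'l set" and ws assume inst: "online_instance L ws"
  define s where "s z j = winner (fst z) (slot_seq L ws) j (snd z)" for z :: "nat \<times> ('l option seed \<Rightarrow> real)" and j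
  have am: "(\<lambda>A. assigned A L ws j) \<in> measurable alg_space (count_space UNIV)" if "j < length ws" for j
    unfolding assigned_def
  proof (rule decision_measurable)
    have "set (take j ws @ [ws ! j]) \<subseteq> set ws" using that by (auto dest: in_set_takeD)
    then show "online_instance L (take j ws @ [ws ! j])" using inst unfolding online_instance_def by blast
  qed
  have vm: "(\<lambda>A. alg_value A L ws) \<in> borel_measurable alg_space"
    unfolding alg_value_best by (intro borel_measurable_sum best_measurable am)
  have "\<Gamma> * max_matching_weight L ws \<le> (\<Sum>i\<in>L. reward (history L ws i))"
    by (rule reward_competitive[OF inst])
  also have "\<dots> \<le> (\<Sum>i\<in>L. \<integral>z. best ws i (s z) \<partial>seeds)"
    unfolding s_def using inst by (intro sum_mono best_expectation)
  also have "\<dots> = (\<integral>z. (\<Sum>i\<in>L. best ws i (s z)) \<partial>seeds)"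
    unfolding s_def using inst by (intro Bochner_Integration.integral_sum[symmetric] best_expectation)
  also have "\<dots> = (\<integral>z. alg_value (alg z) L ws \<partial>seeds)"
  proof (rule Bochner_Integration.integral_cong)
    fix z
    have "best ws i (s z) = best ws i (assigned (alg z) L ws)" for i
      unfolding best_def s_def by (intro arg_cong[where f = Max] image_cong) (auto simp: assigned_alg)
    then show "(\<Sum>i\<in>L. best ws i (s z)) = alg_value (alg z) L ws" by (simp add: alg_value_best)
  qed simp
  also have "\<dots> = (\<integral>A. alg_value A L ws \<partial>alg_measure)"
    unfolding alg_measure_def by (rule integral_distr[symmetric, OF alg_measurable vm])
  finally show "\<Gamma> * max_matching_weight L ws \<le> (\<integral>A. alg_value A L ws \<partial>alg_measure)" .
qed

end

section \<open>The competitive ratio\<close>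

text \<open>For \<open>c = 1 - n / m\<close> and \<open>x = \<epsilon> / m\<close> the left side is
  \<open>H n\<close>, so \<open>\<epsilon>\<close> may be rounded up. Writing
  \<open>1 - y = (1 - x) * (1 - d)\<close> reduces the claim to Bernoulli's inequality.\<close>

lemma blind_loss_mono:
  fixes x y c :: real
  assumes "x \<le> y" "y < 1" "1 \<le> n \<Longrightarrow> x + n * y \<le> 1 - c" "0 \<le> c + n * y"
  shows "(1 - x) ^ n * (c + n * x) \<le> (1 - y) ^ n * (c + n * y)"
proof (cases "n = 0")
  case False
  define d where "d = (y - x) / (1 - x)"
  have d: "d \<le> 1" "(1 - x) * (1 - d) = 1 - y" "(1 - x) * d = y - x"
    using assms(1,2) by (auto simp: d_def field_simps)
  have "1 + real n * (- d) \<le> (1 + (- d)) ^ n"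
    using d(1) by (intro Bernoulli_inequality) simp
  then have "(1 - n * d) * (c + n * y) \<le> (1 - d) ^ n * (c + n * y)"
    using assms(4) by (intro mult_right_mono) auto
  moreover have "c + n * x \<le> (1 - n * d) * (c + n * y)"
  proof -
    have "0 \<le> d" using assms(1,2) by (simp add: d_def)
    then have "n * d * (c + n * y) \<le> n * d * (1 - x)"
      using assms(3) False by (intro mult_left_mono) auto
    also have "\<dots> = n * (y - x)" using d(3) by (metis mult.assoc mult.commute)
    finally show ?thesis by (simp add: algebra_simps)
  qed
  ultimately have "(1 - x) ^ n * (c + n * x) \<le> (1 - x) ^ n * ((1 - d) ^ n * (c + n * y))"
    using assms(1,2) by (intro mult_left_mono) auto
  also have "\<dots> = (1 - y) ^ n * (c + n * y)"
    by (simp add: d(2)[symmetric] power_mult_distrib)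
  finally show ?thesis .
qed simp

text \<open>
  The bound \<open>H\<close> on the loss probability of a cell, for 25 slots per round and cells of 15 units,
  with \<open>\<epsilon> = (14 / 15) ^ 25\<close> rounded up to 0.18.
\<close>

definition cell_weight :: "nat \<Rightarrow> real" where
  "cell_weight n = (1241 / 1250) ^ n * (1 - n * (41 / 1250))"

text \<open>With \<open>a = 1 - 0.18 / 25 = 1241 / 1250\<close> and
  \<open>b = 0.82 / 25 = 41 / 1250\<close>, the two fractions are \<open>1 - a + a * b\<close> and
  \<open>(1 - a) * b\<close>.\<close>

lemma cell_weight_decrement:
  "cell_weight n - cell_weight (Suc n) = (1241 / 1250) ^ n * (62131 / 1562500 - n * (369 / 1562500))"
proof -
  have "a ^ n * (1 - n * b) - a ^ Suc n * (1 - Suc n * b) = a ^ n * ((1 - a + a * b) - n * ((1 - a) * b))" for a b :: real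
    by (simp add: algebra_simps)
  from this[of "1241 / 1250" "41 / 1250"] show ?thesis unfolding cell_weight_def by simp
qed

text \<open>For 25 slots, 15 is the largest cell length that satisfies \<open>half\<close>: its left
  side is about 12.33, against the bound 12.5, and length 16 would give about 12.81.\<close>

lemma cell_params_25_15: "cell_params 25 15"
proof
  show "(1 - (1 - 1 / real 15) ^ 25) * real 15 \<le> real 25 / 2" by (simp add: power_divide)
qed auto

lemma unsel_bound_25_15: "unsel_bound 25 15 cell_weight"
proof
  fix n :: nat
  show "n \<le> 15 \<Longrightarrow> 0 \<le> cell_weight n"
    by (simp add: cell_weight_def)
  show "cell_weight (Suc n) \<le> cell_weight n" if "n < 15"
  proof -
    have "0 \<le> (1241 / 1250 :: real) ^ n * (62131 / 1562500 - n * (369 / 1562500))"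
      using that by (intro mult_nonneg_nonneg) auto
    then show ?thesis unfolding cell_weight_decrement[symmetric] by simp
  qed
  show "cell_weight (Suc n) - cell_weight (Suc (Suc n)) \<le> cell_weight n - cell_weight (Suc n)" if "Suc n < 15"
    unfolding cell_weight_decrement using that by (intro mult_mono power_decreasing) auto
  have "a ^ Suc n * (1 - Suc n * b) \<le> a ^ n * (1 - n * b) * (a * (1 - b))" if "0 \<le> a" "0 \<le> b" for a b :: real
  proof -
    have "a ^ Suc n * (1 - Suc n * b) \<le> a ^ Suc n * ((1 - n * b) * (1 - b))"
      using that by (intro mult_left_mono) (auto simp: algebra_simps)
    then show ?thesis by (simp add: mult_ac)
  qed
  from this[of "1241 / 1250" "41 / 1250"] show "cell_weight (Suc n) \<le> cell_weight n * cell_weight 1"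
    by (simp add: cell_weight_def)
qed (auto simp: cell_weight_def)

lemma sum_sum_lessThan:
  "(\<Sum>k<l. \<Sum>t<l - k. f t) = (\<Sum>t<l. real (l - t) * f t)" for f :: "nat \<Rightarrow> real"
proof (induction l)
  case (Suc l)
  have "(\<Sum>k<Suc l. \<Sum>t<Suc l - k. f t) = (\<Sum>t<Suc l. f t) + (\<Sum>k<l. \<Sum>t<l - k. f t)"
    by (simp add: sum.lessThan_Suc_shift del: sum.lessThan_Suc)
  also have "\<dots> = (\<Sum>t<Suc l. f t) + (\<Sum>t<Suc l. real (l - t) * f t)"
    by (simp add: Suc)
  also have "\<dots> = (\<Sum>t<Suc l. real (Suc l - t) * f t)"
    unfolding sum.distrib[symmetric] by (intro sum.cong) (auto simp: Suc_diff_le algebra_simps)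
  finally show ?case .
qed simp

lemma ratio_25_15: "0.5368 \<le> unsel_bound.\<Gamma> 25 15 cell_weight"
proof -
  interpret unsel_bound 25 15 cell_weight by (rule unsel_bound_25_15)
  have \<theta>: "\<theta> = 25 / 26" by (simp add: \<theta>_def)
  have x: "(25 / 26 :: real) ^ t * (1241 / 1250) ^ t = (1241 / 1300) ^ t" for t
    by (simp add: power_mult_distrib[symmetric])
  have gain: "\<theta> ^ Suc t * gain t = (1241 / 1300) ^ t * (62131 / 1625000 - t * (369 / 1625000))" for t
  proof -
    have "\<theta> ^ Suc t * gain t
        = ((25 / 26) ^ t * (1241 / 1250) ^ t) * (25 / 26 * (62131 / 1562500 - t * (369 / 1562500)))"
      unfolding \<theta> gain_def cell_weight_decrement by simp
    then show ?thesis unfolding x by (simp add: right_diff_distrib mult_ac)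
  qed
  have G: "\<theta> ^ t * cell_weight t = (1241 / 1300) ^ t * (1 - t * (41 / 1250))" for t
    unfolding \<theta> cell_weight_def x[symmetric] by simp
  \<comment> \<open>Rounding \<open>V0\<close> first keeps its quotient out of the final estimate,
    in which \<open>V0\<close> has a nonnegative coefficient.\<close>
  have V: "0.545 \<le> V0"
  proof -
    have "0.545 * (1 - \<theta> ^ 15 * cell_weight 15) \<le> (\<Sum>t<15. \<theta> ^ Suc t * gain t)"
      unfolding gain G by (simp add: eval_nat_numeral)
    then show ?thesis using denom_pos by (simp add: V0_def le_divide_eq)
  qed
  have "15 * 0.5368 \<le> (\<Sum>t<15. real (15 - t) * (\<theta> ^ Suc t * gain t))
      + 0.545 * (\<Sum>k<15. \<theta> ^ (15 - k) * cell_weight (15 - k))"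
    unfolding gain G by (simp add: eval_nat_numeral)
  also have "\<dots> \<le> (\<Sum>t<15. real (15 - t) * (\<theta> ^ Suc t * gain t))
      + V0 * (\<Sum>k<15. \<theta> ^ (15 - k) * cell_weight (15 - k))"
    using V theta G_nonneg by (intro add_left_mono mult_right_mono sum_nonneg mult_nonneg_nonneg) auto
  also have "\<dots> = (\<Sum>k<15. Pv (15 - k) 0)"
    by (simp add: Pv_def sum.distrib sum_sum_lessThan sum_distrib_left mult_ac)
  finally show ?thesis by (simp add: \<Gamma>_def)
qed

lemma online_selection_25_15: "online_selection 25 15 cell_weight"
proof -
  interpret cell_params 25 15 by (rule cell_params_25_15)
  interpret unsel_bound 25 15 cell_weight by (rule unsel_bound_25_15)
  show "online_selection 25 15 cell_weight"
  proof
    fix n :: nat assume n: "n \<le> 15"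
    \<comment> \<open>The exact value \<open>(14 / 15) ^ 25\<close> is about 0.1782.\<close>
    have "\<epsilon> \<le> 0.18" by (simp add: \<epsilon>_def \<rho>_def power_divide)
    moreover have "H n = (1 - \<epsilon> / 25) ^ n * ((1 - n / 25) + n * (\<epsilon> / 25))"
      unfolding H_def \<eta>_def by (intro arg_cong2[where f = "(*)"]) (auto simp: field_simps)
    moreover have "cell_weight n = (1 - 0.0072) ^ n * ((1 - n / 25) + n * 0.0072)"
      by (simp add: cell_weight_def algebra_simps)
    ultimately show "H n \<le> cell_weight n"
      using blind_loss_mono[of "\<epsilon> / 25" "0.0072" n "1 - n / 25"] n by simp
  qed
qed

lemma max_matching_weight_nonneg:
  assumes "online_instance L ws"
  shows "0 \<le> max_matching_weight L ws"
  unfolding max_matching_weight_def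
proof (rule Max_ge)
  show "finite ((\<lambda>E. \<Sum>(i, j)\<in>E. (ws ! j) i) ` matchings L ws)"
    using assms finite_matchings by (auto simp: online_instance_def)
  show "0 \<in> (\<lambda>E. \<Sum>(i, j)\<in>E. (ws ! j) i) ` matchings L ws"
    using empty_in_matchings by force
qed

theorem mainTheorem1:
  "\<exists>M :: 'l det_online_alg measure. randomized_online_algorithm M \<and> competitive 0.5368 M"
proof (intro exI conjI)
  interpret S: online_selection 25 15 cell_weight by (rule online_selection_25_15)
  show "randomized_online_algorithm (S.alg_measure :: 'l det_online_alg measure)"
    by (rule S.randomized_alg_measure)
  show "competitive 0.5368 (S.alg_measure :: 'l det_online_alg measure)"
    unfolding competitive_def
  proof (intro allI impI)
    fix L :: "'l set" and ws assume inst: "online_instance L ws"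
    have "0.5368 * max_matching_weight L ws \<le> S.\<Gamma> * max_matching_weight L ws"
      by (intro mult_right_mono ratio_25_15 max_matching_weight_nonneg inst)
    also have "\<dots> \<le> (\<integral>A. alg_value A L ws \<partial>S.alg_measure)"
      using S.competitive_alg_measure inst unfolding competitive_def by blast
    finally show "0.5368 * max_matching_weight L ws \<le> (\<integral>A. alg_value A L ws \<partial>S.alg_measure)" .
  qed
qed

end
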